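(* Let $R$ be a commutative, unital, complex, semisimple Banach algebra with an involution $\cdot^\star$, and let $M(R)$ be its maximal ideal space. Let $\gamma>0$, and let $A\in R^{n\times n}$, $B\in R^{n\times m}$, $C\in R^{p\times n}$, $D_1\in R^{p\times m}$, $D_2\in R^{p\times \ell}$, $E\in R^{n\times \ell}$. Suppose that for all $\varphi\in M(R)$ the following hold: (i) $\widehat{(A^\star)}(\varphi)=(\widehat{A}(\varphi))^*$, $\widehat{(B^\star)}(\varphi)=(\widehat{B}(\varphi))^*$, $\widehat{(C^\star)}(\varphi)=(\widehat{C}(\varphi))^*$, $\widehat{(D_1^\star)}(\varphi)=(\widehat{D_1}(\varphi))^*$, $\widehat{(D_2^\star)}(\varphi)=(\widehat{D_2}(\varphi))^*$, $\widehat{(E^\star)}(\varphi)=(\widehat{E}(\varphi))^*$; (ii) $(\widehat{A}(\varphi),\widehat{B}(\varphi),\widehat{C}(\varphi),\widehat{D_1}(\varphi))$ is left invertible; (iii) there exist complex matrices $F_1(\varphi)\in\mathbb{C}^{m\times n}$ and $F_2(\varphi)\in\mathbb{C}^{m\times \ell}$ such that $\widehat{A}(\varphi)+\widehat{B}(\varphi)F_1(\varphi)$ is exponentially stable and (suppressing the argument $\varphi$) $$\left\|(\widehat{C}+\widehat{D_1}F_1)(sI-\widehat{A}-\widehat{B}F_1)^{-1}(\widehat{E}+\widehat{B}F_2)+\widehat{D_2}+\widehat{D_1}F_2\right\|_\infty<\gamma;$$ (iv) $(\widehat{A}(\varphi),\widehat{B}(\varphi),\widehat{C}(\varphi),\widehat{D_1}(\varphi))$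 has no invariant zeros on the imaginary axis; (v) $\ker(\widehat{D_1}(\varphi))=\{0\}$. Then there exists $P\in R^{n\times n}$ such that: (1) $$0=A^\star P+PA+C^\star C-\begin{bmatrix} PB+C^\star D_1 & PE+C^\star D_2\end{bmatrix}\begin{bmatrix} D_1^\star D_1 & D_1^\star D_2\\ D_2^\star D_1 & D_2^\star D_2-\gamma^2 I\end{bmatrix}^{-1}\begin{bmatrix} B^\star P+D_1^\star C\\ E^\star P+D_2^\star C\end{bmatrix};$$ (2) the matrix $$A_{\mathrm{cl}}:=A-\begin{bmatrix} B & E\end{bmatrix}\begin{bmatrix} D_1^\star D_1 & D_1^\star D_2\\ D_2^\star D_1 & D_2^\star D_2-\gamma^2 I\end{bmatrix}^{-1}\begin{bmatrix} B^\star P+D_1^\star C\\ E^\star P+D_2^\star C\end{bmatrix}\in R^{n\times n}$$ is exponentially stable; (3) for all $\varphi\in M(R)$, $\widehat{P}(\varphi)$ is positive semidefinite.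
   Context: $M(R)$ denotes the maximal ideal space of $R$ (the nonzero multiplicative linear functionals $\varphi:R\to\mathbb{C}$), equipped with the weak-$\ast$ topology. The Gelfand transform of $x\in R$ is $\widehat{x}(\varphi)=\varphi(x)$, $\varphi\in M(R)$. For a matrix $M=[m_{ij}]\in R^{p\times m}$: $M^\star:=[m_{ji}^\star]\in R^{m\times p}$ and $\widehat{M}:=[\widehat{m_{ij}}]$, a matrix of continuous functions on $M(R)$. For a complex matrix $N=[n_{ij}]\in\mathbb{C}^{p\times m}$, $N^*:=[\overline{n_{ji}}]\in\mathbb{C}^{m\times p}$ is the usual adjoint; in particular $(\widehat{M}(\varphi))^*=[\overline{\widehat{m_{ji}}(\varphi)}]$. Exponential stability over $R$: $R^n$ carries the norm $\|x\|=\max_k\|x_k\|$, and $R^{n\times n}$ carries the norm $\|A\|=\sup\{\|Av\|: v\in R^n,\ \|v\|\le 1\}$, i.e. the operator norm of $v\mapsto Av$ on $R^n$. For $A\in R^{n\times n}$, $e^{A}=\sum_{k\ge 0}\frac{1}{k!}A^k$. $A\in R^{n\times n}$ is exponentially stable if there exist constants $K,\epsilon>0$ such that $\|e^{tA}\|\le Ke^{-\epsilon t}$ for all $t\ge 0$. A complex square matrix is exponentially stable if all its eigenvalues have negative real part. For complex matrices $A\in\mathbb{C}^{n\times n}$, $B\in\mathbb{C}^{n\times m}$, $C\in\mathbb{C}^{p\times n}$, $D\in\mathbb{C}^{p\times m}$: the tuple $(A,B,C,D)$ is left invertible if the transfer matrix $C(sI-A)^{-1}B+D$ is left invertible as a matrix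 over the field of rational functions in $s$; an invariant zero of $(A,B,C,D)$ is a number $s_0\in\mathbb{C}$ at which the rank of $\begin{bmatrix} s_0I-A & -B\\ C & D\end{bmatrix}$ is strictly less than the rank of $\begin{bmatrix} sI-A & -B\\ C & D\end{bmatrix}$ as a matrix over the field of rational functions in $s$. The norm $\|\cdot\|_\infty$ of a matrix-valued function of $s$ is the $H^\infty$ norm, i.e. the supremum over $\mathrm{Re}(s)>0$ of the operator norm (largest singular value) of its value at $s$. The inverse of the $2\times 2$ block matrix in (1) and (2) is taken in $R^{(m+\ell)\times(m+\ell)}$; its existence is part of the assertion. *)

theory Defs
  imports "HOL-Analysis.Analysis" "HOL-Computational_Algebra.Fraction_Field"
    "HOL-Computational_Algebra.Polynomial"
begin

section \<open>Commutative unital complex Banach algebras\<close>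

text \<open>
  The library has only real Banach algebras, so complex scalar multiplication is added here.
  The normalization \<open>norm 1 = 1\<close> is not imposed.
\<close>

class comm_complex_banach_algebra_1 =
  comm_ring_1 + real_algebra_1 + real_normed_algebra + banach +
  fixes scaleC :: "complex \<Rightarrow> 'a \<Rightarrow> 'a"  (infixr \<open>*\<^sub>C\<close> 75)
  assumes scaleC_add_right: "a *\<^sub>C (x + y) = a *\<^sub>C x + a *\<^sub>C y"
    and scaleC_add_left: "(a + b) *\<^sub>C x = a *\<^sub>C x + b *\<^sub>C x"
    and scaleC_scaleC: "a *\<^sub>C (b *\<^sub>C x) = (a * b) *\<^sub>C x"
    and scaleC_of_real: "complex_of_real r *\<^sub>C x = r *\<^sub>R x"
    and mult_scaleC_left: "(a *\<^sub>C x) * y = a *\<^sub>C (x * y)"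
    and norm_scaleC: "norm (a *\<^sub>C x) = cmod a * norm x"

definition is_ideal :: "'a::comm_ring_1 set \<Rightarrow> bool" where
  "is_ideal I \<longleftrightarrow> 0 \<in> I \<and> (\<forall>x\<in>I. \<forall>y\<in>I. x + y \<in> I) \<and> (\<forall>r. \<forall>x\<in>I. r * x \<in> I)"

definition is_maximal_ideal :: "'a::comm_ring_1 set \<Rightarrow> bool" where
  "is_maximal_ideal I \<longleftrightarrow> is_ideal I \<and> I \<noteq> UNIV \<and>
     (\<forall>J. is_ideal J \<longrightarrow> I \<subseteq> J \<longrightarrow> J = I \<or> J = UNIV)"

definition semisimple :: "'a::comm_complex_banach_algebra_1 itself \<Rightarrow> bool" where
  "semisimple _ \<longleftrightarrow> \<Inter>{I :: 'a set. is_maximal_ideal I} = {0}"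

text \<open>An involution is not assumed to be isometric, nor to satisfy \<open>\<phi> (star x) = cnj (\<phi> x)\<close>.\<close>

definition is_involution :: "('a::comm_complex_banach_algebra_1 \<Rightarrow> 'a) \<Rightarrow> bool" where
  "is_involution star \<longleftrightarrow>
     (\<forall>x y. star (x + y) = star x + star y) \<and>
     (\<forall>a x. star (a *\<^sub>C x) = cnj a *\<^sub>C star x) \<and>
     (\<forall>x y. star (x * y) = star y * star x) \<and>
     (\<forall>x. star (star x) = x)"

definition max_ideal_space :: "('a::comm_complex_banach_algebra_1 \<Rightarrow> complex) set" where
  "max_ideal_space = {\<phi>.
     (\<forall>x y. \<phi> (x + y) = \<phi> x + \<phi> y) \<and>
     (\<forall>a x. \<phi> (a *\<^sub>C x) = a * \<phi> x) \<and>
     (\<forall>x y. \<phi> (x * y) = \<phi> x * \<phi> y) \<and>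
     (\<exists>x. \<phi> x \<noteq> 0)}"

definition gelfand :: "'a \<Rightarrow> ('a \<Rightarrow> complex) \<Rightarrow> complex" where
  "gelfand x \<phi> = \<phi> x"

definition gelfand_mat :: "'a^'n^'m \<Rightarrow> ('a \<Rightarrow> complex) \<Rightarrow> complex^'n^'m" where
  "gelfand_mat M \<phi> = map_matrix (\<lambda>x. gelfand x \<phi>) M"

definition star_mat :: "('a \<Rightarrow> 'a) \<Rightarrow> 'a^'m^'p \<Rightarrow> 'a^'p^'m" where
  "star_mat star M = map_matrix star (transpose M)"

definition adj_mat :: "complex^'m^'p \<Rightarrow> complex^'p^'m" where
  "adj_mat N = map_matrix cnj (transpose N)"


section \<open>Block matrices, indexed by sum types\<close>

definition hblock :: "'a^'m^'n \<Rightarrow> 'a^'l^'n \<Rightarrow> 'a^('m + 'l)^'n" where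
  "hblock M N = (\<chi> i j. case j of Inl a \<Rightarrow> M $ i $ a | Inr b \<Rightarrow> N $ i $ b)"

definition vblock :: "'a^'n^'m \<Rightarrow> 'a^'n^'l \<Rightarrow> 'a^'n^('m + 'l)" where
  "vblock M N = (\<chi> i. case i of Inl a \<Rightarrow> M $ a | Inr b \<Rightarrow> N $ b)"

definition block22 ::
  "'a^'m^'n \<Rightarrow> 'a^'l^'n \<Rightarrow> 'a^'m^'k \<Rightarrow> 'a^'l^'k \<Rightarrow> 'a^('m + 'l)^('n + 'k)" where
  "block22 M11 M12 M21 M22 = vblock (hblock M11 M12) (hblock M21 M22)"


section \<open>Exponential stability\<close>

definition vec_max_norm :: "'a::real_normed_vector^'n \<Rightarrow> real" where
  "vec_max_norm x = (MAX k. norm (x $ k))"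

definition mat_op_norm :: "'a::{real_algebra_1, real_normed_algebra}^'n^'n \<Rightarrow> real" where
  "mat_op_norm A = (SUP v\<in>{v. vec_max_norm v \<le> 1}. vec_max_norm (A *v v))"

text \<open>
  The library's multiplication on \<open>'a^'n^'n\<close> is entrywise, so powers are iterates of \<open>(**)\<close>.
  The series below is taken in the entrywise topology on \<open>'a^'n^'n\<close>, which is the one
  induced by \<open>mat_op_norm\<close>.
\<close>

definition mat_pow :: "'a::semiring_1^'n^'n \<Rightarrow> nat \<Rightarrow> 'a^'n^'n" where
  "mat_pow A k = (((**) A) ^^ k) (mat 1)"

definition mat_exp :: "'a::{real_algebra_1, real_normed_algebra}^'n^'n \<Rightarrow> 'a^'n^'n" where
  "mat_exp A = (\<Sum>k. (1 / fact k) *\<^sub>R mat_pow A k)"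

definition exp_stable :: "'a::{real_algebra_1, real_normed_algebra}^'n^'n \<Rightarrow> bool" where
  "exp_stable A \<longleftrightarrow>
     (\<exists>K>0. \<exists>\<epsilon>>0. \<forall>t\<ge>0. mat_op_norm (mat_exp (t *\<^sub>R A)) \<le> K * exp (- \<epsilon> * t))"

definition is_eigenvalue :: "complex^'n^'n \<Rightarrow> complex \<Rightarrow> bool" where
  "is_eigenvalue A z \<longleftrightarrow> (\<exists>v. v \<noteq> 0 \<and> A *v v = z *s v)"

definition complex_exp_stable :: "complex^'n^'n \<Rightarrow> bool" where
  "complex_exp_stable A \<longleftrightarrow> (\<forall>z. is_eigenvalue A z \<longrightarrow> Re z < 0)"


section \<open>Linear systems over the complex numbers\<close>

text \<open>The field of rational functions is \<open>complex poly fract\<close>.\<close>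

definition ratfun_var :: "complex poly fract" where
  "ratfun_var = Fract [:0, 1:] 1"

definition ratfun_const :: "complex \<Rightarrow> complex poly fract" where
  "ratfun_const c = Fract [:c:] 1"

text \<open>
  Transfer matrix and system pencil are defined over an arbitrary field \<open>'k\<close>: they are used both
  with a complex number \<open>s\<close> and with the indeterminate \<open>s = ratfun_var\<close>.
\<close>

definition transfer_mat ::
  "'k::field^'n^'n \<Rightarrow> 'k^'m^'n \<Rightarrow> 'k^'n^'p \<Rightarrow> 'k^'m^'p \<Rightarrow> 'k \<Rightarrow> 'k^'m^'p" where
  "transfer_mat A B C D s = C ** matrix_inv (mat s - A) ** B + D"

definition system_pencil ::
  "'k::field^'n^'n \<Rightarrow> 'k^'m^'n \<Rightarrow> 'k^'n^'p \<Rightarrow> 'k^'m^'p \<Rightarrow> 'k \<Rightarrow> 'k^('n + 'm)^('n + 'p)" where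
  "system_pencil A B C D s = block22 (mat s - A) (- B) C D"

definition left_invertible_system ::
  "complex^'n^'n \<Rightarrow> complex^'m^'n \<Rightarrow> complex^'n^'p \<Rightarrow> complex^'m^'p \<Rightarrow> bool" where
  "left_invertible_system A B C D \<longleftrightarrow>
     (\<exists>X. X ** transfer_mat (map_matrix ratfun_const A) (map_matrix ratfun_const B)
             (map_matrix ratfun_const C) (map_matrix ratfun_const D) ratfun_var = mat 1)"

definition invariant_zero ::
  "complex^'n^'n \<Rightarrow> complex^'m^'n \<Rightarrow> complex^'n^'p \<Rightarrow> complex^'m^'p \<Rightarrow> complex \<Rightarrow> bool" where
  "invariant_zero A B C D s0 \<longleftrightarrow>
     rank (system_pencil A B C D s0) <
     rank (system_pencil (map_matrix ratfun_const A) (map_matrix ratfun_const B)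
             (map_matrix ratfun_const C) (map_matrix ratfun_const D) ratfun_var)"

text \<open>
  \<open>onorm\<close> is taken with respect to the Euclidean norms, so it is the largest singular value.
  The supremum is formed in \<open>ereal\<close>, so that it is meaningful for unbounded functions.
\<close>

definition hinf_norm :: "(complex \<Rightarrow> complex^'l^'p) \<Rightarrow> ereal" where
  "hinf_norm G = (SUP s\<in>{s. Re s > 0}. ereal (onorm ((*v) (G s))))"

definition pos_semidef :: "complex^'n^'n \<Rightarrow> bool" where
  "pos_semidef N \<longleftrightarrow> adj_mat N = N \<and>
     (\<forall>x. 0 \<le> Re (\<Sum>i\<in>UNIV. cnj (x $ i) * (N *v x) $ i))"

end

theory Submission
  imports Defs "HOL-Computational_Algebra.Fundamental_Theorem_Algebra"
begin

text \<open>
  Pointwise on the maximal ideal space, the stabilizing solution of the Riccati equation is the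
  matrix whose graph is the stable invariant subspace of a Hamiltonian matrix \<open>H\<close>. The hypotheses
  exclude imaginary eigenvalues of the Gelfand transform of \<open>H\<close> at every character, so the spectral
  projection of \<open>H\<close> onto the left half plane exists in the matrix algebra over \<open>R\<close> itself: it is the
  limit of \<open>(1 - exp (2^k H))\<^sup>-\<^sup>1\<close>. Over the complex numbers, the stable subspace is a graph because a
  Lyapunov function, built from the bounded real lemma for the system after a preliminary feedback,
  vanishes on the vectors that violate this; the same function shows that the solution is positive
  semidefinite. As \<open>H\<close> is Hamiltonian, the adjoint of the projection \<open>Q\<close> is \<open>1 + J Q J\<close>, so the
  solution is a rational expression in \<open>Q\<close> that makes sense over \<open>R\<close>, and semisimplicity transfers
  the pointwise identities to \<open>R\<close>.
\<close>

section \<open>Gelfand theory\<close>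

text \<open>The obstacle is that solving the Riccati equation at each character yields only a
  function of the character, with no reason for its entries to be Gelfand transforms of elements of
  the algebra. So choices that depend on the character, such as the feedbacks \<open>F1\<close> and
  \<open>F2\<close>, are confined to pointwise arguments, while the weight, the Hamiltonian matrix,
  \<open>Q\<close> and \<open>P\<close> are built once over the algebra. The shape of the limit
  comes from the scalar case: 1 / (1 - exp (2^k l)) tends to 1 if Re l < 0 and to 0 if Re l > 0. The
  exponential carries the imaginary axis to the unit circle, where averages over roots of unity
  replace contour integrals. The inverses exist because characters detect units, which passes to
  matrices through determinants. The formula for \<open>P\<close> must avoid the adjoint of
  \<open>Q\<close>, since compatibility of the involution with conjugation is given for the six data
  matrices only.\<close>

instantiation complex :: comm_complex_banach_algebra_1
begin
definition scaleC_complex :: "complex \<Rightarrow> complex \<Rightarrow> complex" where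
  "scaleC_complex = (*)"
instance
  by standard (simp_all add: scaleC_complex_def algebra_simps norm_mult scaleR_conv_of_real)
end

lemma scaleC_1 [simp]: "1 *\<^sub>C x = (x::'a::comm_complex_banach_algebra_1)"
  using scaleC_of_real[of 1 x] by simp

lemma scaleC_0_left [simp]: "0 *\<^sub>C x = (0::'a::comm_complex_banach_algebra_1)"
  using scaleC_of_real[of 0 x] by simp

lemma scaleC_0_right [simp]: "a *\<^sub>C 0 = (0::'a::comm_complex_banach_algebra_1)"
  using scaleC_add_right[of a 0 "0::'a"] by simp

lemma scaleC_minus_left [simp]: "(- a) *\<^sub>C x = - (a *\<^sub>C (x::'a::comm_complex_banach_algebra_1))"
  using scaleC_add_left[of a "-a" x] by (simp add: eq_neg_iff_add_eq_0 add.commute)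

lemma scaleC_minus_right [simp]: "a *\<^sub>C (- x) = - (a *\<^sub>C (x::'a::comm_complex_banach_algebra_1))"
  using scaleC_add_right[of a "-x" x] by (simp add: eq_neg_iff_add_eq_0)

lemma scaleC_diff_left: "(a - b) *\<^sub>C x = a *\<^sub>C x - b *\<^sub>C (x::'a::comm_complex_banach_algebra_1)"
  using scaleC_add_left[of a "-b" x] by simp

lemma scaleC_diff_right: "a *\<^sub>C (x - y) = a *\<^sub>C x - a *\<^sub>C (y::'a::comm_complex_banach_algebra_1)"
  using scaleC_add_right[of a x "-y"] by simp

lemma mult_scaleC_right: "x * (a *\<^sub>C y) = a *\<^sub>C (x * (y::'a::comm_complex_banach_algebra_1))"
  using mult_scaleC_left[of a y x] by (simp add: mult.commute)

lemma half_scaleC_double: "(1/2::complex) *\<^sub>C (x + x) = (x::'a::comm_complex_banach_algebra_1)"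
proof -
  have "(1/2::complex) *\<^sub>C (x + x) = (1/2 + 1/2) *\<^sub>C x"
    by (simp only: scaleC_add_right scaleC_add_left)
  then show ?thesis by simp
qed

lemma power_dyadic_tendsto_0:
  fixes r :: real
  assumes "\<bar>r\<bar> < 1"
  shows "(\<lambda>k. r ^ (2^k)) \<longlonglongrightarrow> 0"
  by (rule LIMSEQ_subseq_LIMSEQ[OF LIMSEQ_power_zero, of r "\<lambda>k. 2^k", unfolded o_def])
    (use assms in \<open>auto simp: strict_mono_def\<close>)

lemma compact_locally_bounded_imp_bounded:
  fixes f :: "'x::metric_space \<Rightarrow> real"
  assumes "compact S" and loc: "\<And>x. x \<in> S \<Longrightarrow> \<exists>e>0. \<exists>B. \<forall>y\<in>S. dist x y < e \<longrightarrow> f y \<le> B"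
  obtains B where "\<And>y. y \<in> S \<Longrightarrow> f y \<le> B"
proof -
  from loc obtain e B where e: "\<And>x. x \<in> S \<Longrightarrow> e x > 0"
    and B: "\<And>x y. x \<in> S \<Longrightarrow> y \<in> S \<Longrightarrow> dist x y < e x \<Longrightarrow> f y \<le> B x"
    by metis
  have "S \<subseteq> (\<Union>x\<in>S. ball x (e x))"
    using e by force
  from compactE_image[OF assms(1) _ this] obtain C where
    C: "C \<subseteq> S" "finite C" "S \<subseteq> (\<Union>x\<in>C. ball x (e x))" by (metis open_ball)
  show ?thesis
  proof
    fix y assume y: "y \<in> S"
    then obtain x where x: "x \<in> C" "dist x y < e x" using C(3) by auto
    then have "f y \<le> B x" using B y C(1) by blast
    also have "\<dots> \<le> Max (B ` C)" using x C(2) by simp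
    finally show "f y \<le> Max (B ` C)" .
  qed
qed

text \<open>An inverse of \<open>1 - a\<^sup>2\<close> is the average of inverses of \<open>1 - a\<close> and \<open>1 + a\<close>. Iterating this
  gives the average of the inverses of \<open>1 - \<omega> y\<close> over the \<open>2^k\<close>-th roots of unity \<open>\<omega>\<close>, an
  elementary substitute for the Cauchy integral of the resolvent.\<close>

locale algebra_seminorm =
  fixes q :: "'a::comm_complex_banach_algebra_1 \<Rightarrow> real"
  assumes q_add: "q (a + b) \<le> q a + q b"
    and q_mult: "q (a * b) \<le> q a * q b"
    and q_scale: "q (c *\<^sub>C a) \<le> cmod c * q a"
begin

lemma q_0 [simp]: "q 0 = 0"
proof -
  have "q 0 \<le> 0" using q_scale[of 0 0] by simp
  moreover have "q 0 \<ge> 0" using q_add[of 0 0] by simp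
  ultimately show ?thesis by simp
qed

lemma q_uminus [simp]: "q (- a) = q a"
proof -
  have "q (- a) \<le> q a" for a using q_scale[of "-1" a] by simp
  from this[of a] this[of "-a"] show ?thesis by simp
qed

lemma q_nonneg [simp]: "q a \<ge> 0"
  using q_add[of a "-a"] by simp

lemma q_diff: "q (a - b) \<le> q a + q b"
  using q_add[of a "-b"] by simp

lemma q_minus_commute: "q (a - b) = q (b - a)"
  using q_uminus[of "a - b"] by simp

lemma q_power:
  assumes "n > 0"
  shows "q (a ^ n) \<le> q a ^ n"
  using assms
proof (induction n rule: nat_induct_non_zero)
  case (Suc n)
  have "q (a ^ Suc n) \<le> q a * q (a ^ n)" using q_mult[of a "a ^ n"] by simp
  also have "\<dots> \<le> q a * q a ^ n" using Suc by (intro mult_left_mono) auto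
  finally show ?case by simp
qed simp

lemma q_null_mult: "q a = 0 \<Longrightarrow> q (a * b) = 0" "q a = 0 \<Longrightarrow> q (b * a) = 0"
  using q_mult[of a b] q_mult[of b a] q_nonneg[of "a * b"] q_nonneg[of "b * a"]
  by (simp_all add: order_antisym)

lemma q_null_add: "q a = 0 \<Longrightarrow> q b = 0 \<Longrightarrow> q (a + b) = 0"
  using q_add[of a b] q_nonneg[of "a + b"] by linarith

lemma q_null_diff: "q a = 0 \<Longrightarrow> q b = 0 \<Longrightarrow> q (a - b) = 0"
  using q_null_add[of a "-b"] by simp

lemma q_null_scale: "q a = 0 \<Longrightarrow> q (c *\<^sub>C a) = 0"
  using q_scale[of c a] q_nonneg[of "c *\<^sub>C a"] by simp

lemma q_cong: "q (a - b) = 0 \<Longrightarrow> q a = q b"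
  using q_add[of "a - b" b] q_add[of "b - a" a] q_minus_commute[of a b] by simp

text \<open>\<open>u\<close> and \<open>v\<close> are inverses only up to elements of seminorm 0,
  which is how inverses in a quotient algebra appear here. The difference \<open>u - v\<close>
  agrees with (\<theta> - \<tau>) y u v up to such an element.\<close>

lemma resolvent_identity:
  assumes "q (u * (1 - \<theta> *\<^sub>C y) - 1) = 0" "q (v * (1 - \<tau> *\<^sub>C y) - 1) = 0"
  shows "q (u - v) \<le> cmod (\<theta> - \<tau>) * q y * q u * q v"
proof -
  define w where "w = (\<theta> - \<tau>) *\<^sub>C (y * u * v)"
  have "u - v - w = v * (u * (1 - \<theta> *\<^sub>C y) - 1) - u * (v * (1 - \<tau> *\<^sub>C y) - 1)"
    unfolding w_def by (simp add: algebra_simps mult_scaleC_left mult_scaleC_right scaleC_diff_left)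
  then have "q (u - v - w) = 0"
    by (simp only: q_null_diff q_null_mult assms)
  then have "q (u - v) = q w" by (rule q_cong)
  also have "\<dots> \<le> cmod (\<theta> - \<tau>) * q (y * u * v)" unfolding w_def by (rule q_scale)
  also have "q (y * u * v) \<le> q y * q u * q v"
    by (meson order.trans mult_right_mono q_mult q_nonneg)
  finally show ?thesis by (simp add: mult.assoc mult_left_mono)
qed

lemma average_inverse:
  assumes "q (u * (1 - a) - 1) = 0" "q (v * (1 + a) - 1) = 0"
  shows "q ((1/2) *\<^sub>C (u + v) * (1 - a * a) - 1) = 0"
proof -
  have h: "(1/2::complex) *\<^sub>C (1 + 1 :: 'a) = 1" by (rule half_scaleC_double)
  have "(1/2) *\<^sub>C (u + v) * (1 - a * a) - 1 =
    (1/2) *\<^sub>C ((u * (1 - a) - 1) * (1 + a) + (v * (1 + a) - 1) * (1 - a)) + ((1/2::complex) *\<^sub>C (1 + 1 :: 'a) - 1)"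
    by (simp add: algebra_simps mult_scaleC_left mult_scaleC_right scaleC_diff_right scaleC_add_right)
  then show ?thesis
    by (simp only: h q_null_scale q_null_add q_null_mult assms diff_self q_0)
qed

text \<open>A Liouville argument without integrals. The averaged resolvent at \<open>s\<close>, an
  inverse of 1 - s^(2^k) y^(2^k), has a radial Lipschitz bound independent of \<open>k\<close>,
  because averaging does not enlarge it. If r^(2^k) y^(2^k) tends to 0 at one radius, the average
  there is close to 1; it is then still close to 1 at a slightly larger radius, which bounds the
  powers there. The good radii thus grow by a fixed factor until they reach
  \<open>R\<close>.\<close>

lemma spectral_radius_zero:
  assumes inv: "\<And>\<theta>. \<exists>z. q (z * (1 - \<theta> *\<^sub>C y) - 1) = 0" and "R > 0"
  shows "(\<lambda>k. R ^ (2^k) * q (y ^ (2^k))) \<longlonglongrightarrow> 0"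
proof -
  obtain z where z: "\<And>\<theta>. q (z \<theta> * (1 - \<theta> *\<^sub>C y) - 1) = 0"
    using inv by metis
  define good where "good r \<longleftrightarrow> (\<lambda>k. r ^ (2^k) * q (y ^ (2^k))) \<longlonglongrightarrow> 0" for r :: real
  \<comment> \<open>Each extension step below looks ahead by a factor d * d \<le> 4, so the
    resolvent is controlled on a disc of radius 4 R.\<close>
  define R1 where "R1 = 4 * R"
  have R1: "R1 > 0" using \<open>R > 0\<close> R1_def by simp
  \<comment> \<open>The radius is chosen so that the resolvent identity gives q (z \<theta>) \<le> q
    (z \<tau>) + q (z \<theta>) / 2, hence the local bound 2 q (z \<tau>).\<close>
  have "\<exists>e>0. \<exists>B. \<forall>\<theta>\<in>cball 0 R1. dist \<tau> \<theta> < e \<longrightarrow> q (z \<theta>) \<le> B" for \<tau>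
  proof (rule exI[of _ "1 / (2 * (q y * q (z \<tau>) + 1))"], intro conjI, goal_cases)
    case 2
    show ?case
    proof (rule exI[of _ "2 * q (z \<tau>)"], intro ballI impI)
    let ?c = "q y * q (z \<tau>)"
    have c: "?c \<ge> 0" by simp
    fix \<theta> assume "dist \<tau> \<theta> < 1 / (2 * (?c + 1))"
    then have d: "cmod (\<theta> - \<tau>) * (2 * (?c + 1)) < 1"
      using c by (simp add: dist_norm norm_minus_commute field_simps add_nonneg_pos)
    have "q (z \<theta>) \<le> q (z \<tau>) + q (z \<theta> - z \<tau>)" using q_add[of "z \<tau>" "z \<theta> - z \<tau>"] by simp
    also have "q (z \<theta> - z \<tau>) \<le> cmod (\<theta> - \<tau>) * q y * q (z \<theta>) * q (z \<tau>)"
      by (rule resolvent_identity[OF z z])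
    also have "\<dots> = (cmod (\<theta> - \<tau>) * ?c) * q (z \<theta>)" by simp
    also have "\<dots> \<le> (1/2) * q (z \<theta>)"
    proof (intro mult_right_mono)
      have "cmod (\<theta> - \<tau>) * (2 * ?c) \<le> cmod (\<theta> - \<tau>) * (2 * (?c + 1))"
        by (intro mult_left_mono) auto
      then show "cmod (\<theta> - \<tau>) * ?c \<le> 1/2" using d by simp
    qed simp
    finally show "q (z \<theta>) \<le> 2 * q (z \<tau>)" by simp
    qed
  qed (simp add: add_nonneg_pos)
  then obtain B0 where B0: "\<And>\<theta>. \<theta> \<in> cball 0 R1 \<Longrightarrow> q (z \<theta>) \<le> B0"
    using compact_locally_bounded_imp_bounded[OF compact_cball, of 0 R1 "\<lambda>\<theta>. q (z \<theta>)"] by metis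
  have B0_nn: "B0 \<ge> 0" by (rule order.trans[OF q_nonneg B0[of 0]]) (use R1 in simp)
  define L where "L = q y * B0 * B0 + 1"
  have L: "L > 0" unfolding L_def using B0_nn
    by (intro add_nonneg_pos mult_nonneg_nonneg q_nonneg) auto
  have Lip: "q (z \<theta> - z \<tau>) \<le> L * cmod (\<theta> - \<tau>)" if "cmod \<theta> \<le> R1" "cmod \<tau> \<le> R1" for \<theta> \<tau>
  proof -
    have "q (z \<theta> - z \<tau>) \<le> cmod (\<theta> - \<tau>) * q y * q (z \<theta>) * q (z \<tau>)"
      by (rule resolvent_identity[OF z z])
    also have "\<dots> \<le> cmod (\<theta> - \<tau>) * q y * B0 * B0"
      using that B0 B0_nn by (intro mult_mono) auto
    also have "\<dots> \<le> L * cmod (\<theta> - \<tau>)" unfolding L_def by (simp add: algebra_simps)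
    finally show ?thesis .
  qed
  \<comment> \<open>\<open>Z k s\<close> averages \<open>z\<close> over all products of
    \<open>s\<close> with a 2^k-th root of unity: \<open>cis (pi / 2^k)\<close> is a 2^k-th root of
    -1, so each step adds the roots that are still missing.\<close>
  define Z where "Z = rec_nat z (\<lambda>k f s. (1/2) *\<^sub>C (f s + f (cis (pi / 2^k) * s)))"
  have Z0: "Z 0 = z" and ZS: "\<And>k s. Z (Suc k) s = (1/2) *\<^sub>C (Z k s + Z k (cis (pi / 2^k) * s))"
    unfolding Z_def by simp_all
  have Zinv: "q (Z k s * (1 - s ^ (2^k) *\<^sub>C y ^ (2^k)) - 1) = 0" for k s
  proof (induction k arbitrary: s)
    case 0 then show ?case using z Z0 by simp
  next
    case (Suc k)
    let ?a = "s ^ (2^k) *\<^sub>C y ^ (2^k)"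
    have "cis (pi / 2^k) ^ (2^k) = -1" unfolding Complex.DeMoivre by simp
    then have "(cis (pi / 2^k) * s) ^ (2^k) *\<^sub>C y ^ (2^k) = - ?a"
      by (simp add: power_mult_distrib)
    then have 1: "q (Z k (cis (pi / 2^k) * s) * (1 + ?a) - 1) = 0"
      using Suc[of "cis (pi / 2^k) * s"] by simp
    have 2: "?a * ?a = s ^ (2^Suc k) *\<^sub>C y ^ (2^Suc k)"
      by (simp add: mult_scaleC_left mult_scaleC_right scaleC_scaleC mult_2 power_add)
    show ?case using average_inverse[OF Suc[of s] 1] unfolding ZS 2 .
  qed
  have Zlip: "q (Z k s - Z k (of_real c * s)) \<le> L * R1 * (1 - c)"
    if "cmod s \<le> R1" "0 \<le> c" "c \<le> 1" for k s c
    using that(1)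
  proof (induction k arbitrary: s)
    case 0
    have "cmod (of_real c * s) \<le> R1"
      using 0 that by (simp add: norm_mult) (smt (verit) mult_left_le_one_le norm_ge_zero)
    then have "q (z s - z (of_real c * s)) \<le> L * cmod (s - of_real c * s)"
      using Lip 0 by simp
    also have "s - of_real c * s = of_real (1 - c) * s" by (simp add: algebra_simps)
    also have "L * cmod (of_real (1 - c) * s) \<le> L * ((1 - c) * R1)"
      unfolding norm_mult norm_of_real using L 0 that by (intro mult_left_mono mult_mono) auto
    finally show ?case unfolding Z0 by (simp add: algebra_simps)
  next
    case (Suc k)
    let ?w = "cis (pi / 2^k)"
    have "Z (Suc k) s - Z (Suc k) (of_real c * s) =
      (1/2) *\<^sub>C ((Z k s - Z k (of_real c * s)) + (Z k (?w * s) - Z k (of_real c * (?w * s))))"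
      unfolding ZS by (simp add: scaleC_diff_right scaleC_add_right algebra_simps)
    then have "q (Z (Suc k) s - Z (Suc k) (of_real c * s)) \<le>
      (1/2) * (q (Z k s - Z k (of_real c * s)) + q (Z k (?w * s) - Z k (of_real c * (?w * s))))"
      using q_scale[of "1/2" "(Z k s - Z k (of_real c * s)) + (Z k (?w * s) - Z k (of_real c * (?w * s)))"]
        q_add[of "Z k s - Z k (of_real c * s)" "Z k (?w * s) - Z k (of_real c * (?w * s))"] by simp
    also have "\<dots> \<le> (1/2) * (L * R1 * (1 - c) + L * R1 * (1 - c))"
      using Suc.IH[of s] Suc.IH[of "?w * s"] Suc.prems by (simp add: norm_mult)
    finally show ?case by simp
  qed
  \<comment> \<open>Shrinking a point by the factor \<open>c\<close> moves every average by at most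
    1/4; the lower bound 1/4 on \<open>c\<close> ensures d * d \<le> 4 later.\<close>
  define c where "c = max (1/4) (1 - 1 / (4 * L * R1))"
  have c: "0 < c" "c < 1" "L * R1 * (1 - c) \<le> 1/4"
  proof -
    show "0 < c" "c < 1" using L R1 unfolding c_def by auto
    have "1 - c \<le> 1 / (4 * L * R1)" unfolding c_def by simp
    then have "L * R1 * (1 - c) \<le> L * R1 * (1 / (4 * L * R1))" using L R1 by (intro mult_left_mono) auto
    then show "L * R1 * (1 - c) \<le> 1/4" using L R1 by simp
  qed
  \<comment> \<open>At radius \<open>c * r\<close> the average ends up within 1/4 of 1, hence within
    1/2 of 1 at radius \<open>r\<close>. Its inverse 1 - b then forces q b \<le> 1, and any radius
    strictly below \<open>r\<close> turns this bound into convergence to 0.\<close>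
  have step: "good r'" if g: "good (c * r)" and r: "0 < r" "r \<le> R1" and r': "0 \<le> r'" "r' < r" for r r'
  proof -
    let ?a = "\<lambda>k. complex_of_real (c * r) ^ (2^k) *\<^sub>C y ^ (2^k)"
    let ?b = "\<lambda>k. complex_of_real r ^ (2^k) *\<^sub>C y ^ (2^k)"
    have qa: "q (?a k) \<le> (c * r) ^ (2^k) * q (y ^ (2^k))" for k
      using q_scale[of "complex_of_real (c * r) ^ (2^k)" "y ^ (2^k)"] c r by (simp add: norm_power norm_mult)
    \<comment> \<open>The factor makes both \<alpha> and \<alpha> * q 1 at most 1/5, so that q (u -
      1) \<le> (1/5) / (1 - 1/5) = 1/4. The term \<open>q 1\<close> enters because the unit is not
      normalized.\<close>
    have "(\<lambda>k. 5 * (q 1 + 1) * ((c * r) ^ (2^k) * q (y ^ (2^k)))) \<longlonglongrightarrow> 5 * (q 1 + 1) * 0"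
      using g unfolding good_def by (intro tendsto_intros)
    then have "\<forall>\<^sub>F k in sequentially. 5 * (q 1 + 1) * ((c * r) ^ (2^k) * q (y ^ (2^k))) < 1"
      by (rule order_tendstoD) simp
    then have "\<forall>\<^sub>F k in sequentially. r ^ (2^k) * q (y ^ (2^k)) \<le> 1"
    proof eventually_elim
      case (elim k)
      define u where "u = Z k (of_real (c * r))"
      define v where "v = Z k (of_real r)"
      have qa5: "5 * (q 1 + 1) * q (?a k) < 1"
        using elim mult_left_mono[OF qa[of k], of "5 * (q 1 + 1)"] by simp
      have "q (u - 1 - ?a k * u) = 0"
        using Zinv[of k "of_real (c * r)"] unfolding u_def by (simp add: algebra_simps)
      then have "q (u - 1) = q (?a k * u)" by (rule q_cong)
      also have "\<dots> \<le> q (?a k) * q u" by (rule q_mult)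
      also have "\<dots> \<le> q (?a k) * (q 1 + q (u - 1))"
        using q_add[of 1 "u - 1"] by (intro mult_left_mono) auto
      finally have 1: "q (u - 1) \<le> q (?a k) * q 1 + q (?a k) * q (u - 1)" by (simp add: algebra_simps)
      define \<alpha> where "\<alpha> = q (?a k)"
      have \<alpha>: "\<alpha> \<ge> 0" "q 1 * \<alpha> \<ge> 0" "5 * \<alpha> + 5 * (q 1 * \<alpha>) < 1"
        using qa5 unfolding \<alpha>_def[symmetric] by (simp_all add: \<alpha>_def algebra_simps)
      then have 2: "q (?a k) \<le> 1/5" and 3: "q (?a k) * q 1 \<le> 1/5"
        unfolding \<alpha>_def[symmetric] mult.commute[of \<alpha>] by linarith+
      have 4: "q (?a k) * q (u - 1) \<le> 1/5 * q (u - 1)" using 2 by (intro mult_right_mono) auto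
      have u1: "q (u - 1) \<le> 1/4" using 1 3 4 by simp
      have "q (v - u) \<le> 1/4"
        using Zlip[of "of_real r" c k] c r unfolding u_def v_def by simp
      then have v1: "q (v - 1) \<le> 1/2" using u1 q_add[of "v - u" "u - 1"] by simp
      have "q (?b k - ((v - 1) - (v - 1) * ?b k)) = 0"
      proof -
        have "?b k - ((v - 1) - (v - 1) * ?b k) = - (v * (1 - ?b k) - 1)" by (simp add: algebra_simps)
        then show ?thesis using Zinv[of k "of_real r"] unfolding v_def by (simp only: q_uminus)
      qed
      then have "q (?b k) = q ((v - 1) - (v - 1) * ?b k)" by (rule q_cong)
      also have "\<dots> \<le> q (v - 1) + q (v - 1) * q (?b k)"
        using q_diff[of "v - 1" "(v - 1) * ?b k"] q_mult[of "v - 1" "?b k"] by simp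
      also have "\<dots> \<le> 1/2 + 1/2 * q (?b k)" using v1 by (intro add_mono mult_right_mono) auto
      finally have b1: "q (?b k) \<le> 1" by simp
      have "y ^ (2^k) = complex_of_real (1 / r ^ (2^k)) *\<^sub>C ?b k"
        using r by (simp add: scaleC_scaleC flip: of_real_power of_real_mult of_real_divide)
      then have "q (y ^ (2^k)) \<le> 1 / r ^ (2^k) * q (?b k)"
        using q_scale[of "complex_of_real (1 / r ^ (2^k))" "?b k"] r by (simp add: norm_divide norm_power)
      also have "\<dots> \<le> 1 / r ^ (2^k) * 1" using b1 r by (intro mult_left_mono) auto
      finally show ?case using r by (simp add: field_simps)
    qed
    then obtain K where K: "\<And>k. k \<ge> K \<Longrightarrow> r ^ (2^k) * q (y ^ (2^k)) \<le> 1"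
      unfolding eventually_sequentially by blast
    have "(\<lambda>k. (r' / r) ^ (2^k)) \<longlonglongrightarrow> 0" using r r' by (intro power_dyadic_tendsto_0) simp
    moreover have "\<forall>\<^sub>F k in sequentially. norm (r' ^ (2^k) * q (y ^ (2^k))) \<le> (r' / r) ^ (2^k)"
      unfolding eventually_sequentially
    proof (intro exI[of _ K] allI impI)
      fix k assume "K \<le> k"
      have "r' ^ (2^k) * q (y ^ (2^k)) = (r' / r) ^ (2^k) * (r ^ (2^k) * q (y ^ (2^k)))"
        using r by (simp add: power_divide)
      also have "\<dots> \<le> (r' / r) ^ (2^k) * 1" using K[OF \<open>K \<le> k\<close>] r r' by (intro mult_left_mono) auto
      finally show "norm (r' ^ (2^k) * q (y ^ (2^k))) \<le> (r' / r) ^ (2^k)" using r' by simp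
    qed
    ultimately show "good r'" unfolding good_def by (rule Lim_null_comparison[rotated])
  qed
  have good_mono: "good r'" if "good r" "0 \<le> r'" "r' \<le> r" for r r'
  proof -
    have *: "\<forall>k. norm (r' ^ (2^k) * q (y ^ (2^k))) \<le> r ^ (2^k) * q (y ^ (2^k))"
      using that by (simp add: abs_mult mult_right_mono power_mono)
    show ?thesis using that(1) unfolding good_def
      by (rule Lim_null_comparison[OF always_eventually[OF *]])
  qed
  \<comment> \<open>A starting radius with \<rho> * q y \<le> 1/2, where submultiplicativity alone
    gives decay.\<close>
  define \<rho> where "\<rho> = min R (1 / (2 * (q y + 1)))"
  have qy: "0 < q y + 1" using q_nonneg[of y] by linarith
  have \<rho>: "\<rho> > 0" "\<rho> \<le> R" unfolding \<rho>_def using \<open>R > 0\<close> divide_pos_pos[of 1 "2 * (q y + 1)"] qy by auto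
  have "good \<rho>"
  proof -
    have "\<rho> * q y \<le> 1 / (2 * (q y + 1)) * q y" unfolding \<rho>_def by (intro mult_right_mono) auto
    also have "\<dots> = q y / (q y + 1) / 2" by simp
    also have "\<dots> \<le> 1/2" using qy by (simp add: divide_le_eq_1)
    finally have *: "\<rho> * q y \<le> 1/2" .
    have "(\<lambda>k. (1/2::real) ^ (2^k)) \<longlonglongrightarrow> 0" by (rule power_dyadic_tendsto_0) simp
    moreover have "\<forall>k. norm (\<rho> ^ (2^k) * q (y ^ (2^k))) \<le> (1/2) ^ (2^k)"
    proof
      fix k :: nat
      have "\<rho> ^ (2^k) * q (y ^ (2^k)) \<le> \<rho> ^ (2^k) * q y ^ (2^k)"
        using \<rho> by (intro mult_left_mono q_power) auto
      also have "\<dots> = (\<rho> * q y) ^ (2^k)" by (simp add: power_mult_distrib)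
      also have "\<dots> \<le> (1/2) ^ (2^k)" using * \<rho> by (intro power_mono) auto
      finally show "norm (\<rho> ^ (2^k) * q (y ^ (2^k))) \<le> (1/2) ^ (2^k)" using \<rho> by simp
    qed
    ultimately show "good \<rho>" unfolding good_def
      by (metis (no_types, lifting) Lim_null_comparison always_eventually)
  qed
  \<comment> \<open>If \<open>r\<close> is good, the extension step at \<open>d * d * r\<close>
    applies because c * (d * d * r) = r, and it yields all radii strictly below
    \<open>d * d * r\<close>, in particular \<open>d * r\<close>.\<close>
  define d where "d = 1 / sqrt c"
  have dd: "d * d = 1 / c" unfolding d_def using c by (simp add: divide_simps)
  have d: "d > 1" "c * (d * d) = 1" "d * d \<le> 4"
  proof -
    show "d > 1" unfolding d_def using c by simp
    show "c * (d * d) = 1" unfolding dd using c by simp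
    have "c \<ge> 1/4" unfolding c_def by simp
    then show "d * d \<le> 4" unfolding dd by (simp add: divide_simps)
  qed
  have "good (min R (\<rho> * d ^ j))" for j
  proof (induction j)
    case 0 then show ?case using \<open>good \<rho>\<close> \<rho> by (simp add: min_absorb2)
  next
    case (Suc j)
    let ?r = "min R (\<rho> * d ^ j)"
    let ?r1 = "min R (\<rho> * d ^ Suc j)"
    have rp: "?r > 0" using \<rho> d \<open>R > 0\<close> by simp
    have "?r1 \<le> min (d * R) (d * (\<rho> * d ^ j))"
      using d \<open>R > 0\<close> by (intro min.mono) simp_all
    then have "?r1 \<le> d * ?r" using d by (simp add: min_mult_distrib_left)
    moreover have "d * ?r < d * d * ?r" using d rp by simp
    ultimately have 1: "?r1 < d * d * ?r" by simp
    have 2: "d * d * ?r \<le> R1" unfolding R1_def using d rp by (intro mult_mono) auto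
    have 3: "c * (d * d * ?r) = ?r" using d(2) by (metis mult.assoc mult_1)
    show ?case
    proof (rule step[of "d * d * ?r"])
      show "good (c * (d * d * ?r))" unfolding 3 by (rule Suc.IH)
      show "0 < d * d * ?r" using rp d by simp
      show "0 \<le> ?r1" using \<rho> d \<open>R > 0\<close> by simp
    qed (rule 2 1)+
  qed
  moreover obtain j where "R / \<rho> < d ^ j" using real_arch_pow[OF d(1)] by blast
  then have "R \<le> \<rho> * d ^ j" using \<rho> by (simp add: field_simps)
  then have "min R (\<rho> * d ^ j) = R" by simp
  ultimately have "good R" by metis
  then show ?thesis unfolding good_def .
qed

end

section \<open>Maximal ideals as kernels of characters\<close>

lemma inverse_one_minus:
  fixes x :: "'a::comm_complex_banach_algebra_1"
  assumes "norm x < 1"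
  shows "\<exists>y. y * (1 - x) = 1"
proof -
  \<comment> \<open>The factor \<open>norm 1\<close> accounts for the zeroth power, since the unit
    may have norm different from 1.\<close>
  have bound: "norm (x ^ n) \<le> norm (1::'a) * norm x ^ n" for n
  proof (induction n)
    case (Suc n)
    have "norm (x ^ Suc n) \<le> norm x * norm (x ^ n)" by (simp add: norm_mult_ineq)
    also have "\<dots> \<le> norm x * (norm (1::'a) * norm x ^ n)" using Suc by (intro mult_left_mono) auto
    finally show ?case by (simp add: mult_ac)
  qed simp
  have "summable (\<lambda>n. norm (1::'a) * norm x ^ n)"
    using assms by (intro summable_mult summable_geometric) simp
  then have sm: "summable (\<lambda>n. x ^ n)"
    by (rule summable_comparison_test'[where N = 0]) (use bound in auto)
  have "suminf (\<lambda>n. x ^ n) * x = suminf (\<lambda>n. x ^ Suc n)"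
    using suminf_mult2[OF sm, of x] by (simp add: mult.commute)
  also have "\<dots> = suminf (\<lambda>n. x ^ n) - 1"
    using suminf_split_head[OF sm] by simp
  finally show ?thesis by (intro exI[of _ "suminf (\<lambda>n. x ^ n)"]) (simp add: right_diff_distrib)
qed

lemma ideal_add: "is_ideal I \<Longrightarrow> x \<in> I \<Longrightarrow> y \<in> I \<Longrightarrow> x + y \<in> I"
  and ideal_mult: "is_ideal I \<Longrightarrow> x \<in> I \<Longrightarrow> r * x \<in> I"
  and ideal_0: "is_ideal I \<Longrightarrow> 0 \<in> I"
  unfolding is_ideal_def by auto

lemma ideal_mult_right: "is_ideal I \<Longrightarrow> x \<in> I \<Longrightarrow> x * r \<in> I"
  using ideal_mult by (metis mult.commute)

lemma ideal_uminus: "is_ideal I \<Longrightarrow> x \<in> I \<Longrightarrow> - x \<in> I"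
  using ideal_mult[of I x "-1"] by simp

lemma ideal_diff: "is_ideal I \<Longrightarrow> x \<in> I \<Longrightarrow> y \<in> I \<Longrightarrow> x - y \<in> I"
  using ideal_add[of I x "-y"] ideal_uminus[of I y] by simp

lemma ideal_scaleC: "is_ideal I \<Longrightarrow> x \<in> I \<Longrightarrow> c *\<^sub>C x \<in> I"
  using ideal_mult[of I x "c *\<^sub>C 1"] by (simp add: mult_scaleC_left)

text \<open>For products of infima such as distances to an ideal, where only near-minimizers are
  available.\<close>

lemma le_mult_of_le_mult_greater:
  fixes c x y :: real
  assumes "\<And>s t. s > x \<Longrightarrow> t > y \<Longrightarrow> c \<le> s * t"
  shows "c \<le> x * y"
proof (rule tendsto_lowerbound)
  show "((\<lambda>e. (x + e) * (y + e)) \<longlongrightarrow> x * y) (at_right 0)"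
    by (auto intro!: tendsto_eq_intros)
  show "\<forall>\<^sub>F e in at_right 0. c \<le> (x + e) * (y + e)"
    unfolding eventually_at_right_field using assms by (intro exI[of _ 1]) auto
qed simp

text \<open>Gelfand-Mazur, with the distance to \<open>I\<close> in the role of the quotient norm.
  If \<open>y - l\<close> lies outside \<open>I\<close> for every scalar \<open>l\<close>, then
  \<open>y\<close> has spectral radius 0 modulo \<open>I\<close>. By maximality it also has an
  inverse \<open>z\<close> modulo \<open>I\<close>, and 1 \<le> q ((z y)^(2^k)) \<le> (q z)^(2^k) q
  (y^(2^k)) contradicts this. The character sends \<open>y\<close> to the scalar it equals modulo
  \<open>I\<close>.\<close>

theorem maximal_ideal_character:
  fixes I :: "'a::comm_complex_banach_algebra_1 set"
  assumes "is_maximal_ideal I"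
  shows "\<exists>\<phi>\<in>max_ideal_space. I = {x. \<phi> x = 0}"
proof -
  have I: "is_ideal I" and IU: "I \<noteq> UNIV"
    and max: "\<And>J. is_ideal J \<Longrightarrow> I \<subseteq> J \<Longrightarrow> J = I \<or> J = UNIV"
    using assms unfolding is_maximal_ideal_def by auto
  have one: "1 \<notin> I"
  proof
    assume "1 \<in> I"
    then have "r \<in> I" for r using ideal_mult[OF I, of 1 r] by simp
    then show False using IU by auto
  qed
  have far: "norm (1 - i) \<ge> 1" if "i \<in> I" for i
  proof (rule ccontr)
    assume "\<not> norm (1 - i) \<ge> 1"
    then obtain y where "y * (1 - (1 - i)) = 1" using inverse_one_minus[of "1 - i"] by auto
    then show False using ideal_mult[OF I that, of y] one by simp
  qed
  have invI: "\<exists>z. z * x - 1 \<in> I" if "x \<notin> I" for x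
  proof -
    let ?J = "{i + r * x | i r. i \<in> I}"
    have "is_ideal ?J" unfolding is_ideal_def
    proof (intro conjI ballI allI)
      show "0 \<in> ?J" using ideal_0[OF I] by (auto intro!: exI[of _ 0])
    next
      fix u v assume "u \<in> ?J" "v \<in> ?J"
      then obtain i r j t where "u = i + r * x" "v = j + t * x" "i \<in> I" "j \<in> I" by auto
      then show "u + v \<in> ?J"
        using ideal_add[OF I] by (intro CollectI exI[of _ "r + t"] exI[of _ "i + j"]) (auto simp: algebra_simps)
    next
      fix t u assume "u \<in> ?J"
      then obtain i r where "u = i + r * x" "i \<in> I" by auto
      then show "t * u \<in> ?J"
        using ideal_mult[OF I] by (intro CollectI exI[of _ "t * r"] exI[of _ "t * i"]) (auto simp: algebra_simps)
    qed
    moreover have "I \<subseteq> ?J" by (force intro: exI[of _ 0])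
    moreover have "x \<in> ?J" using ideal_0[OF I] by (intro CollectI exI[of _ 1] exI[of _ 0]) auto
    ultimately have "?J = UNIV" using max that by blast
    then obtain i r where "1 = i + r * x" "i \<in> I" by blast
    then have "r * x - 1 = - i" by (metis add_diff_cancel_left' diff_minus_eq_add minus_diff_eq)
    then show ?thesis using ideal_uminus[OF I \<open>i \<in> I\<close>] by metis
  qed
  define q where "q x = infdist x I" for x
  have q_less: "q x < s \<Longrightarrow> \<exists>i\<in>I. norm (x - i) < s" for x s
    unfolding q_def infdist_def using ideal_0[OF I]
    by (auto simp: dist_norm dest!: cInf_lessD[rotated] split: if_splits)
  have q_le: "i \<in> I \<Longrightarrow> q x \<le> norm (x - i)" for x i
    unfolding q_def using infdist_le[of i I x] by (simp add: dist_norm)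
  have q_I: "x \<in> I \<Longrightarrow> q x = 0" for x
    unfolding q_def by simp
  interpret algebra_seminorm q
  proof
    fix a b :: 'a and c :: complex
    show "q (a + b) \<le> q a + q b"
    proof (rule field_le_epsilon)
      fix e :: real assume "e > 0"
      then obtain i j where ij: "i \<in> I" "j \<in> I" "norm (a - i) < q a + e/2" "norm (b - j) < q b + e/2"
        using q_less[of a "q a + e/2"] q_less[of b "q b + e/2"] by auto
      have "q (a + b) \<le> norm (a + b - (i + j))" using q_le ideal_add[OF I] ij by blast
      also have "\<dots> \<le> norm (a - i) + norm (b - j)" using norm_triangle_ineq[of "a - i" "b - j"] by (simp add: algebra_simps)
      finally show "q (a + b) \<le> q a + q b + e" using ij by simp
    qed
    show "q (a * b) \<le> q a * q b"
    proof (rule le_mult_of_le_mult_greater)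
      fix s t assume st: "s > q a" "t > q b"
      then obtain i j where ij: "i \<in> I" "j \<in> I" "norm (a - i) < s" "norm (b - j) < t"
        using q_less by blast
      have "(a - i) * (b - j) = a * b - (i * b + (a - i) * j)" by (simp add: algebra_simps)
      moreover have "i * b + (a - i) * j \<in> I"
        using ij ideal_add[OF I] ideal_mult[OF I] ideal_mult_right[OF I] by blast
      ultimately have "q (a * b) \<le> norm ((a - i) * (b - j))" using q_le by metis
      also have "\<dots> \<le> norm (a - i) * norm (b - j)" by (rule norm_mult_ineq)
      also have "\<dots> \<le> s * t" using ij by (intro mult_mono) (auto intro: order.trans[OF norm_ge_zero less_imp_le])
      finally show "q (a * b) \<le> s * t" .
    qed
    show "q (c *\<^sub>C a) \<le> cmod c * q a"
    proof (rule le_mult_of_le_mult_greater)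
      fix s t assume st: "s > cmod c" "t > q a"
      then obtain i where i: "i \<in> I" "norm (a - i) < t" using q_less by blast
      have "q (c *\<^sub>C a) \<le> norm (c *\<^sub>C a - c *\<^sub>C i)" using q_le ideal_scaleC[OF I] i by blast
      also have "\<dots> = cmod c * norm (a - i)" by (simp add: norm_scaleC flip: scaleC_diff_right)
      also have "\<dots> \<le> s * t" using i st by (intro mult_mono) (auto intro: order.trans[OF norm_ge_zero less_imp_le])
      finally show "q (c *\<^sub>C a) \<le> s * t" .
    qed
  qed
  have q1: "q 1 \<ge> 1"
  proof (rule ccontr)
    assume "\<not> q 1 \<ge> 1"
    then obtain i where "i \<in> I" "norm (1 - i) < 1" using q_less[of 1 1] by auto
    then show False using far[of i] by simp
  qed
  have "\<exists>l. y - l *\<^sub>C 1 \<in> I" for y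
  proof (rule ccontr)
    assume "\<not> (\<exists>l. y - l *\<^sub>C 1 \<in> I)"
    then have no: "\<And>l. y - l *\<^sub>C 1 \<notin> I" by blast
    have "\<exists>z. q (z * (1 - \<theta> *\<^sub>C y) - 1) = 0" for \<theta>
    proof (cases "\<theta> = 0")
      case True then show ?thesis by (auto intro: exI[of _ 1])
    next
      case False
      have "1 - \<theta> *\<^sub>C y \<notin> I"
      proof
        assume "1 - \<theta> *\<^sub>C y \<in> I"
        from ideal_scaleC[OF I this, of "- (1 / \<theta>)"] have "y - (1 / \<theta>) *\<^sub>C 1 \<in> I"
          using False by (simp add: scaleC_diff_right scaleC_scaleC)
        then show False using no by blast
      qed
      then show ?thesis using invI q_I by blast
    qed
    note lim = spectral_radius_zero[OF this]
    obtain z where z: "z * y - 1 \<in> I" using invI[of y] no[of 0] by auto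
    have "(z * y) ^ n - 1 \<in> I" for n
    proof (induction n)
      case 0 then show ?case using ideal_0[OF I] by simp
    next
      case (Suc n)
      have "(z * y) ^ Suc n - 1 = (z * y) * ((z * y) ^ n - 1) + (z * y - 1)" by (simp add: algebra_simps)
      then show ?case using ideal_add[OF I ideal_mult[OF I Suc] z] by metis
    qed
    then have "q ((z * y) ^ n - 1) = 0" for n using q_I by blast
    then have qzy: "q ((z * y) ^ n) = q 1" for n by (rule q_cong)
    \<comment> \<open>Adding 1 gives a strictly positive radius at which the spectral radius lemma
      can be applied.\<close>
    have "1 \<le> (q z + 1) ^ (2^k) * q (y ^ (2^k))" for k
    proof -
      have "1 \<le> q ((z * y) ^ (2^k))" using q1 qzy by simp
      also have "\<dots> \<le> q (z ^ (2^k)) * q (y ^ (2^k))" unfolding power_mult_distrib by (rule q_mult)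
      also have "\<dots> \<le> q z ^ (2^k) * q (y ^ (2^k))" by (intro mult_right_mono q_power) simp_all
      also have "\<dots> \<le> (q z + 1) ^ (2^k) * q (y ^ (2^k))" by (intro mult_right_mono power_mono) auto
      finally show ?thesis .
    qed
    then have "1 \<le> (0::real)"
      using q_nonneg[of z] by (intro LIMSEQ_le_const[OF lim[of "q z + 1"]]) (linarith, blast)
    then show False by simp
  qed
  then obtain f where f: "\<And>y. y - f y *\<^sub>C 1 \<in> I" by metis
  have f_unique: "f y = a" if "y - a *\<^sub>C 1 \<in> I" for y a
  proof (rule ccontr)
    assume "f y \<noteq> a"
    have "(f y - a) *\<^sub>C 1 \<in> I"
      using ideal_diff[OF I that f[of y]] by (simp add: scaleC_diff_left)
    from ideal_scaleC[OF I this, of "1 / (f y - a)"] have "1 \<in> I"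
      using \<open>f y \<noteq> a\<close> by (simp add: scaleC_scaleC)
    then show False using one by simp
  qed
  have "f \<in> max_ideal_space"
    unfolding max_ideal_space_def
  proof (intro CollectI conjI allI)
    fix x y a
    show "f (x + y) = f x + f y"
    proof (rule f_unique)
      have "x + y - (f x + f y) *\<^sub>C 1 = (x - f x *\<^sub>C 1) + (y - f y *\<^sub>C 1)" by (simp add: scaleC_add_left)
      then show "x + y - (f x + f y) *\<^sub>C 1 \<in> I" using ideal_add[OF I f f] by metis
    qed
    show "f (a *\<^sub>C x) = a * f x"
    proof (rule f_unique)
      have "a *\<^sub>C x - (a * f x) *\<^sub>C 1 = a *\<^sub>C (x - f x *\<^sub>C 1)" by (simp add: scaleC_diff_right scaleC_scaleC)
      then show "a *\<^sub>C x - (a * f x) *\<^sub>C 1 \<in> I" using ideal_scaleC[OF I f] by metis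
    qed
    show "f (x * y) = f x * f y"
    proof (rule f_unique)
      have "x * y - (f x * f y) *\<^sub>C 1 = x * (y - f y *\<^sub>C 1) + f y *\<^sub>C (x - f x *\<^sub>C 1)"
        by (simp add: scaleC_diff_right scaleC_scaleC mult_scaleC_right algebra_simps)
      then show "x * y - (f x * f y) *\<^sub>C 1 \<in> I"
        using ideal_add[OF I ideal_mult[OF I f] ideal_scaleC[OF I f]] by metis
    qed
    have "f 1 = 1" by (rule f_unique) (simp add: ideal_0[OF I])
    then show "\<exists>x. f x \<noteq> 0" by (metis zero_neq_one)
  qed
  moreover have "I = {x. f x = 0}"
    using f f_unique[of _ 0] by (auto, metis diff_zero scaleC_0_left)
  ultimately show ?thesis by blast
qed

lemma noninvertible_character:
  fixes x :: "'a::comm_complex_banach_algebra_1"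
  assumes "\<nexists>z. z * x = 1"
  shows "\<exists>\<phi>\<in>max_ideal_space. \<phi> x = 0"
proof -
  let ?A = "{I. is_ideal I \<and> 1 \<notin> I \<and> x \<in> I}"
  have "\<exists>M\<in>?A. \<forall>X\<in>?A. M \<subseteq> X \<longrightarrow> X = M"
  proof (rule subset_Zorn_nonempty)
    have "is_ideal (range (\<lambda>r. r * x))" unfolding is_ideal_def
    proof (intro conjI ballI allI)
      show "0 \<in> range (\<lambda>r. r * x)" by (rule range_eqI[of _ _ 0]) simp
    next
      fix u v assume "u \<in> range (\<lambda>r. r * x)" "v \<in> range (\<lambda>r. r * x)"
      then obtain a b where "u = a * x" "v = b * x" by auto
      then show "u + v \<in> range (\<lambda>r. r * x)"
        by (intro range_eqI[of _ _ "a + b"]) (simp add: distrib_right)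
    next
      fix r u assume "u \<in> range (\<lambda>r. r * x)"
      then obtain a where "u = a * x" by auto
      then show "r * u \<in> range (\<lambda>r. r * x)"
        by (intro range_eqI[of _ _ "r * a"]) (simp add: mult.assoc)
    qed
    moreover have "1 \<notin> range (\<lambda>r. r * x)" using assms by (metis imageE)
    moreover have "x \<in> range (\<lambda>r. r * x)" by (rule range_eqI[of _ _ 1]) simp
    ultimately show "?A \<noteq> {}" by blast
  next
    fix C assume C: "C \<noteq> {}" "subset.chain ?A C"
    have sub: "\<And>I. I \<in> C \<Longrightarrow> is_ideal I \<and> 1 \<notin> I \<and> x \<in> I" and
      tot: "\<And>I J. I \<in> C \<Longrightarrow> J \<in> C \<Longrightarrow> I \<subseteq> J \<or> J \<subseteq> I"
      using C(2) unfolding subset.chain_def by auto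
    have "is_ideal (\<Union>C)" unfolding is_ideal_def
    proof (intro conjI ballI allI)
      show "0 \<in> \<Union>C" using C(1) sub ideal_0 by fastforce
    next
      fix u v assume "u \<in> \<Union>C" "v \<in> \<Union>C"
      then obtain I J where "I \<in> C" "u \<in> I" "J \<in> C" "v \<in> J" by auto
      then show "u + v \<in> \<Union>C" using tot[of I J] sub ideal_add by (metis UnionI subsetD)
    next
      fix r u assume "u \<in> \<Union>C"
      then show "r * u \<in> \<Union>C" using sub ideal_mult by blast
    qed
    then show "\<Union>C \<in> ?A" using C(1) sub by auto
  qed
  then obtain M where M: "is_ideal M" "1 \<notin> M" "x \<in> M"
    and max: "\<And>X. is_ideal X \<Longrightarrow> 1 \<notin> X \<Longrightarrow> x \<in> X \<Longrightarrow> M \<subseteq> X \<Longrightarrow> X = M" by blast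
  have "is_maximal_ideal M" unfolding is_maximal_ideal_def
  proof (intro conjI allI impI)
    show "M \<noteq> UNIV" using M(2) by auto
    fix J assume J: "is_ideal J" "M \<subseteq> J"
    show "J = M \<or> J = UNIV"
    proof (cases "1 \<in> J")
      case True
      then have "r \<in> J" for r using ideal_mult[OF J(1), of 1 r] by simp
      then show ?thesis by auto
    next
      case False then show ?thesis using max J M(3) by blast
    qed
  qed (rule M)
  then show ?thesis using maximal_ideal_character M(3) by blast
qed

section \<open>Calculus and continuity of characters\<close>

context
  fixes \<phi> :: "'a::comm_complex_banach_algebra_1 \<Rightarrow> complex"
  assumes \<phi>: "\<phi> \<in> max_ideal_space"
begin

lemma character_add: "\<phi> (x + y) = \<phi> x + \<phi> y"
  and character_scaleC: "\<phi> (a *\<^sub>C x) = a * \<phi> x"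
  and character_mult: "\<phi> (x * y) = \<phi> x * \<phi> y"
  using \<phi> unfolding max_ideal_space_def by auto

lemma character_1: "\<phi> 1 = 1"
proof -
  obtain x where "\<phi> x \<noteq> 0" using \<phi> unfolding max_ideal_space_def by blast
  then show ?thesis using character_mult[of 1 x] by simp
qed

lemma character_0: "\<phi> 0 = 0"
  using character_add[of 0 0] by simp

lemma character_diff: "\<phi> (x - y) = \<phi> x - \<phi> y"
  using character_add[of "x - y" y] by simp

lemma character_uminus: "\<phi> (- x) = - \<phi> x"
  using character_diff[of 0 x] by (simp add: character_0)

lemma character_of_real: "\<phi> (of_real r) = of_real r"
proof -
  have "(of_real r :: 'a) = complex_of_real r *\<^sub>C 1"
    unfolding scaleC_of_real by (rule of_real_def)
  then show ?thesis by (simp only: character_scaleC character_1 mult_1_right)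
qed

lemma character_sum: "\<phi> (sum f S) = (\<Sum>i\<in>S. \<phi> (f i))"
  by (induction S rule: infinite_finite_induct) (auto simp: character_0 character_add)

end

lemmas character_simps = character_add character_scaleC character_mult character_1 character_0
  character_diff character_uminus character_of_real character_sum

text \<open>If the bound failed, 1 - x / \<phi> x would be a unit by the Neumann series, although
  \<phi> maps it to 0. So characters are automatically continuous.\<close>

lemma norm_character_le:
  assumes "\<phi> \<in> max_ideal_space"
  shows "cmod (\<phi> x) \<le> norm x"
proof (rule ccontr)
  assume a: "\<not> cmod (\<phi> x) \<le> norm x"
  then have nz: "\<phi> x \<noteq> 0" using norm_ge_zero[of x] by auto
  have "norm ((1 / \<phi> x) *\<^sub>C x) < 1"
    using a nz by (simp add: norm_scaleC norm_divide divide_simps)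
  then obtain y where "y * (1 - (1 / \<phi> x) *\<^sub>C x) = 1" using inverse_one_minus by blast
  then have "\<phi> (y * (1 - (1 / \<phi> x) *\<^sub>C x)) = 1" using assms by (simp add: character_1)
  then show False using assms nz by (simp add: character_simps)
qed

lemma bounded_linear_character:
  assumes "\<phi> \<in> max_ideal_space"
  shows "bounded_linear \<phi>"
proof (rule bounded_linear_intro[where K = 1])
  fix r x show "\<phi> (r *\<^sub>R x) = r *\<^sub>R \<phi> x"
    unfolding scaleC_of_real[symmetric] using assms by (simp add: character_scaleC scaleC_complex_def)
qed (use assms norm_character_le in \<open>auto simp: character_add\<close>)

lemma semisimpleD:
  assumes "semisimple TYPE('a::comm_complex_banach_algebra_1)"
    and "\<And>\<phi>. \<phi> \<in> max_ideal_space \<Longrightarrow> \<phi> (x::'a) = 0"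
  shows "x = 0"
  using assms maximal_ideal_character unfolding semisimple_def by blast

text \<open>Together with the next lemma this lets results about matrices over the algebra be
  applied to complex matrices, the identity being the only character.\<close>

lemma semisimple_complex: "semisimple TYPE(complex)"
proof -
  have "is_maximal_ideal {0::complex}" unfolding is_maximal_ideal_def
  proof (intro conjI allI impI)
    show "is_ideal {0::complex}" unfolding is_ideal_def by simp
    show "{0::complex} \<noteq> UNIV" by (metis UNIV_I singletonD zero_neq_one)
    fix J :: "complex set" assume J: "is_ideal J" "{0} \<subseteq> J"
    show "J = {0} \<or> J = UNIV"
    proof (cases "\<exists>x\<in>J. x \<noteq> 0")
      case True
      then obtain x where x: "x \<in> J" "x \<noteq> 0" by blast
      have "r \<in> J" for r using ideal_mult[OF J(1) x(1), of "r / x"] x(2) by simp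
      then show ?thesis by auto
    qed (use J in auto)
  qed
  moreover have "0 \<in> I" if "is_maximal_ideal I" for I :: "complex set"
    using that ideal_0 unfolding is_maximal_ideal_def by blast
  ultimately show ?thesis unfolding semisimple_def by blast
qed

lemma max_ideal_space_complex: "max_ideal_space = {id :: complex \<Rightarrow> complex}"
proof (intro equalityI subsetI)
  fix \<phi> :: "complex \<Rightarrow> complex" assume p: "\<phi> \<in> max_ideal_space"
  have "\<phi> x = x" for x
    using character_scaleC[OF p, of x 1] character_1[OF p] by (simp add: scaleC_complex_def)
  then show "\<phi> \<in> {id}" by auto
qed (auto simp: max_ideal_space_def scaleC_complex_def intro: exI[of _ 1])

section \<open>Matrices over a commutative ring\<close>

lemma det_map_matrix:
  fixes h :: "'a::comm_ring_1 \<Rightarrow> 'b::comm_ring_1" and A :: "'a^'n^'n"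
  assumes add: "\<And>x y. h (x + y) = h x + h y" and mult: "\<And>x y. h (x * y) = h x * h y" and one: "h 1 = 1"
  shows "det (map_matrix h A) = h (det A)"
proof -
  have zero: "h 0 = 0" using add[of 0 0] by simp
  have m1: "h (- 1) = - 1" using add[of "-1" 1] one zero by (simp add: eq_neg_iff_add_eq_0)
  have sum: "h (sum f S) = (\<Sum>i\<in>S. h (f i))" for f :: "_ \<Rightarrow> 'a" and S :: "('n \<Rightarrow> 'n) set"
    by (induction S rule: infinite_finite_induct) (auto simp: zero add)
  have prod: "h (prod f S) = (\<Prod>i\<in>S. h (f i))" for f :: "_ \<Rightarrow> 'a" and S :: "'n set"
    by (induction S rule: infinite_finite_induct) (auto simp: one mult)
  have "h (of_int (sign p)) = of_int (sign p)" for p :: "'n \<Rightarrow> 'n"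
    by (cases p rule: sign_cases) (auto simp: one m1)
  then show ?thesis unfolding det_def by (simp add: sum prod mult)
qed

text \<open>Cramer's rule. Entry (j, i) of \<open>B\<close> is \<open>y\<close> times a cofactor,
  written as the determinant of \<open>A\<close> with row \<open>i\<close> replaced by a unit
  vector. Linearity in that row turns entry (k, i) of the product into \<open>y\<close> times the
  determinant with row \<open>i\<close> replaced by row \<open>k\<close>.\<close>

lemma right_inverse_if_det_unit:
  fixes A :: "'a::comm_ring_1^'n^'n"
  assumes "y * det A = 1"
  shows "\<exists>B. A ** B = mat 1"
proof -
  define B :: "'a^'n^'n" where "B = (\<chi> j i. y * det (\<chi> r. if r = i then axis j 1 else A $ r))"
  have "(A ** B) $ k $ i = mat 1 $ k $ i" for k i
  proof -
    have "(A ** B) $ k $ i = (\<Sum>j\<in>UNIV. A $ k $ j * (y * det (\<chi> r. if r = i then axis j 1 else A $ r)))"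
      unfolding B_def matrix_matrix_mult_def by simp
    also have "\<dots> = y * (\<Sum>j\<in>UNIV. det (\<chi> r. if r = i then A $ k $ j *s axis j 1 else A $ r))"
      by (simp add: det_row_mul sum_distrib_left mult_ac)
    also have "\<dots> = y * det (\<chi> r. if r = i then (\<Sum>j\<in>UNIV. A $ k $ j *s axis j 1) else A $ r)"
      by (simp add: det_linear_row_sum)
    also have "(\<Sum>j\<in>UNIV. A $ k $ j *s axis j 1) = A $ k"
      by (rule basis_expansion)
    also have "y * det (\<chi> r. if r = i then A $ k else A $ r) = mat 1 $ k $ i"
    proof (cases "k = i")
      case True
      then have "(\<chi> r. if r = i then A $ k else A $ r) = A" by (auto simp: vec_eq_iff)
      then show ?thesis using assms True by (simp add: mat_def)
    next
      case False
      then have "det (\<chi> r. if r = i then A $ k else A $ r) = 0"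
        by (intro det_identical_rows[of i k]) (auto simp: row_def vec_eq_iff)
      then show ?thesis using False by (simp add: mat_def)
    qed
    finally show ?thesis .
  qed
  then show ?thesis by (auto simp: vec_eq_iff)
qed

text \<open>The right inverse \<open>B\<close> again has a unit as determinant, hence a right
  inverse \<open>C\<close>, and C = (A B) C = A (B C) = A makes \<open>B\<close> two-sided.\<close>

lemma invertible_if_det_unit:
  fixes A :: "'a::comm_ring_1^'n^'n"
  assumes y: "y * det A = 1"
  shows "invertible A"
proof -
  obtain B where B: "A ** B = mat 1" using right_inverse_if_det_unit[OF y] by blast
  then have "det A * det B = 1" by (metis det_I det_mul)
  then obtain C where C: "B ** C = mat 1" using right_inverse_if_det_unit by blast
  have "C = A" by (metis B C matrix_mul_assoc matrix_mul_lid matrix_mul_rid)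
  then show ?thesis using B C unfolding invertible_def by blast
qed

lemma matrix_inv_right: "invertible A \<Longrightarrow> A ** matrix_inv A = mat 1"
  and matrix_inv_left: "invertible A \<Longrightarrow> matrix_inv A ** A = mat 1"
  unfolding invertible_def matrix_inv_def by (metis (mono_tags, lifting) someI_ex)+

lemma gelfand_mat_nth [simp]: "gelfand_mat M \<phi> $ i $ j = \<phi> (M $ i $ j)"
  unfolding gelfand_mat_def gelfand_def by simp

context
  fixes \<phi> :: "'a::comm_complex_banach_algebra_1 \<Rightarrow> complex"
  assumes \<phi>: "\<phi> \<in> max_ideal_space"
begin

lemma gelfand_mat_mult: "gelfand_mat (M ** N) \<phi> = gelfand_mat M \<phi> ** gelfand_mat N \<phi>"
  and gelfand_mat_add: "gelfand_mat (M' + N') \<phi> = gelfand_mat M' \<phi> + gelfand_mat N' \<phi>"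
  and gelfand_mat_diff: "gelfand_mat (M' - N') \<phi> = gelfand_mat M' \<phi> - gelfand_mat N' \<phi>"
  and gelfand_mat_uminus: "gelfand_mat (- M') \<phi> = - gelfand_mat M' \<phi>"
  and gelfand_mat_0: "gelfand_mat 0 \<phi> = 0"
  by (simp_all add: vec_eq_iff matrix_matrix_mult_def character_simps \<phi>)

lemma gelfand_mat_mat: "gelfand_mat (mat c) \<phi> = mat (\<phi> c)"
  by (simp add: vec_eq_iff mat_def character_simps \<phi>)

end

text \<open>A determinant that is not a unit is annihilated by some character, and there the Gelfand
  transform is singular.\<close>

lemma invertible_if_gelfand_mat_invertible:
  fixes M :: "'a::comm_complex_banach_algebra_1^'n^'n"
  assumes "\<And>\<phi>. \<phi> \<in> max_ideal_space \<Longrightarrow> invertible (gelfand_mat M \<phi>)"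
  shows "invertible M"
proof -
  have "\<exists>y. y * det M = 1"
  proof (rule ccontr)
    assume "\<nexists>y. y * det M = 1"
    then obtain \<phi> where p: "\<phi> \<in> max_ideal_space" "\<phi> (det M) = 0" using noninvertible_character by blast
    have "det (gelfand_mat M \<phi>) = \<phi> (det M)"
      unfolding gelfand_mat_def gelfand_def by (rule det_map_matrix) (use p in \<open>auto simp: character_simps\<close>)
    then show False using assms[OF p(1)] p(2) by (simp add: invertible_det_nz)
  qed
  then show ?thesis using invertible_if_det_unit by blast
qed

lemma gelfand_mat_inverse:
  fixes M :: "'a::comm_complex_banach_algebra_1^'n^'n"
  assumes "\<phi> \<in> max_ideal_space" "invertible M"
  shows "invertible (gelfand_mat M \<phi>)" "gelfand_mat (matrix_inv M) \<phi> = matrix_inv (gelfand_mat M \<phi>)"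
proof -
  have 1: "gelfand_mat M \<phi> ** gelfand_mat (matrix_inv M) \<phi> = mat 1"
    using assms by (simp add: matrix_inv_right gelfand_mat_mat character_1 flip: gelfand_mat_mult)
  then show inv: "invertible (gelfand_mat M \<phi>)" unfolding invertible_right_inverse by blast
  show "gelfand_mat (matrix_inv M) \<phi> = matrix_inv (gelfand_mat M \<phi>)"
    by (metis 1 inv matrix_inv_left matrix_mul_assoc matrix_mul_lid matrix_mul_rid)
qed

lemma gelfand_mat_eqI:
  fixes M :: "'a::comm_complex_banach_algebra_1^'n^'m"
  assumes "semisimple TYPE('a)" "\<And>\<phi>. \<phi> \<in> max_ideal_space \<Longrightarrow> gelfand_mat M \<phi> = gelfand_mat N \<phi>"
  shows "M = N"
proof -
  have "M $ i $ j - N $ i $ j = 0" for i j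
  proof (rule semisimpleD[OF assms(1)])
    fix \<phi> :: "'a \<Rightarrow> complex" assume p: "\<phi> \<in> max_ideal_space"
    have "\<phi> (M $ i $ j) = \<phi> (N $ i $ j)" using assms(2)[OF p] by (metis gelfand_mat_nth)
    then show "\<phi> (M $ i $ j - N $ i $ j) = 0" using p by (simp add: character_diff)
  qed
  then show ?thesis by (simp add: vec_eq_iff)
qed

section \<open>The Banach algebra of square matrices\<close>

text \<open>The norm of this copy of \<open>'a^'n^'n\<close> is the operator norm for the Euclidean norm on \<open>'a^'n\<close>, so
  that the identity has norm \<open>1\<close> and the library's exponential is available.\<close>

typedef (overloaded) ('a, 'n::finite) sqmat = "UNIV :: ('a^'n^'n) set"
  morphisms to_mat of_mat ..

setup_lifting type_definition_sqmat

lemma matrix_vector_mult_scaleR_left: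
  fixes M :: "'a::real_algebra_1^'n^'m"
  shows "(r *\<^sub>R M) *v x = r *\<^sub>R (M *v x)"
  by (simp add: matrix_vector_mult_def vec_eq_iff scaleR_sum_right)

lemma matrix_vector_mult_scaleR_right:
  fixes M :: "'a::real_algebra_1^'n^'m"
  shows "M *v (r *\<^sub>R x) = r *\<^sub>R (M *v x)"
  by (simp add: matrix_vector_mult_def vec_eq_iff scaleR_sum_right)

lemma matrix_mult_scaleR_left:
  fixes M :: "'a::real_algebra_1^'n^'m"
  shows "(r *\<^sub>R M) ** N = r *\<^sub>R (M ** N)"
  by (simp add: matrix_matrix_mult_def vec_eq_iff scaleR_sum_right)

lemma matrix_mult_scaleR_right:
  fixes M :: "'a::real_algebra_1^'n^'m"
  shows "M ** (r *\<^sub>R N) = r *\<^sub>R (M ** N)"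
  by (simp add: matrix_matrix_mult_def vec_eq_iff scaleR_sum_right)

lemma matrix_add_rdistrib: "(A + B) ** C = A ** C + B ** (C :: 'a::semiring_1^'n^'m)"
  by (simp add: matrix_matrix_mult_def vec_eq_iff distrib_right sum.distrib)

lemma norm_vec_le_sum: "norm (x :: 'a::real_normed_vector^'n) \<le> (\<Sum>i\<in>UNIV. norm (x $ i))"
  unfolding norm_vec_def by (rule L2_set_le_sum) simp

lemma norm_matrix_vector_mult_le:
  fixes M :: "'a::{real_algebra_1,real_normed_algebra}^'n^'m"
  shows "norm (M *v x) \<le> (\<Sum>i\<in>UNIV. \<Sum>j\<in>UNIV. norm (M $ i $ j)) * norm x"
proof -
  have "norm (M *v x) \<le> (\<Sum>i\<in>UNIV. norm ((M *v x) $ i))" by (rule norm_vec_le_sum)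
  also have "\<dots> \<le> (\<Sum>i\<in>UNIV. \<Sum>j\<in>UNIV. norm (M $ i $ j) * norm x)"
  proof (rule sum_mono)
    fix i
    have "norm ((M *v x) $ i) \<le> (\<Sum>j\<in>UNIV. norm (M $ i $ j * x $ j))"
      unfolding matrix_vector_mult_def by (simp add: norm_sum)
    also have "\<dots> \<le> (\<Sum>j\<in>UNIV. norm (M $ i $ j) * norm x)"
      by (intro sum_mono order.trans[OF norm_mult_ineq] mult_left_mono Finite_Cartesian_Product.norm_nth_le) simp
    finally show "norm ((M *v x) $ i) \<le> (\<Sum>j\<in>UNIV. norm (M $ i $ j) * norm x)" .
  qed
  finally show ?thesis by (simp add: sum_distrib_right)
qed

lemma bounded_linear_matrix_vector_mult:
  fixes M :: "'a::{real_algebra_1,real_normed_algebra}^'n^'m"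
  shows "bounded_linear ((*v) M)"
proof (rule bounded_linear_intro)
  show "norm (M *v x) \<le> norm x * (\<Sum>i\<in>UNIV. \<Sum>j\<in>UNIV. norm (M $ i $ j))" for x
    using norm_matrix_vector_mult_le[of M x] by (simp add: mult.commute)
qed (simp_all add: matrix_vector_right_distrib matrix_vector_mult_scaleR_right)

lemma norm_matrix_vector_mult_le_onorm:
  fixes M :: "'a::{real_algebra_1,real_normed_algebra}^'n^'m"
  shows "norm (M *v x) \<le> onorm ((*v) M) * norm x"
  by (rule onorm[OF bounded_linear_matrix_vector_mult])

lemma onorm_matrix_nonneg: "0 \<le> onorm ((*v) (M :: 'a::{real_algebra_1,real_normed_algebra}^'n^'m))"
  by (rule onorm_pos_le[OF bounded_linear_matrix_vector_mult])

lemma onorm_matrix_le: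
  fixes M :: "'a::{real_algebra_1,real_normed_algebra}^'n^'m"
  shows "onorm ((*v) M) \<le> (\<Sum>i\<in>UNIV. \<Sum>j\<in>UNIV. norm (M $ i $ j))"
  by (rule onorm_bound) (auto intro!: sum_nonneg norm_matrix_vector_mult_le)

text \<open>With \<open>onorm_matrix_le\<close> this makes convergence in operator norm the same as
  entrywise convergence, from which completeness follows.\<close>

lemma norm_entry_le_onorm:
  fixes M :: "'a::{real_algebra_1,real_normed_algebra}^'n^'m"
  shows "norm (M $ i $ j) \<le> onorm ((*v) M) * norm (1::'a)"
proof -
  have "M $ i $ j = (M *v axis j 1) $ i"
    by (simp add: matrix_vector_mult_def axis_def if_distrib[of "\<lambda>x. _ * x"] cong: if_cong)
  then have "norm (M $ i $ j) \<le> norm (M *v axis j 1)" by (metis Finite_Cartesian_Product.norm_nth_le)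
  also have "\<dots> \<le> onorm ((*v) M) * norm (axis j (1::'a) :: 'a^'n)"
    by (rule norm_matrix_vector_mult_le_onorm)
  also have "norm (axis j (1::'a) :: 'a^'n) \<le> (\<Sum>k\<in>UNIV. norm (if k = j then 1 else (0::'a)))"
    using norm_vec_le_sum[of "axis j (1::'a) :: 'a^'n"] by (simp add: axis_def)
  also have "\<dots> = norm (1::'a)" by (simp add: if_distrib[of norm] cong: if_cong)
  finally show ?thesis by (simp add: mult_left_mono onorm_matrix_nonneg)
qed

instantiation sqmat :: (comm_complex_banach_algebra_1, finite) real_normed_algebra_1
begin

lift_definition zero_sqmat :: "('a,'b) sqmat" is 0 .
lift_definition one_sqmat :: "('a,'b) sqmat" is "mat 1" .
lift_definition plus_sqmat :: "('a,'b) sqmat \<Rightarrow> ('a,'b) sqmat \<Rightarrow> ('a,'b) sqmat" is "(+)" .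
lift_definition minus_sqmat :: "('a,'b) sqmat \<Rightarrow> ('a,'b) sqmat \<Rightarrow> ('a,'b) sqmat" is "(-)" .
lift_definition uminus_sqmat :: "('a,'b) sqmat \<Rightarrow> ('a,'b) sqmat" is uminus .
lift_definition times_sqmat :: "('a,'b) sqmat \<Rightarrow> ('a,'b) sqmat \<Rightarrow> ('a,'b) sqmat" is "(**)" .
lift_definition scaleR_sqmat :: "real \<Rightarrow> ('a,'b) sqmat \<Rightarrow> ('a,'b) sqmat" is scaleR .
lift_definition norm_sqmat :: "('a,'b) sqmat \<Rightarrow> real" is "\<lambda>M. onorm ((*v) M)" .

definition dist_sqmat :: "('a,'b) sqmat \<Rightarrow> ('a,'b) sqmat \<Rightarrow> real" where
  "dist_sqmat x y = norm (x - y)"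
definition sgn_sqmat :: "('a,'b) sqmat \<Rightarrow> ('a,'b) sqmat" where
  "sgn_sqmat x = inverse (norm x) *\<^sub>R x"
definition uniformity_sqmat :: "(('a,'b) sqmat \<times> ('a,'b) sqmat) filter" where
  [code del]: "uniformity_sqmat = (INF e\<in>{0<..}. principal {(x, y). dist x y < e})"
definition open_sqmat :: "('a,'b) sqmat set \<Rightarrow> bool" where
  [code del]: "open_sqmat U = (\<forall>x\<in>U. \<forall>\<^sub>F (x', y) in uniformity. x' = x \<longrightarrow> y \<in> U)"

instance
proof
  fix x y z :: "('a,'b) sqmat" and r s :: real and U :: "('a,'b) sqmat set"
  show "x + y + z = x + (y + z)" by transfer (simp add: add.assoc)
  show "x + y = y + x" by transfer (simp add: add.commute)
  show "0 + x = x" by transfer simp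
  show "- x + x = 0" by transfer simp
  show "x - y = x + - y" by transfer simp
  show "r *\<^sub>R (x + y) = r *\<^sub>R x + r *\<^sub>R y" by transfer (simp add: scaleR_add_right)
  show "(r + s) *\<^sub>R x = r *\<^sub>R x + s *\<^sub>R x" by transfer (simp add: scaleR_add_left)
  show "r *\<^sub>R s *\<^sub>R x = (r * s) *\<^sub>R x" by transfer simp
  show "1 *\<^sub>R x = x" by transfer simp
  show "x * y * z = x * (y * z)" by transfer (simp add: matrix_mul_assoc)
  show "(x + y) * z = x * z + y * z" by transfer (rule matrix_add_rdistrib)
  show "x * (y + z) = x * y + x * z" by transfer (simp add: matrix_add_ldistrib)
  show "r *\<^sub>R x * y = r *\<^sub>R (x * y)" by transfer (rule matrix_mult_scaleR_left)
  show "x * r *\<^sub>R y = r *\<^sub>R (x * y)" by transfer (rule matrix_mult_scaleR_right)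
  show "1 * x = x" by transfer simp
  show "x * 1 = x" by transfer simp
  show "(0::('a,'b) sqmat) \<noteq> 1" by transfer (simp add: vec_eq_iff mat_def)
  show "dist x y = norm (x - y)" by (rule dist_sqmat_def)
  show "sgn x = inverse (norm x) *\<^sub>R x" by (rule sgn_sqmat_def)
  show "uniformity = (INF e\<in>{0<..}. principal {(x :: ('a,'b) sqmat, y). dist x y < e})" by (rule uniformity_sqmat_def)
  show "open U = (\<forall>x\<in>U. \<forall>\<^sub>F (x', y) in uniformity. x' = x \<longrightarrow> y \<in> U)" by (rule open_sqmat_def)
  show "norm x = 0 \<longleftrightarrow> x = 0"
  proof transfer
    fix M :: "'a^'b^'b"
    have "M = 0" if "onorm ((*v) M) = 0"
      using norm_entry_le_onorm[of M] that by (simp add: vec_eq_iff)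
    moreover have "(*v) (0 :: 'a^'b^'b) = (\<lambda>_. 0)" by auto
    ultimately show "onorm ((*v) M) = 0 \<longleftrightarrow> M = 0" by (auto simp: onorm_zero)
  qed
  show "norm (x + y) \<le> norm x + norm y"
  proof transfer
    fix M N :: "'a^'b^'b"
    have "(*v) (M + N) = (\<lambda>v. M *v v + N *v v)" by (auto simp: matrix_vector_mult_add_rdistrib)
    then show "onorm ((*v) (M + N)) \<le> onorm ((*v) M) + onorm ((*v) N)"
      by (simp add: onorm_triangle bounded_linear_matrix_vector_mult)
  qed
  show "norm (r *\<^sub>R x) = \<bar>r\<bar> * norm x"
  proof transfer
    fix r :: real and M :: "'a^'b^'b"
    have "(*v) (r *\<^sub>R M) = (\<lambda>v. r *\<^sub>R (M *v v))" by (auto simp: matrix_vector_mult_scaleR_left)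
    then show "onorm ((*v) (r *\<^sub>R M)) = \<bar>r\<bar> * onorm ((*v) M)"
      by (simp add: onorm_scaleR bounded_linear_matrix_vector_mult)
  qed
  show "norm (x * y) \<le> norm x * norm y"
  proof transfer
    fix M N :: "'a^'b^'b"
    have "(*v) (M ** N) = (*v) M \<circ> (*v) N" by (auto simp: matrix_vector_mul_assoc)
    then show "onorm ((*v) (M ** N)) \<le> onorm ((*v) M) * onorm ((*v) N)"
      by (simp add: onorm_compose bounded_linear_matrix_vector_mult)
  qed
  show "norm (1 :: ('a,'b) sqmat) = 1"
  proof transfer
    have 1: "norm ((mat 1 :: 'a^'b^'b) *v x) \<le> 1 * norm x" for x by simp
    have "onorm ((*v) (mat 1 :: 'a^'b^'b)) \<le> 1" by (rule onorm_bound) (use 1 in auto)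
    moreover have "norm ((mat 1 :: 'a^'b^'b) *v axis undefined 1) \<le> onorm ((*v) (mat 1 :: 'a^'b^'b)) * norm (axis (undefined::'b) (1::'a) :: 'a^'b)"
      by (rule norm_matrix_vector_mult_le_onorm)
    ultimately show "onorm ((*v) (mat 1 :: 'a^'b^'b)) = 1" by simp
  qed
qed

end

lemma norm_to_mat_entry_le:
  "norm (to_mat (A :: ('a::comm_complex_banach_algebra_1,'n::finite) sqmat) $ i $ j) \<le> norm A * norm (1::'a)"
  unfolding norm_sqmat.rep_eq by (rule norm_entry_le_onorm)

lemma norm_sqmat_le_sum:
  "norm (A :: ('a::comm_complex_banach_algebra_1,'n::finite) sqmat) \<le> (\<Sum>i\<in>UNIV. \<Sum>j\<in>UNIV. norm (to_mat A $ i $ j))"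
  unfolding norm_sqmat.rep_eq by (rule onorm_matrix_le)

instance sqmat :: (comm_complex_banach_algebra_1, finite) banach
proof
  fix X :: "nat \<Rightarrow> ('a,'b) sqmat" assume X: "Cauchy X"
  have "Cauchy (\<lambda>k. to_mat (X k) $ i $ j)" for i j
  proof (rule metric_CauchyI)
    fix e :: real assume "e > 0"
    then have "e / norm (1::'a) > 0" by simp
    from metric_CauchyD[OF X this] obtain K where
      K: "\<And>m n. m \<ge> K \<Longrightarrow> n \<ge> K \<Longrightarrow> dist (X m) (X n) < e / norm (1::'a)" by blast
    show "\<exists>K. \<forall>m\<ge>K. \<forall>n\<ge>K. dist (to_mat (X m) $ i $ j) (to_mat (X n) $ i $ j) < e"
    proof (intro exI[of _ K] allI impI)
      fix m n assume "K \<le> m" "K \<le> n"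
      have "dist (to_mat (X m) $ i $ j) (to_mat (X n) $ i $ j) \<le> norm (X m - X n) * norm (1::'a)"
        using norm_to_mat_entry_le[of "X m - X n" i j] by (simp add: dist_norm minus_sqmat.rep_eq)
      also have "\<dots> < e" using K[OF \<open>K \<le> m\<close> \<open>K \<le> n\<close>] by (simp add: dist_norm field_simps)
      finally show "dist (to_mat (X m) $ i $ j) (to_mat (X n) $ i $ j) < e" .
    qed
  qed
  then have "\<forall>i j. \<exists>l. (\<lambda>k. to_mat (X k) $ i $ j) \<longlonglongrightarrow> l"
    using Cauchy_convergent convergent_def by blast
  then obtain l where l: "\<And>i j. (\<lambda>k. to_mat (X k) $ i $ j) \<longlonglongrightarrow> l i j" by metis
  define L :: "('a,'b) sqmat" where "L = of_mat (\<chi> i j. l i j)"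
  have L: "to_mat L $ i $ j = l i j" for i j unfolding L_def by (simp add: of_mat_inverse)
  have "(\<lambda>k. \<Sum>i\<in>UNIV. \<Sum>j\<in>UNIV. norm (to_mat (X k) $ i $ j - l i j)) \<longlonglongrightarrow> (\<Sum>i\<in>(UNIV::'b set). \<Sum>j\<in>(UNIV::'b set). norm (l i j - l i j))"
    by (intro tendsto_intros l)
  then have lim: "(\<lambda>k. \<Sum>i\<in>UNIV. \<Sum>j\<in>UNIV. norm (to_mat (X k) $ i $ j - l i j)) \<longlonglongrightarrow> 0" by simp
  have "(\<lambda>k. X k - L) \<longlonglongrightarrow> 0"
    by (rule Lim_null_comparison[OF always_eventually lim])
      (use norm_sqmat_le_sum[of "X _ - L"] in \<open>simp add: minus_sqmat.rep_eq L\<close>)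
  then have "X \<longlonglongrightarrow> L" by (simp add: LIM_zero_iff)
  then show "convergent X" by (auto simp: convergent_def)
qed

lemma to_mat_mult: "to_mat (A * B) = to_mat A ** to_mat B"
  and to_mat_add: "to_mat (A + B) = to_mat A + to_mat B"
  and to_mat_diff: "to_mat (A - B) = to_mat A - to_mat B"
  and to_mat_uminus: "to_mat (- A) = - to_mat A"
  and to_mat_scaleR: "to_mat (r *\<^sub>R A) = r *\<^sub>R to_mat A"
  and to_mat_1: "to_mat 1 = mat 1"
  and to_mat_0: "to_mat 0 = 0"
  by (rule times_sqmat.rep_eq plus_sqmat.rep_eq minus_sqmat.rep_eq uminus_sqmat.rep_eq
      scaleR_sqmat.rep_eq one_sqmat.rep_eq zero_sqmat.rep_eq)+

lemma to_mat_of_mat [simp]: "to_mat (of_mat M) = M"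
  by (simp add: of_mat_inverse)

lemmas to_mat_simps = to_mat_mult to_mat_add to_mat_diff to_mat_uminus to_mat_scaleR to_mat_1 to_mat_0

lemma sqmat_eqI: "to_mat A = to_mat B \<Longrightarrow> A = B"
  by (simp add: to_mat_inject)

lemma bounded_linear_sqmat_vector_mult:
  "bounded_linear (\<lambda>A :: ('a::comm_complex_banach_algebra_1,'n::finite) sqmat. to_mat A *v x)"
proof (rule bounded_linear_intro)
  show "norm (to_mat A *v x) \<le> norm A * norm x" for A :: "('a,'n) sqmat"
    unfolding norm_sqmat.rep_eq by (rule norm_matrix_vector_mult_le_onorm)
qed (simp_all add: to_mat_simps matrix_vector_mult_add_rdistrib matrix_vector_mult_scaleR_left)

lemma bounded_linear_to_mat:
  "bounded_linear (to_mat :: ('a::comm_complex_banach_algebra_1,'n::finite) sqmat \<Rightarrow> _)"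
proof (rule bounded_linear_intro)
  fix A :: "('a,'n) sqmat"
  have "norm (to_mat A) \<le> (\<Sum>i\<in>UNIV. \<Sum>j\<in>UNIV. norm (to_mat A $ i $ j))"
    by (intro order.trans[OF norm_vec_le_sum] sum_mono norm_vec_le_sum)
  also have "\<dots> \<le> (\<Sum>i\<in>(UNIV::'n set). \<Sum>j\<in>(UNIV::'n set). norm A * norm (1::'a))"
    by (intro sum_mono norm_to_mat_entry_le)
  also have "\<dots> = norm A * (\<Sum>i\<in>(UNIV::'n set). \<Sum>j\<in>(UNIV::'n set). norm (1::'a))"
    by (simp add: sum_distrib_left)
  finally show "norm (to_mat A) \<le> norm A * (\<Sum>i\<in>(UNIV::'n set). \<Sum>j\<in>(UNIV::'n set). norm (1::'a))" .
qed (simp_all add: to_mat_simps)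

lemma mat_pow_to_mat: "mat_pow (to_mat A) k = to_mat (A ^ k)"
  by (induction k) (simp_all add: mat_pow_def to_mat_simps)

lemma mat_exp_to_mat:
  "mat_exp (to_mat (A :: ('a::comm_complex_banach_algebra_1,'n::finite) sqmat)) = to_mat (exp A)"
proof -
  have "to_mat (exp A) = (\<Sum>k. to_mat (A ^ k /\<^sub>R fact k))"
    unfolding exp_def by (rule bounded_linear.suminf[OF bounded_linear_to_mat summable_exp_generic])
  then show ?thesis unfolding mat_exp_def mat_pow_to_mat by (simp add: to_mat_simps divide_inverse)
qed

section \<open>Spectral projections by dyadic averaging\<close>

lemma inverse_unique_left_right:
  fixes a :: "'m::ring_1"
  assumes "f * a = 1" "a * g = 1"
  shows "f = g"
  by (metis assms mult.assoc mult_1_left mult_1_right)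

lemma inverse_commutes:
  fixes a :: "'m::ring_1"
  assumes "f * a = 1" "a * f = 1" "a * x = x * a"
  shows "f * x = x * f"
proof -
  have "f * x = f * (x * a) * f" by (simp only: mult.assoc assms mult_1_right)
  also have "\<dots> = (f * a) * (x * f)" by (simp only: assms(3)[symmetric] mult.assoc)
  finally show ?thesis by (simp add: assms)
qed

lemma power_mult_power_eq_1:
  fixes a :: "'m::monoid_mult"
  assumes "a * b = 1"
  shows "a ^ n * b ^ n = 1"
proof (induction n)
  case (Suc n)
  have "a ^ Suc n * b ^ Suc n = a ^ n * (a * b) * b ^ n"
    unfolding power_Suc2[of a] power_Suc[of b] by (simp only: mult.assoc)
  then show ?case using assms Suc by simp
qed simp

text \<open>\<open>e t\<close> stands for the scalar exp (i t). The hypothesis says that the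
  spectrum of \<open>Z\<close> misses the unit circle, and \<open>f k\<close> is the average of the
  resolvent over the 2^k-th roots of unity, a Riemann sum of the contour integral that defines the
  spectral projection.\<close>

lemma dyadic_resolvent_limit:
  fixes Z :: "'m::{real_normed_algebra_1,banach}" and e :: "real \<Rightarrow> 'm"
  assumes e0: "e 0 = 1" and epi: "e pi = - 1" and e_add: "\<And>s t. e (s + t) = e s * e t"
    and e_comm: "\<And>t x. e t * x = x * e t" and e_lip: "\<And>s t. norm (e s - e t) \<le> \<bar>s - t\<bar>"
    and inv: "\<And>t. \<exists>g. g * (1 - e t * Z) = 1 \<and> (1 - e t * Z) * g = 1"
  shows "\<exists>f Q. (\<forall>k. f k * (1 - Z ^ (2^k)) = 1 \<and> (1 - Z ^ (2^k)) * f k = 1) \<and> f \<longlonglongrightarrow> Q \<and> Q * Q = Q"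
proof -
  obtain g where g: "\<And>t. g t * (1 - e t * Z) = 1" and g': "\<And>t. (1 - e t * Z) * g t = 1"
    using inv by metis
  have res: "norm (g s - g t) \<le> \<bar>s - t\<bar> * (norm Z * norm (g t)) * norm (g s)" for s t
  proof -
    have "g s - g t = g s * ((1 - e t * Z) * g t) - (g s * (1 - e s * Z)) * g t"
      by (simp add: g g')
    also have "\<dots> = g s * ((e s - e t) * (Z * g t))" by (simp add: algebra_simps)
    finally have "norm (g s - g t) \<le> norm (g s) * (norm (e s - e t) * (norm Z * norm (g t)))"
      by (smt (verit) mult_left_mono norm_ge_zero norm_mult_ineq)
    also have "\<dots> \<le> norm (g s) * (\<bar>s - t\<bar> * (norm Z * norm (g t)))"
      by (intro mult_left_mono mult_right_mono e_lip) auto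
    finally show ?thesis by (simp add: mult_ac)
  qed
  have "\<exists>d>0. \<exists>B. \<forall>s\<in>{0..2*pi}. dist t s < d \<longrightarrow> norm (g s) \<le> B" for t
  proof (rule exI[of _ "1 / (2 * (norm Z * norm (g t) + 1))"], intro conjI)
    let ?c = "norm Z * norm (g t)"
    have c: "0 \<le> ?c" by simp
    show "0 < 1 / (2 * (?c + 1))" using c by (simp add: add_nonneg_pos)
    show "\<exists>B. \<forall>s\<in>{0..2*pi}. dist t s < 1 / (2 * (?c + 1)) \<longrightarrow> norm (g s) \<le> B"
    proof (intro exI[of _ "2 * norm (g t)"] ballI impI)
      fix s assume "dist t s < 1 / (2 * (?c + 1))"
      then have "\<bar>s - t\<bar> * (2 * (?c + 1)) < 1"
        using c by (simp add: dist_real_def abs_minus_commute field_simps add_nonneg_pos)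
      moreover have "\<bar>s - t\<bar> * (2 * ?c) \<le> \<bar>s - t\<bar> * (2 * (?c + 1))" by (intro mult_left_mono) auto
      ultimately have "\<bar>s - t\<bar> * ?c \<le> 1/2" by simp
      then have "\<bar>s - t\<bar> * ?c * norm (g s) \<le> 1/2 * norm (g s)" by (intro mult_right_mono) auto
      moreover have "norm (g s) \<le> norm (g t) + norm (g s - g t)" by (metis norm_triangle_sub add.commute)
      ultimately show "norm (g s) \<le> 2 * norm (g t)" using res[of s t] by linarith
    qed
  qed
  then obtain B where B: "\<And>s. s \<in> {0..2*pi} \<Longrightarrow> norm (g s) \<le> B"
    using compact_locally_bounded_imp_bounded[OF compact_Icc, of 0 "2*pi" "\<lambda>s. norm (g s)"] by metis
  have B0: "B \<ge> 0" by (rule order.trans[OF norm_ge_zero B[of 0]]) simp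
  define L where "L = norm Z * B * B"
  have L0: "L \<ge> 0" unfolding L_def using B0 by simp
  have lip0: "norm (g s - g t) \<le> L * \<bar>s - t\<bar>" if "s \<in> {0..2*pi}" "t \<in> {0..2*pi}" for s t
  proof -
    have "norm (g s - g t) \<le> \<bar>s - t\<bar> * (norm Z * norm (g t)) * norm (g s)" by (rule res)
    also have "\<dots> \<le> \<bar>s - t\<bar> * (norm Z * B) * B"
      using B that B0 by (intro mult_mono) auto
    finally show ?thesis unfolding L_def by (simp add: mult_ac)
  qed
  \<comment> \<open>\<open>F k t\<close> will invert 1 - e t Z^(2^k): the angles t/2 and t/2 + pi
    are those of the two square roots of exp (i t). Both maps send [0, 2 pi] into itself and halve
    distances, so the Lipschitz constant of \<open>F k\<close> is halved with each step.\<close>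
  define F where "F = rec_nat g (\<lambda>k f t. (1/2) *\<^sub>R (f (t/2) + f (t/2 + pi)))"
  have F0: "F 0 = g" and FS: "\<And>k t. F (Suc k) t = (1/2) *\<^sub>R (F k (t/2) + F k (t/2 + pi))"
    unfolding F_def by simp_all
  have e_half: "e (t/2 + pi) = - e (t/2)" "e (t/2) * e (t/2) = e t" for t
    using e_add[of "t/2" pi] e_add[of "t/2" "t/2"] epi by simp_all
  have Finv: "F k t * (1 - e t * Z ^ (2^k)) = 1 \<and> (1 - e t * Z ^ (2^k)) * F k t = 1" for k t
  proof (induction k arbitrary: t)
    case 0 then show ?case using g g' F0 by simp
  next
    case (Suc k)
    define b where "b = e (t/2) * Z ^ (2^k)"
    define u where "u = F k (t/2)"
    define v where "v = F k (t/2 + pi)"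
    have u: "u * (1 - b) = 1" "(1 - b) * u = 1" and v: "v * (1 + b) = 1" "(1 + b) * v = 1"
      using Suc[of "t/2"] Suc[of "t/2 + pi"] unfolding b_def u_def v_def by (simp_all add: e_half)
    have "b * b = e (t/2) * (Z ^ (2^k) * e (t/2)) * Z ^ (2^k)" unfolding b_def by (simp only: mult.assoc)
    also have "Z ^ (2^k) * e (t/2) = e (t/2) * Z ^ (2^k)" by (rule e_comm[symmetric])
    also have "e (t/2) * (e (t/2) * Z ^ (2^k)) * Z ^ (2^k) = (e (t/2) * e (t/2)) * (Z ^ (2^k) * Z ^ (2^k))"
      by (simp only: mult.assoc)
    also have "\<dots> = e t * Z ^ (2^Suc k)"
      by (simp only: e_half power_add[symmetric] mult_2[symmetric] power_Suc)
    finally have bb: "e t * Z ^ (2^Suc k) = b * b" ..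
    have 1: "1 - b * b = (1 - b) * (1 + b)" and 2: "1 - b * b = (1 + b) * (1 - b)"
      by (simp_all add: algebra_simps)
    have "u * (1 - b * b) = (u * (1 - b)) * (1 + b)" "v * (1 - b * b) = (v * (1 + b)) * (1 - b)"
      "(1 - b * b) * u = (1 + b) * ((1 - b) * u)" "(1 - b * b) * v = (1 - b) * ((1 + b) * v)"
      by (simp only: 1 mult.assoc, simp only: 2 mult.assoc, simp only: 2 mult.assoc, simp only: 1 mult.assoc)
    then have "u * (1 - b * b) = 1 + b" "v * (1 - b * b) = 1 - b"
      "(1 - b * b) * u = 1 + b" "(1 - b * b) * v = 1 - b"
      by (simp_all only: u v mult_1_left mult_1_right)
    moreover have "(1/2) *\<^sub>R (1 + b + (1 - b)) = 1"
      by (simp add: scaleR_2[symmetric])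
    ultimately show ?case unfolding FS bb u_def[symmetric] v_def[symmetric]
      by (simp add: distrib_left distrib_right)
  qed
  have lip: "norm (F k s - F k t) \<le> L / 2^k * \<bar>s - t\<bar>" if "s \<in> {0..2*pi}" "t \<in> {0..2*pi}" for k s t
    using that
  proof (induction k arbitrary: s t)
    case 0 then show ?case using lip0 F0 by simp
  next
    case (Suc k)
    have "F (Suc k) s - F (Suc k) t = (1/2) *\<^sub>R ((F k (s/2) - F k (t/2)) + (F k (s/2 + pi) - F k (t/2 + pi)))"
      unfolding FS by (simp add: algebra_simps)
    then have "norm (F (Suc k) s - F (Suc k) t) \<le> (1/2) * (norm (F k (s/2) - F k (t/2)) + norm (F k (s/2 + pi) - F k (t/2 + pi)))"
      using norm_triangle_ineq[of "F k (s/2) - F k (t/2)" "F k (s/2 + pi) - F k (t/2 + pi)"] by simp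
    also have "\<dots> \<le> (1/2) * (L / 2^k * \<bar>s/2 - t/2\<bar> + L / 2^k * \<bar>(s/2 + pi) - (t/2 + pi)\<bar>)"
      using Suc.prems by (intro mult_left_mono add_mono Suc.IH) auto
    also have "\<bar>s/2 - t/2\<bar> = \<bar>s - t\<bar> / 2" by (simp add: abs_if field_simps)
    also have "\<bar>(s/2 + pi) - (t/2 + pi)\<bar> = \<bar>s - t\<bar> / 2" by (simp add: abs_if field_simps)
    finally show ?case by (simp add: field_simps)
  qed
  define f where "f k = F k 0" for k
  have f: "f k * (1 - Z ^ (2^k)) = 1" "(1 - Z ^ (2^k)) * f k = 1" for k
    using Finv[of k 0] unfolding f_def e0 by simp_all
  have dpi: "norm (F k pi - f k) \<le> L * pi * (1/2)^k" for k
    using lip[of pi 0 k] unfolding f_def by (simp add: power_divide mult_ac)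
  have diff: "norm (f (Suc k) - f k) \<le> L * pi * (1/2)^k" for k
  proof -
    have "f (Suc k) - f k = (1/2) *\<^sub>R (F k pi - f k)"
      using scaleR_add_left[of "1/2" "1/2" "f k"] unfolding f_def FS by (simp add: algebra_simps)
    then have "norm (f (Suc k) - f k) = (1/2) * norm (F k pi - f k)" by simp
    then show ?thesis using dpi[of k] norm_ge_zero[of "F k pi - f k"] by linarith
  qed
  have "summable (\<lambda>k. L * pi * (1/2)^k)" by (intro summable_mult summable_geometric) simp
  then have "summable (\<lambda>k. f (Suc k) - f k)"
    by (rule summable_comparison_test'[where N = 0]) (use diff in auto)
  then obtain S where "(\<lambda>n. \<Sum>k<n. f (Suc k) - f k) \<longlonglongrightarrow> S"
    using summable_LIMSEQ by blast
  then have "(\<lambda>n. f n - f 0 + f 0) \<longlonglongrightarrow> S + f 0"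
    unfolding sum_lessThan_telescope by (intro tendsto_intros)
  then obtain Q where Q: "f \<longlonglongrightarrow> Q" by auto
  have "(\<lambda>k. L * pi * (1/2)^k) \<longlonglongrightarrow> L * pi * 0"
    by (intro tendsto_intros LIMSEQ_power_zero) simp
  then have "(\<lambda>k. F k pi - f k) \<longlonglongrightarrow> 0"
    by (intro Lim_null_comparison[OF always_eventually[OF allI[OF dpi]]]) simp
  from tendsto_add[OF this Q] have Qpi: "(\<lambda>k. F k pi) \<longlonglongrightarrow> Q" by simp
  \<comment> \<open>From (1 + a) (1 - a) = 1 - a^2 at a = Z^(2^k). Both factors converge to
    \<open>Q\<close>, since \<open>F k\<close> is nearly constant, and so does the product; this is
    why \<open>Q\<close> is idempotent.\<close>
  have prod: "f k * F k pi = f (Suc k)" for k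
  proof (rule inverse_unique_left_right)
    let ?a = "Z ^ (2^k)"
    have v: "F k pi * (1 + ?a) = 1" using Finv[of k pi] epi by simp
    have "Z ^ (2^Suc k) = ?a * ?a" by (simp add: mult_2 power_add)
    then have *: "1 - Z ^ (2^Suc k) = (1 + ?a) * (1 - ?a)" by (simp add: algebra_simps)
    have "f k * F k pi * ((1 + ?a) * (1 - ?a)) = f k * (F k pi * (1 + ?a)) * (1 - ?a)"
      by (simp only: mult.assoc)
    then show "f k * F k pi * (1 - Z ^ (2^Suc k)) = 1" unfolding * v using f(1)[of k] by simp
    show "(1 - Z ^ (2^Suc k)) * f (Suc k) = 1" by (rule f)
  qed
  have "(\<lambda>k. f (Suc k)) \<longlonglongrightarrow> Q * Q"
    unfolding prod[symmetric] by (intro tendsto_mult Q Qpi)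
  then have "Q * Q = Q" using LIMSEQ_Suc[OF Q] LIMSEQ_unique by blast
  then show ?thesis using f Q by blast
qed

text \<open>As Z^(2^k) f k = f k - 1 and \<open>f k\<close> tends to the identity on the range of
  \<open>Q\<close>, the product Z^(2^k) f k Q tends to 0. The relation c = b + b c transfers this
  from \<open>c\<close> to \<open>b\<close>, with norm b \<le> 2 norm c once norm c < 1/2.\<close>

lemma dyadic_power_null:
  fixes Z :: "'m::{real_normed_algebra_1,banach}"
  assumes f: "\<And>k. f k * (1 - Z ^ (2^k)) = 1" "\<And>k. (1 - Z ^ (2^k)) * f k = 1"
    and lim: "f \<longlonglongrightarrow> Q" and idem: "Q * Q = Q" and comm: "Q * Z = Z * Q"
  shows "(\<lambda>k. Z ^ (2^k) * Q) \<longlonglongrightarrow> 0"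
proof -
  define b where "b k = Z ^ (2^k) * Q" for k
  define c where "c k = (f k - 1) * Q" for k
  have comm_pow: "Q * Z ^ n = Z ^ n * Q" for n
    by (induction n) (simp_all add: comm mult.assoc[symmetric], metis comm mult.assoc)
  have comm_f: "Q * f k = f k * Q" for k
    by (rule inverse_commutes[OF f, symmetric]) (simp add: left_diff_distrib right_diff_distrib comm_pow)
  have Zf: "Z ^ (2^k) * f k = f k - 1" for k using f(2)[of k] by (simp add: left_diff_distrib algebra_simps)
  have bc: "c k = b k + b k * c k" for k
  proof -
    have "c k = b k * f k" unfolding c_def b_def Zf[symmetric] mult.assoc comm_f ..
    also have "f k = 1 + (f k - 1)" by simp
    also have "b k * (1 + (f k - 1)) = b k + b k * (f k - 1)" by (simp add: algebra_simps)
    also have "b k * (f k - 1) = b k * (Q * (f k - 1))"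
    proof -
      have "b k * (Q * (f k - 1)) = Z ^ (2^k) * (Q * Q) * (f k - 1)"
        unfolding b_def by (simp only: mult.assoc)
      then show ?thesis unfolding idem b_def ..
    qed
    also have "Q * (f k - 1) = c k" unfolding c_def by (simp add: comm_f algebra_simps)
    finally show ?thesis .
  qed
  have "c \<longlonglongrightarrow> (Q - 1) * Q" unfolding c_def by (intro tendsto_intros lim)
  then have c0: "c \<longlonglongrightarrow> 0" by (simp add: left_diff_distrib idem)
  then have "(\<lambda>k. norm (c k)) \<longlonglongrightarrow> 0" by (simp add: tendsto_norm_zero)
  then have "\<forall>\<^sub>F k in sequentially. norm (c k) < 1/2" by (rule order_tendstoD) simp
  then have "\<forall>\<^sub>F k in sequentially. norm (b k) \<le> 2 * norm (c k)"
  proof eventually_elim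
    case (elim k)
    have "b k = c k - b k * c k" by (metis bc add_diff_cancel_right')
    then have "norm (b k) \<le> norm (c k) + norm (b k * c k)" by (metis norm_triangle_ineq4)
    also have "norm (b k * c k) \<le> norm (b k) * norm (c k)" by (rule norm_mult_ineq)
    also have "\<dots> \<le> norm (b k) * (1/2)" using elim by (intro mult_left_mono) auto
    finally show ?case by simp
  qed
  moreover have "(\<lambda>k. 2 * norm (c k)) \<longlonglongrightarrow> 0" using c0 by (auto intro!: tendsto_eq_intros)
  ultimately show ?thesis unfolding b_def by (rule Lim_null_comparison)
qed

text \<open>The spectral projection for the open left half plane, described by dynamics: the flow
  decays forward in time on the range and backward on the kernel. Time runs through powers of 2
  because those are the times that the averaging controls.\<close>

definition stable_projection :: "'m::{real_normed_algebra_1,banach} \<Rightarrow> 'm \<Rightarrow> bool" where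
  "stable_projection H Q \<longleftrightarrow> Q * Q = Q \<and> Q * H = H * Q \<and>
    (\<lambda>k. exp H ^ (2^k) * Q) \<longlonglongrightarrow> 0 \<and> (\<lambda>k. exp (- H) ^ (2^k) * (1 - Q)) \<longlonglongrightarrow> 0"

lemma stable_projectionD:
  assumes "stable_projection H Q"
  shows "Q * Q = Q" "Q * H = H * Q" "(\<lambda>k. exp H ^ (2^k) * Q) \<longlonglongrightarrow> 0"
    "(\<lambda>k. exp (- H) ^ (2^k) * (1 - Q)) \<longlonglongrightarrow> 0"
  using assms unfolding stable_projection_def by blast+

theorem exp_dyadic_projection:
  fixes H :: "'m::{real_normed_algebra_1,banach}" and e :: "real \<Rightarrow> 'm"
  assumes "e 0 = 1" "e pi = - 1" "\<And>s t. e (s + t) = e s * e t"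
    and "\<And>t x. e t * x = x * e t" "\<And>s t. norm (e s - e t) \<le> \<bar>s - t\<bar>"
    and "\<And>t. \<exists>g. g * (1 - e t * exp H) = 1 \<and> (1 - e t * exp H) * g = 1"
  obtains Q where "stable_projection H Q"
proof -
  obtain f Q where f: "\<And>k. f k * (1 - exp H ^ (2^k)) = 1" "\<And>k. (1 - exp H ^ (2^k)) * f k = 1"
    and lim: "f \<longlonglongrightarrow> Q" and idem: "Q * Q = Q"
    using dyadic_resolvent_limit[OF assms] by metis
  have comm: "Q * x = x * Q" if x: "x * exp H = exp H * x" for x
  proof -
    have xp: "x * exp H ^ n = exp H ^ n * x" for n
      by (induction n) (simp_all add: x mult.assoc[symmetric], metis x mult.assoc)
    have "f k * x = x * f k" for k
      by (rule inverse_commutes[OF f]) (simp add: left_diff_distrib right_diff_distrib xp)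
    then have "(\<lambda>k. f k * x) \<longlonglongrightarrow> x * Q" using tendsto_mult_left[OF lim, of x] by simp
    then show ?thesis using tendsto_mult_right[OF lim, of x] LIMSEQ_unique by blast
  qed
  have QH: "Q * H = H * Q" by (rule comm) (simp add: exp_times_arg_commute)
  have inv: "exp (- H) * exp H = 1" "exp H * exp (- H) = 1"
    using exp_minus_inverse[of H] exp_minus_inverse[of "- H"] by simp_all
  have "stable_projection H Q" unfolding stable_projection_def
  proof (intro conjI idem QH)
    show "(\<lambda>k. exp H ^ (2^k) * Q) \<longlonglongrightarrow> 0"
      by (rule dyadic_power_null[OF f lim idem]) (simp add: comm)
    show "(\<lambda>k. exp (- H) ^ (2^k) * (1 - Q)) \<longlonglongrightarrow> 0"
    proof (rule dyadic_power_null[where f = "\<lambda>k. 1 - f k"])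
      fix k
      \<comment> \<open>For the complement, 1 - 1 / (1 - z) = 1 / (1 - 1 / z): so
        \<open>1 - f k\<close> inverts 1 - exp (- H)^(2^k), and the same decay lemma serves the
        backward flow.\<close>
      let ?z = "exp H ^ (2^k)" and ?w = "exp (- H) ^ (2^k)"
      have zw: "?w * ?z = 1" and wz: "?z * ?w = 1" by (rule power_mult_power_eq_1, rule inv)+
      have 1: "1 - f k = - (?z * f k)" using f(2)[of k] by (simp add: left_diff_distrib algebra_simps)
      have 2: "1 - f k = - (f k * ?z)" using f(1)[of k] by (simp add: right_diff_distrib algebra_simps)
      show "(1 - f k) * (1 - ?w) = 1"
        unfolding 2 using f(1)[of k] by (simp add: right_diff_distrib mult.assoc wz)
      show "(1 - ?w) * (1 - f k) = 1"
        unfolding 1 using f(2)[of k] by (simp add: left_diff_distrib mult.assoc[symmetric] zw)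
    next
      show "(\<lambda>k. 1 - f k) \<longlonglongrightarrow> 1 - Q" by (intro tendsto_intros lim)
      show "(1 - Q) * (1 - Q) = 1 - Q" by (simp add: algebra_simps idem)
      have "Q * exp (- H) = exp (- H) * Q" by (rule comm) (simp add: inv)
      then show "(1 - Q) * exp (- H) = exp (- H) * (1 - Q)" by (simp add: algebra_simps)
    qed
  qed
  then show ?thesis by (rule that)
qed

section \<open>Eigenvectors of complex matrices\<close>

definition poly_act :: "complex^'n^'n \<Rightarrow> complex poly \<Rightarrow> complex^'n \<Rightarrow> complex^'n" where
  "poly_act M p v = fold_coeffs (\<lambda>a w. a *s v + M *v w) p 0"

lemma poly_act_0 [simp]: "poly_act M 0 v = 0"
  by (simp add: poly_act_def)

lemma poly_act_pCons [simp]: "poly_act M (pCons a p) v = a *s v + M *v poly_act M p v"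
  by (cases "p = 0 \<and> a = 0") (auto simp: poly_act_def)

lemma poly_act_add: "poly_act M (p + q) v = poly_act M p v + poly_act M q v"
  by (induction p q rule: poly_induct2)
    (simp_all add: matrix_vector_right_distrib vector_sadd_rdistrib algebra_simps)

lemma poly_act_smult: "poly_act M (smult c p) v = c *s poly_act M p v"
  by (induction p) (simp_all add: vector_add_ldistrib vector_smult_assoc vec.scale vector_scalar_commute)

lemma poly_act_sum: "poly_act M (\<Sum>i\<in>I. f i) v = (\<Sum>i\<in>I. poly_act M (f i) v)"
  by (induction I rule: infinite_finite_induct) (simp_all add: poly_act_add)

lemma poly_act_linear_factor:
  "poly_act M ([:- l, 1:] * q) v = M *v poly_act M q v - l *s poly_act M q v"
proof -
  have "[:- l, 1:] * q = pCons 0 q + smult (- l) q" by simp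
  then show ?thesis by (simp only: poly_act_add poly_act_smult) simp
qed

lemma poly_act_diff_vec: "poly_act M q (v - w) = poly_act M q v - poly_act M q w"
  by (induction q) (simp_all add: vec.scale_right_diff_distrib matrix_vector_mult_diff_distrib)

lemma poly_act_scale_vec: "poly_act M q (c *s v) = c *s poly_act M q v"
  by (induction q) (simp_all add: vector_add_ldistrib vector_smult_assoc vector_scalar_commute mult.commute)

lemma poly_act_mult_vec: "poly_act M q (M *v v) = M *v poly_act M q v"
  by (induction q) (simp_all add: matrix_vector_right_distrib vector_scalar_commute)

lemma poly_act_commutes: "poly_act M q (M *v v - l *s v) = M *v poly_act M q v - l *s poly_act M q v"
  by (simp add: poly_act_diff_vec poly_act_scale_vec poly_act_mult_vec)

lemma poly_act_monom: "poly_act M (monom c i) v = c *s (((*v) M) ^^ i) v"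
  by (induction i) (simp_all add: monom_0 monom_Suc vector_scalar_commute)

lemma norm_scale_vec: "norm (z *s x) = cmod z * norm (x :: complex^'n)"
  by (simp add: norm_vec_def norm_mult L2_set_right_distrib)

lemma of_real_scale_vec: "complex_of_real r *s x = r *\<^sub>R x"
  by (simp add: vec_eq_iff scaleR_conv_of_real[where 'a = complex])

text \<open>A Krylov argument: one more iterate of \<open>v\<close> than the real dimension must be
  dependent. Coinciding iterates are treated separately, because dependence refers to the set of
  iterates and would not see a repetition.\<close>

lemma poly_act_annihilator: "\<exists>p. p \<noteq> 0 \<and> poly_act M p v = 0"
proof -
  let ?w = "\<lambda>i. (((*v) M) ^^ i) v"
  let ?I = "{..DIM(complex^'a)}"
  show ?thesis
  proof (cases "inj_on ?w ?I")
    case False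
    then obtain i j where ij: "i \<noteq> j" "?w i = ?w j" unfolding inj_on_def by blast
    let ?p = "monom 1 i + monom (-1) j :: complex poly"
    have "coeff ?p i = 1" using ij by simp
    then have "?p \<noteq> 0" by (metis coeff_0 zero_neq_one)
    moreover have "poly_act M ?p v = 0" using ij by (simp add: poly_act_add poly_act_monom)
    ultimately show ?thesis by blast
  next
    case True
    then have "card (?w ` ?I) = DIM(complex^'a) + 1" by (simp add: card_image)
    then have "dependent (?w ` ?I)" by (intro dependent_biggerset) simp
    then obtain u where u: "\<exists>x\<in>?w ` ?I. u x \<noteq> 0" "(\<Sum>x\<in>?w ` ?I. u x *\<^sub>R x) = 0"
      unfolding dependent_finite[OF finite_imageI[OF finite_atMost]] by blast
    let ?p = "\<Sum>i\<in>?I. monom (complex_of_real (u (?w i))) i"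
    obtain i where i: "i \<in> ?I" "u (?w i) \<noteq> 0" using u by blast
    have "coeff ?p i = complex_of_real (u (?w i))" using i by (simp add: coeff_sum)
    then have "?p \<noteq> 0" using i by (metis coeff_0 of_real_eq_0_iff)
    moreover have "poly_act M ?p v = 0"
    proof -
      show ?thesis using u(2) unfolding sum.reindex[OF True]
        by (simp add: poly_act_sum poly_act_monom of_real_scale_vec)
    qed
    ultimately show ?thesis by blast
  qed
qed

text \<open>Applies a product of factors M - l one at a time, so that inductions can follow the
  intermediate vectors.\<close>

fun reduce_by :: "complex^'n^'n \<Rightarrow> complex list \<Rightarrow> complex^'n \<Rightarrow> complex^'n" where
  "reduce_by M [] v = v"
| "reduce_by M (l # ls) v = reduce_by M ls (M *v v - l *s v)"

text \<open>Split off a root \<open>l\<close> of an annihilating polynomial, p = (X - l) q. Either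
  q(M) already kills \<open>v\<close>, or q(M) v is an eigenvector for \<open>l\<close>, and then
  q(M) kills (M - l) v. Only roots that are genuine eigenvalues are thus collected.\<close>

theorem eigenvalue_list_annihilates:
  "\<exists>ls. (\<forall>l\<in>set ls. is_eigenvalue M l) \<and> reduce_by M ls v = 0"
proof -
  have "\<exists>ls. (\<forall>l\<in>set ls. is_eigenvalue M l) \<and> reduce_by M ls v = 0"
    if "p \<noteq> 0" "poly_act M p v = 0" for p v
    using that
  proof (induction "degree p" arbitrary: p v)
    case 0
    then obtain a where "p = [:a:]" "a \<noteq> 0" by (metis degree_eq_zeroE pCons_0_0)
    with 0 have "v = 0" by (auto simp: vector_mul_eq_0)
    then show ?case by (intro exI[of _ "[]"]) simp
  next
    case (Suc n)
    then have "\<not> constant (poly p)" by (simp add: constant_degree)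
    then obtain l where "poly p l = 0" using fundamental_theorem_of_algebra by blast
    then obtain q where q: "p = [:- l, 1:] * q" by (metis dvdE poly_eq_0_iff_dvd)
    have q0: "q \<noteq> 0" using Suc.prems q by auto
    have "degree p = Suc (degree q)" unfolding q using q0 by (subst degree_mult_eq) auto
    then have dq: "n = degree q" using Suc.hyps(2) by simp
    have act: "M *v poly_act M q v - l *s poly_act M q v = 0"
      using Suc.prems(2) unfolding q poly_act_linear_factor .
    show ?case
    proof (cases "poly_act M q v = 0")
      case True
      then show ?thesis using Suc.hyps(1)[OF dq q0] by blast
    next
      case False
      then have l: "is_eigenvalue M l" unfolding is_eigenvalue_def using act by auto
      have "poly_act M q (M *v v - l *s v) = 0" unfolding poly_act_commutes by (rule act)
      then obtain ls where "\<forall>l\<in>set ls. is_eigenvalue M l" "reduce_by M ls (M *v v - l *s v) = 0"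
        using Suc.hyps(1)[OF dq q0] by blast
      then show ?thesis using l by (intro exI[of _ "l # ls"]) simp
    qed
  qed
  then show ?thesis using poly_act_annihilator by blast
qed

text \<open>The last nonzero vector in the chain of factors M - l is an eigenvector, and the chain
  stays in \<open>S\<close>. It is applied to sets cut out by linear equations compatible with
  \<open>M\<close>, such as ranges of commuting projections.\<close>

theorem eigenvector_in_invariant_set:
  fixes M :: "complex^'n^'n"
  assumes "v \<in> S" "v \<noteq> 0" and inv: "\<And>x l. x \<in> S \<Longrightarrow> M *v x - l *s x \<in> S"
  obtains w l where "w \<in> S" "w \<noteq> 0" "M *v w = l *s w"
proof -
  have "\<exists>w l. w \<in> S \<and> w \<noteq> 0 \<and> M *v w = l *s w"
    if "reduce_by M ls v = 0" "v \<in> S" "v \<noteq> 0" for ls v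
    using that
  proof (induction ls arbitrary: v)
    case (Cons l ls)
    then show ?case using inv[of v l] by (cases "M *v v - l *s v = 0") auto
  qed simp
  then show ?thesis using that eigenvalue_list_annihilates[of M v] assms by blast
qed

lemma invertible_if_injective:
  fixes M :: "'a::field^'n^'n"
  assumes "\<And>x. M *v x = 0 \<Longrightarrow> x = 0"
  shows "invertible M"
  using assms matrix_left_invertible_ker[of M] invertible_left_inverse[of M] by blast

section \<open>The Gelfand transform of a matrix algebra\<close>

lemma exp_hom:
  fixes h :: "'a::{real_normed_algebra_1,banach} \<Rightarrow> 'b::{real_normed_algebra_1,banach}"
  assumes h: "bounded_linear h" and mult: "\<And>x y. h (x * y) = h x * h y" and one: "h 1 = 1"
  shows "h (exp x) = exp (h x)"
proof -
  have pow: "h (x ^ n) = h x ^ n" for n by (induction n) (simp_all add: mult one)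
  have "h (exp x) = (\<Sum>n. h (x ^ n /\<^sub>R fact n))"
    unfolding exp_def by (rule bounded_linear.suminf[OF h summable_exp_generic])
  also have "\<dots> = (\<Sum>n. h x ^ n /\<^sub>R fact n)"
    by (simp add: linear_simps(5)[OF h] pow)
  finally show ?thesis unfolding exp_def .
qed

definition sq_gelfand :: "('a::comm_complex_banach_algebra_1 \<Rightarrow> complex) \<Rightarrow> ('a, 'n::finite) sqmat \<Rightarrow> (complex, 'n) sqmat" where
  "sq_gelfand \<phi> A = of_mat (gelfand_mat (to_mat A) \<phi>)"

lemma to_mat_sq_gelfand [simp]: "to_mat (sq_gelfand \<phi> A) = gelfand_mat (to_mat A) \<phi>"
  by (simp add: sq_gelfand_def)

context
  fixes \<phi> :: "'a::comm_complex_banach_algebra_1 \<Rightarrow> complex"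
  assumes \<phi>: "\<phi> \<in> max_ideal_space"
begin

lemma sq_gelfand_mult: "sq_gelfand \<phi> (A * B) = sq_gelfand \<phi> A * sq_gelfand \<phi> B"
  and sq_gelfand_add: "sq_gelfand \<phi> (A + B) = sq_gelfand \<phi> A + sq_gelfand \<phi> B"
  and sq_gelfand_diff: "sq_gelfand \<phi> (A - B) = sq_gelfand \<phi> A - sq_gelfand \<phi> B"
  and sq_gelfand_uminus: "sq_gelfand \<phi> (- A) = - sq_gelfand \<phi> A"
  and sq_gelfand_1: "sq_gelfand \<phi> 1 = 1"
  by (auto intro!: sqmat_eqI simp: to_mat_simps gelfand_mat_mult gelfand_mat_add gelfand_mat_diff
      gelfand_mat_uminus gelfand_mat_mat character_1 \<phi>)

lemma sq_gelfand_power: "sq_gelfand \<phi> (A ^ n) = sq_gelfand \<phi> A ^ n"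
  by (induction n) (simp_all add: sq_gelfand_1 sq_gelfand_mult)

end

lemma bounded_linear_sq_gelfand:
  fixes \<phi> :: "'a::comm_complex_banach_algebra_1 \<Rightarrow> complex"
  assumes p: "\<phi> \<in> max_ideal_space"
  shows "bounded_linear (sq_gelfand \<phi> :: ('a, 'n::finite) sqmat \<Rightarrow> _)"
proof (rule bounded_linear_intro)
  fix A B :: "('a, 'n) sqmat" and r :: real
  show "sq_gelfand \<phi> (A + B) = sq_gelfand \<phi> A + sq_gelfand \<phi> B" using p by (rule sq_gelfand_add)
  show "sq_gelfand \<phi> (r *\<^sub>R A) = r *\<^sub>R sq_gelfand \<phi> A"
    using linear_simps(5)[OF bounded_linear_character[OF p]]
    by (intro sqmat_eqI) (simp add: to_mat_simps vec_eq_iff)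
  have "norm (sq_gelfand \<phi> A) \<le> (\<Sum>i\<in>UNIV. \<Sum>j\<in>UNIV. norm (\<phi> (to_mat A $ i $ j)))"
    using norm_sqmat_le_sum[of "sq_gelfand \<phi> A"] by simp
  also have "\<dots> \<le> (\<Sum>i\<in>(UNIV::'n set). \<Sum>j\<in>(UNIV::'n set). norm A * norm (1::'a))"
    by (intro sum_mono order.trans[OF norm_character_le[OF p] norm_to_mat_entry_le])
  also have "\<dots> = norm A * (\<Sum>i\<in>(UNIV::'n set). \<Sum>j\<in>(UNIV::'n set). norm (1::'a))"
    by (simp add: sum_distrib_left)
  finally show "norm (sq_gelfand \<phi> A) \<le> norm A * (\<Sum>i\<in>(UNIV::'n set). \<Sum>j\<in>(UNIV::'n set). norm (1::'a))" .
qed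

lemma sq_gelfand_exp: "\<phi> \<in> max_ideal_space \<Longrightarrow> sq_gelfand \<phi> (exp A) = exp (sq_gelfand \<phi> A)"
  by (rule exp_hom[OF bounded_linear_sq_gelfand]) (simp_all add: sq_gelfand_mult sq_gelfand_1)

lemma sqmat_power_eigenvector:
  assumes "to_mat A *v v = l *s v"
  shows "to_mat (A ^ n) *v v = l ^ n *s (v :: complex^'n)"
  by (induction n)
    (simp_all add: to_mat_simps assms vector_scalar_commute vector_smult_assoc mult.commute
      flip: matrix_vector_mul_assoc)

lemma exp_sqmat_eigenvector:
  fixes A :: "(complex, 'n::finite) sqmat"
  assumes "to_mat A *v v = l *s v"
  shows "to_mat (exp A) *v v = exp l *s v"
proof -
  have bl: "bounded_linear (\<lambda>c. c *s v)"
  proof (rule bounded_linear_intro)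
    show "norm (c *s v) \<le> norm c * norm v" for c by (simp add: norm_scale_vec)
  qed (simp_all add: vec_eq_iff algebra_simps)
  have "to_mat (exp A) *v v = (\<Sum>n. to_mat (A ^ n /\<^sub>R fact n) *v v)"
    unfolding exp_def by (rule bounded_linear.suminf[OF bounded_linear_sqmat_vector_mult summable_exp_generic])
  also have "\<dots> = (\<Sum>n. (l ^ n /\<^sub>R fact n) *s v)"
    by (simp add: to_mat_simps matrix_vector_mult_scaleR_left sqmat_power_eigenvector[OF assms] linear_simps(5)[OF bl])
  also have "\<dots> = exp l *s v"
    unfolding exp_def by (rule bounded_linear.suminf[OF bl summable_exp_generic, symmetric])
  finally show ?thesis .
qed

definition sq_scalar :: "complex \<Rightarrow> ('a::comm_complex_banach_algebra_1, 'n::finite) sqmat" where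
  "sq_scalar c = of_mat (mat (c *\<^sub>C 1))"

lemma mat_mult_matrix:
  fixes M :: "'a::semiring_1^'n^'m"
  shows "mat c ** M = (\<chi> i j. c * M $ i $ j)"
  by (simp add: matrix_matrix_mult_def mat_def vec_eq_iff if_distrib[of "\<lambda>x. x * _"] cong: if_cong)

lemma matrix_mult_mat:
  fixes M :: "'a::semiring_1^'n^'m"
  shows "M ** mat c = (\<chi> i j. M $ i $ j * c)"
  by (simp add: matrix_matrix_mult_def mat_def vec_eq_iff if_distrib[of "\<lambda>x. _ * x"] cong: if_cong)

lemma mat_vector_mult:
  fixes x :: "'a::semiring_1^'n"
  shows "mat c *v x = (\<chi> i. c * x $ i)"
  by (simp add: matrix_vector_mult_def mat_def vec_eq_iff if_distrib[of "\<lambda>x. x * _"] cong: if_cong)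

lemma mat_mult_mat: "mat c ** mat d = mat (c * d)"
  unfolding mat_mult_matrix by (simp add: mat_def vec_eq_iff)

lemma sq_scalar_commute: "sq_scalar c * A = A * sq_scalar c"
  by (rule sqmat_eqI) (simp add: sq_scalar_def to_mat_simps mat_mult_matrix matrix_mult_mat vec_eq_iff mult.commute)

lemma sq_scalar_mult: "sq_scalar (c * d) = sq_scalar c * sq_scalar d"
  by (rule sqmat_eqI) (simp add: sq_scalar_def to_mat_simps mat_mult_mat mult_scaleC_left scaleC_scaleC)

lemma sq_scalar_diff: "sq_scalar (c - d) = sq_scalar c - sq_scalar d"
  by (rule sqmat_eqI) (simp add: sq_scalar_def to_mat_simps vec_eq_iff mat_def scaleC_diff_left)

lemma sq_scalar_1: "sq_scalar 1 = 1" and sq_scalar_minus_1: "sq_scalar (- 1) = - 1"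
  by (rule sqmat_eqI, simp add: sq_scalar_def to_mat_simps vec_eq_iff mat_def)+

lemma norm_sq_scalar_le: "norm (sq_scalar c :: ('a::comm_complex_banach_algebra_1, 'n::finite) sqmat) \<le> cmod c"
  unfolding norm_sqmat.rep_eq
proof (rule onorm_bound)
  fix x :: "'a^'n"
  have "to_mat (sq_scalar c) *v x = (\<chi> i. c *\<^sub>C x $ i)"
    by (simp add: sq_scalar_def mat_vector_mult mult_scaleC_left)
  then show "norm (to_mat (sq_scalar c) *v x) \<le> cmod c * norm x"
    by (simp add: norm_vec_def norm_scaleC L2_set_right_distrib)
qed simp

lemma norm_cis_diff_le: "cmod (cis s - cis t) \<le> \<bar>s - t\<bar>"
proof -
  have "cis s - cis t = cis t * (cis (s - t) - 1)" by (simp add: cis_mult algebra_simps)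
  then have "cmod (cis s - cis t) = cmod (exp (\<i> * of_real (s - t)) - 1)"
    by (simp add: norm_mult cis_conv_exp)
  also have "\<dots> = 2 * \<bar>sin ((s - t) / 2)\<bar>" by (rule dist_exp_i_1)
  also have "\<dots> \<le> \<bar>s - t\<bar>" using abs_sin_x_le_abs_x[of "(s - t) / 2"] by simp
  finally show ?thesis .
qed

text \<open>If 1 - cis t * exp H were singular at a character, the kernel there would be invariant
  under the transform of \<open>H\<close> and contain an eigenvector with eigenvalue
  \<open>l\<close>. Then cis t * exp l = 1, which forces Re l = 0.\<close>

theorem spectral_projection:
  fixes H :: "('a::comm_complex_banach_algebra_1, 'n::finite) sqmat"
  assumes no_imag: "\<And>\<phi> z. \<phi> \<in> max_ideal_space \<Longrightarrow> Re z = 0 \<Longrightarrow> \<not> is_eigenvalue (gelfand_mat (to_mat H) \<phi>) z"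
  obtains Q where "stable_projection H Q"
proof -
  let ?e = "\<lambda>t. sq_scalar (cis t) :: ('a, 'n) sqmat"
  have inv: "\<exists>g. g * (1 - ?e t * exp H) = 1 \<and> (1 - ?e t * exp H) * g = 1" for t
  proof -
    let ?N = "1 - ?e t * exp H"
    have "invertible (to_mat ?N)"
    proof (rule invertible_if_gelfand_mat_invertible, rule invertible_if_injective, rule ccontr)
      fix \<phi> :: "'a \<Rightarrow> complex" and v :: "complex^'n"
      assume p: "\<phi> \<in> max_ideal_space" and v: "gelfand_mat (to_mat ?N) \<phi> *v v = 0" "v \<noteq> 0"
      let ?H = "sq_gelfand \<phi> H"
      have scal: "gelfand_mat (to_mat (?e t)) \<phi> *v x = cis t *s x" for x
        using p by (simp add: sq_scalar_def gelfand_mat_mat character_simps mat_vector_mult vec_eq_iff)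
      have act: "gelfand_mat (to_mat ?N) \<phi> *v x = x - cis t *s (to_mat (exp ?H) *v x)" for x
        using p by (simp add: to_mat_simps gelfand_mat_diff gelfand_mat_mult gelfand_mat_mat character_1
            matrix_vector_mult_diff_rdistrib scal flip: matrix_vector_mul_assoc sq_gelfand_exp)
      let ?S = "{x. cis t *s (to_mat (exp ?H) *v x) = x}"
      have comm: "to_mat (exp ?H) *v (to_mat ?H *v x) = to_mat ?H *v (to_mat (exp ?H) *v x)" for x
        by (simp only: matrix_vector_mul_assoc to_mat_mult[symmetric] exp_times_arg_commute)
      obtain w l where w: "w \<in> ?S" "w \<noteq> 0" "to_mat ?H *v w = l *s w"
      proof (rule eigenvector_in_invariant_set[where S = ?S and v = v and M = "to_mat ?H"])
        show "v \<in> ?S" using v(1) unfolding act by simp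
        fix x l assume x: "x \<in> ?S"
        have "cis t *s (to_mat (exp ?H) *v (to_mat ?H *v x - l *s x)) =
          to_mat ?H *v (cis t *s (to_mat (exp ?H) *v x)) - l *s (cis t *s (to_mat (exp ?H) *v x))"
          by (simp add: matrix_vector_mult_diff_distrib comm vector_scalar_commute vec.scale_right_diff_distrib
              vector_smult_assoc mult.commute del: to_mat_sq_gelfand)
        moreover have "cis t *s (to_mat (exp ?H) *v x) = x" using x by simp
        ultimately show "to_mat ?H *v x - l *s x \<in> ?S" by (simp only: mem_Collect_eq)
      qed (rule v)
      have "(cis t * exp l) *s w = w"
        using w(1) exp_sqmat_eigenvector[OF w(3)] by (simp add: vector_smult_assoc)
      then have "(cis t * exp l - 1) *s w = 0" by (simp add: vec.scale_left_diff_distrib)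
      then have "cis t * exp l - 1 = 0" using w(2) unfolding vector_mul_eq_0 by blast
      then have "cis t * exp l = 1" by simp
      then have "cmod (cis t * exp l) = 1" by simp
      then have "Re l = 0" by (simp add: norm_mult)
      moreover have "is_eigenvalue (gelfand_mat (to_mat H) \<phi>) l"
        unfolding is_eigenvalue_def using w by auto
      ultimately show False using no_imag p by blast
    qed
    then obtain G where G: "to_mat ?N ** G = mat 1" "G ** to_mat ?N = mat 1"
      unfolding invertible_def by blast
    show ?thesis
      by (intro exI[of _ "of_mat G"] conjI sqmat_eqI) (simp_all add: to_mat_mult to_mat_1 G)
  qed
  have e: "?e 0 = 1" "?e pi = - 1" "\<And>s t. ?e (s + t) = ?e s * ?e t"
    by (simp_all add: sq_scalar_1 sq_scalar_minus_1 cis_mult flip: sq_scalar_mult)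
  have lip: "norm (?e s - ?e t) \<le> \<bar>s - t\<bar>" for s t
    unfolding sq_scalar_diff[symmetric] by (rule order.trans[OF norm_sq_scalar_le norm_cis_diff_le])
  show ?thesis
    by (rule exp_dyadic_projection[of ?e H, OF e sq_scalar_commute lip inv], rule that)
qed

section \<open>Exponential stability over the algebra\<close>

lemma exp_of_nat_scaleR:
  fixes A :: "'a::{real_normed_algebra_1,banach}"
  shows "exp (real n *\<^sub>R A) = exp A ^ n"
proof (induction n)
  case (Suc n)
  have "exp (real (Suc n) *\<^sub>R A) = exp (A + real n *\<^sub>R A)" by (simp add: scaleR_left_distrib)
  also have "\<dots> = exp A * exp (real n *\<^sub>R A)" by (rule exp_add_commuting) simp
  finally show ?case using Suc by simp
qed simp

lemma sq_gelfand_tendsto_0: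
  assumes "\<phi> \<in> max_ideal_space" "(\<lambda>k. exp H ^ (2^k) * R) \<longlonglongrightarrow> 0"
  shows "(\<lambda>k. exp (sq_gelfand \<phi> H) ^ (2^k) * sq_gelfand \<phi> R) \<longlonglongrightarrow> 0"
proof -
  have "(\<lambda>k. sq_gelfand \<phi> (exp H ^ (2^k) * R)) \<longlonglongrightarrow> sq_gelfand \<phi> 0"
    by (intro bounded_linear.tendsto[OF bounded_linear_sq_gelfand[OF assms(1)]] assms(2))
  then show ?thesis
    using assms(1) by (simp add: sq_gelfand_mult sq_gelfand_power sq_gelfand_exp
        linear_simps(3)[OF bounded_linear_sq_gelfand])
qed

text \<open>On an eigenvector the flow multiplies by powers of exp l, which cannot shrink it unless
  Re l < 0. Stated for decay alone, so that it also serves the backward flow.\<close>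

lemma eigenvalue_stable_if_null:
  fixes H Q :: "(complex, 'n::finite) sqmat"
  assumes lim: "(\<lambda>k. exp H ^ (2^k) * Q) \<longlonglongrightarrow> 0"
    and s: "to_mat Q *v s = s" "s \<noteq> 0" "to_mat H *v s = l *s s"
  shows "Re l < 0"
proof (rule ccontr)
  assume "\<not> Re l < 0"
  have "(\<lambda>k. to_mat (exp H ^ (2^k) * Q) *v s) \<longlonglongrightarrow> to_mat 0 *v s"
    by (intro bounded_linear.tendsto[OF bounded_linear_sqmat_vector_mult] lim)
  moreover have "to_mat (exp H ^ (2^k) * Q) *v s = exp l ^ (2^k) *s s" for k
    using sqmat_power_eigenvector[OF exp_sqmat_eigenvector[OF s(3)], of "2^k"] s(1)
    by (simp add: to_mat_mult flip: matrix_vector_mul_assoc)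
  ultimately have "(\<lambda>k. exp l ^ (2^k) *s s) \<longlonglongrightarrow> 0" by (simp add: to_mat_0)
  moreover have "norm s \<le> norm (exp l ^ (2^k) *s s)" for k
  proof -
    have "cmod (exp l ^ (2^k)) \<ge> 1" using \<open>\<not> Re l < 0\<close> by (simp add: norm_power one_le_power)
    then show ?thesis unfolding norm_scale_vec using mult_right_mono[of 1 _ "norm s"] by simp
  qed
  ultimately have "norm s \<le> norm (0 :: complex^'n)"
    by (intro LIMSEQ_le_const[OF tendsto_norm]) auto
  then show False using s(2) by simp
qed

lemma projection_eigenvalue_stable:
  fixes H Q :: "(complex, 'n::finite) sqmat"
  assumes "stable_projection H Q" "to_mat Q *v s = s" "s \<noteq> 0" "to_mat H *v s = l *s s"
  shows "Re l < 0"
  using eigenvalue_stable_if_null[OF stable_projectionD(3)[OF assms(1)] assms(2-)] .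

text \<open>The stable projection must be 1. Otherwise, at some character, the range of 1 - Q
  contains an eigenvector of \<open>A\<close>, whose eigenvalue has negative real part by hypothesis
  and positive real part by backward decay.\<close>

theorem stable_exp_powers_null:
  fixes A :: "('a::comm_complex_banach_algebra_1, 'n::finite) sqmat"
  assumes ss: "semisimple TYPE('a)"
    and stab: "\<And>\<phi>. \<phi> \<in> max_ideal_space \<Longrightarrow> complex_exp_stable (gelfand_mat (to_mat A) \<phi>)"
  shows "(\<lambda>k. exp A ^ (2^k)) \<longlonglongrightarrow> 0"
proof -
  have "\<not> is_eigenvalue (gelfand_mat (to_mat A) \<phi>) z" if "\<phi> \<in> max_ideal_space" "Re z = 0" for \<phi> z
    using stab[OF that(1)] that(2) unfolding complex_exp_stable_def by auto
  then obtain Q where "stable_projection A Q"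
    by (rule spectral_projection)
  note Q = stable_projectionD[OF this]
  have "to_mat (1 - Q) = 0"
  proof (rule gelfand_mat_eqI[OF ss], rule ccontr)
    fix \<phi> :: "'a \<Rightarrow> complex" assume p: "\<phi> \<in> max_ideal_space"
    let ?A = "sq_gelfand \<phi> A" and ?R = "sq_gelfand \<phi> (1 - Q)"
    assume "gelfand_mat (to_mat (1 - Q)) \<phi> \<noteq> gelfand_mat 0 \<phi>"
    then have "to_mat ?R \<noteq> 0" using p by (simp add: gelfand_mat_0)
    then obtain v where v: "to_mat ?R *v v \<noteq> 0" by (metis matrix_eq matrix_vector_mult_0)
    have RR: "?R * ?R = ?R"
      unfolding sq_gelfand_mult[OF p, symmetric] by (simp add: algebra_simps Q(1))
    have RA: "?R * ?A = ?A * ?R"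
      unfolding sq_gelfand_mult[OF p, symmetric] by (simp add: algebra_simps Q(2))
    obtain w l where w: "to_mat ?R *v w = w" "w \<noteq> 0" "to_mat ?A *v w = l *s w"
    proof (rule eigenvector_in_invariant_set[where S = "{x. to_mat ?R *v x = x}" and v = "to_mat ?R *v v" and M = "to_mat ?A"])
      show "to_mat ?R *v v \<in> {x. to_mat ?R *v x = x}"
        by (simp only: mem_Collect_eq matrix_vector_mul_assoc to_mat_mult[symmetric] RR)
      fix x l assume x: "x \<in> {x. to_mat ?R *v x = x}"
      have "to_mat ?R *v (to_mat ?A *v x - l *s x) = to_mat ?A *v (to_mat ?R *v x) - l *s (to_mat ?R *v x)"
        by (simp only: matrix_vector_mult_diff_distrib vector_scalar_commute matrix_vector_mul_assoc to_mat_mult[symmetric] RA)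
      then show "to_mat ?A *v x - l *s x \<in> {x. to_mat ?R *v x = x}" using x by simp
    qed (use v in auto)
    have l: "Re l < 0"
      using stab[OF p] w(2,3) unfolding complex_exp_stable_def is_eigenvalue_def by auto
    have lim: "(\<lambda>k. exp (- ?A) ^ (2^k) * ?R) \<longlonglongrightarrow> 0"
      using sq_gelfand_tendsto_0[OF p Q(4)] p by (simp add: sq_gelfand_uminus)
    have "to_mat (- ?A) *v w = (- l) *s w"
      using w(3) by (simp add: to_mat_simps vec_eq_iff matrix_vector_mult_def sum_negf)
    then have "Re (- l) < 0" by (rule eigenvalue_stable_if_null[OF lim w(1,2)])
    then show False using l by simp
  qed
  then have "Q = 1" by (metis to_mat_0 sqmat_eqI right_minus_eq)
  then show ?thesis using Q(3) by simp
qed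

text \<open>Some time \<open>T\<close> at least halves the norm, which fixes the rate (ln 2) / T. In
  \<open>K\<close>, the factor 2 pays for rounding t / T down and the exponential bounds the flow
  over the remaining time.\<close>

lemma exp_decay_if_powers_null:
  fixes A :: "'a::{real_normed_algebra_1,banach}"
  assumes "(\<lambda>k. exp A ^ (2^k)) \<longlonglongrightarrow> 0"
  shows "\<exists>K>0. \<exists>\<epsilon>>0. \<forall>t\<ge>0. norm (exp (t *\<^sub>R A)) \<le> K * exp (- \<epsilon> * t)"
proof -
  have "(\<lambda>k. norm (exp A ^ (2^k))) \<longlonglongrightarrow> 0" using assms by (rule tendsto_norm_zero)
  then have "\<forall>\<^sub>F k in sequentially. norm (exp A ^ (2^k)) < 1/2" by (rule order_tendstoD) simp
  then obtain k where k: "norm (exp A ^ (2^k)) < 1/2" unfolding eventually_sequentially by blast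
  define T where "T = real (2^k)"
  have T: "T > 0" unfolding T_def by simp
  have half: "norm (exp (T *\<^sub>R A)) \<le> 1/2" unfolding T_def exp_of_nat_scaleR using k by simp
  define K where "K = 2 * exp (T * norm A)"
  define \<epsilon> where "\<epsilon> = ln 2 / T"
  have "norm (exp (t *\<^sub>R A)) \<le> K * exp (- \<epsilon> * t)" if t: "t \<ge> 0" for t
  proof -
    define j where "j = nat \<lfloor>t / T\<rfloor>"
    define r where "r = t - real j * T"
    have j: "real j \<le> t / T" "t / T < real j + 1"
      unfolding j_def using t T by (auto simp: of_nat_nat)
    have r: "0 \<le> r" "r \<le> T" using j T unfolding r_def by (auto simp: field_simps)
    have "exp (t *\<^sub>R A) = exp (r *\<^sub>R A + real j *\<^sub>R (T *\<^sub>R A))"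
      unfolding r_def by (simp add: scaleR_left_diff_distrib)
    also have "\<dots> = exp (r *\<^sub>R A) * exp (T *\<^sub>R A) ^ j"
      unfolding exp_of_nat_scaleR[symmetric] by (rule exp_add_commuting) (simp add: mult_ac)
    finally have "norm (exp (t *\<^sub>R A)) \<le> norm (exp (r *\<^sub>R A)) * norm (exp (T *\<^sub>R A) ^ j)"
      by (simp add: norm_mult_ineq)
    also have "\<dots> \<le> exp (T * norm A) * (1/2) ^ j"
    proof (intro mult_mono)
      have "norm (exp (r *\<^sub>R A)) \<le> exp (norm (r *\<^sub>R A))" by (rule norm_exp)
      also have "\<dots> \<le> exp (T * norm A)" using r by (simp add: mult_right_mono)
      finally show "norm (exp (r *\<^sub>R A)) \<le> exp (T * norm A)" .
      have "norm (exp (T *\<^sub>R A) ^ j) \<le> norm (exp (T *\<^sub>R A)) ^ j" by (rule norm_power_ineq)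
      also have "\<dots> \<le> (1/2) ^ j" using half by (intro power_mono) auto
      finally show "norm (exp (T *\<^sub>R A) ^ j) \<le> (1/2) ^ j" .
    qed auto
    also have "(1/2::real) ^ j = exp (- (real j * ln 2))"
      by (simp add: exp_minus exp_of_nat_mult power_one_over inverse_eq_divide)
    also have "\<dots> \<le> exp (ln 2 - \<epsilon> * t)"
    proof -
      have "\<epsilon> * t = (t / T) * ln 2" unfolding \<epsilon>_def by simp
      also have "\<dots> \<le> (real j + 1) * ln 2" using j by (intro mult_right_mono) auto
      finally show ?thesis by (simp add: algebra_simps)
    qed
    also have "exp (ln 2 - \<epsilon> * t) = 2 * exp (- \<epsilon> * t)" by (simp add: exp_diff exp_minus divide_inverse)
    finally show ?thesis unfolding K_def by (simp add: mult_ac)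
  qed
  moreover have "K > 0" "\<epsilon> > 0" unfolding K_def \<epsilon>_def using T by auto
  ultimately show ?thesis by blast
qed

lemma mat_op_norm_le:
  fixes A :: "('a::comm_complex_banach_algebra_1, 'n::finite) sqmat"
  shows "mat_op_norm (to_mat A) \<le> norm A * real CARD('n)"
  unfolding mat_op_norm_def
proof (rule cSUP_least)
  have "(0 :: 'a^'n) \<in> {v. vec_max_norm v \<le> 1}" by (simp add: vec_max_norm_def)
  then show "{v :: 'a^'n. vec_max_norm v \<le> 1} \<noteq> {}" by blast
  fix v :: "'a^'n" assume v: "v \<in> {v. vec_max_norm v \<le> 1}"
  have "norm (v $ i) \<le> 1" for i
    using v unfolding vec_max_norm_def by (simp add: Max_le_iff)
  then have nv: "norm v \<le> real CARD('n)"
    using norm_vec_le_sum[of v] sum_mono[of UNIV "\<lambda>i. norm (v $ i)" "\<lambda>_. 1"] by simp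
  have "vec_max_norm (to_mat A *v v) \<le> norm (to_mat A *v v)"
    unfolding vec_max_norm_def by (simp add: Max_le_iff Finite_Cartesian_Product.norm_nth_le)
  also have "\<dots> \<le> norm A * norm v"
    unfolding norm_sqmat.rep_eq by (rule norm_matrix_vector_mult_le_onorm)
  also have "\<dots> \<le> norm A * real CARD('n)" using nv by (intro mult_left_mono) auto
  finally show "vec_max_norm (to_mat A *v v) \<le> norm A * real CARD('n)" .
qed

theorem exp_stable_if_pointwise_stable:
  fixes M :: "'a::comm_complex_banach_algebra_1^'n^'n"
  assumes "semisimple TYPE('a)"
    and "\<And>\<phi>. \<phi> \<in> max_ideal_space \<Longrightarrow> complex_exp_stable (gelfand_mat M \<phi>)"
  shows "exp_stable M"
proof -
  let ?A = "of_mat M :: ('a, 'n) sqmat"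
  have "(\<lambda>k. exp ?A ^ (2^k)) \<longlonglongrightarrow> 0" by (rule stable_exp_powers_null) (use assms in simp_all)
  then obtain K \<epsilon> where K: "K > 0" "\<epsilon> > 0" "\<And>t. t \<ge> 0 \<Longrightarrow> norm (exp (t *\<^sub>R ?A)) \<le> K * exp (- \<epsilon> * t)"
    using exp_decay_if_powers_null by blast
  have "mat_op_norm (mat_exp (t *\<^sub>R M)) \<le> (K * real CARD('n)) * exp (- \<epsilon> * t)" if "t \<ge> 0" for t
  proof -
    have "mat_exp (t *\<^sub>R M) = to_mat (exp (t *\<^sub>R ?A))"
      by (simp add: to_mat_scaleR flip: mat_exp_to_mat)
    then have "mat_op_norm (mat_exp (t *\<^sub>R M)) \<le> norm (exp (t *\<^sub>R ?A)) * real CARD('n)"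
      using mat_op_norm_le by metis
    also have "\<dots> \<le> (K * exp (- \<epsilon> * t)) * real CARD('n)" using K(3)[OF that] by (intro mult_right_mono) auto
    finally show ?thesis by (simp add: mult_ac)
  qed
  moreover have "K * real CARD('n) > 0" using K(1) by simp
  ultimately show ?thesis unfolding exp_stable_def using K(2) by blast
qed

section \<open>Block vectors and adjoints\<close>

definition vjoin :: "'a^'n \<Rightarrow> 'a^'m \<Rightarrow> 'a^('n + 'm)" where
  "vjoin x y = (\<chi> i. case i of Inl a \<Rightarrow> x $ a | Inr b \<Rightarrow> y $ b)"

definition vtop :: "'a^('n::finite + 'm::finite) \<Rightarrow> 'a^'n" where
  "vtop s = (\<chi> a. s $ Inl a)"

definition vbot :: "'a^('n::finite + 'm::finite) \<Rightarrow> 'a^'m" where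
  "vbot s = (\<chi> b. s $ Inr b)"

lemma vtop_vjoin [simp]: "vtop (vjoin x y) = x"
  and vbot_vjoin [simp]: "vbot (vjoin x y) = y"
  by (simp_all add: vtop_def vbot_def vjoin_def vec_eq_iff)

lemma vjoin_vtop_vbot [simp]: "vjoin (vtop s) (vbot s) = s"
  by (simp add: vtop_def vbot_def vjoin_def vec_eq_iff split: sum.split)

lemma block_vec_eq_iff: "s = r \<longleftrightarrow> vtop s = vtop r \<and> vbot s = vbot r"
  by (metis vjoin_vtop_vbot)

lemma vtop_simps [simp]: "vtop (s + r) = vtop s + vtop r" "vtop (s - r) = vtop s - vtop r"
  "vtop (- s) = - vtop s" "vtop (c *s s) = c *s vtop s" "vtop 0 = 0"
  by (simp_all add: vtop_def vec_eq_iff)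

lemma vbot_simps [simp]: "vbot (s + r) = vbot s + vbot r" "vbot (s - r) = vbot s - vbot r"
  "vbot (- s) = - vbot s" "vbot (c *s s) = c *s vbot s" "vbot 0 = 0"
  by (simp_all add: vbot_def vec_eq_iff)

lemma vtop_scaleR [simp]: "vtop (r *\<^sub>R s) = r *\<^sub>R vtop s"
  and vbot_scaleR [simp]: "vbot (r *\<^sub>R s) = r *\<^sub>R vbot s"
  by (simp_all add: vtop_def vbot_def vec_eq_iff)

lemma vjoin_0 [simp]: "vjoin 0 0 = 0"
  by (simp add: block_vec_eq_iff)

lemma sum_UNIV_Plus: "(\<Sum>i\<in>(UNIV :: ('a::finite + 'b::finite) set). f i) = (\<Sum>a\<in>UNIV. f (Inl a)) + (\<Sum>b\<in>UNIV. f (Inr b))"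
  by (simp add: UNIV_Plus_UNIV[symmetric] sum.Plus del: UNIV_Plus_UNIV)

lemma hblock_mult_vec: "hblock M N *v s = M *v vtop s + N *v vbot s"
  by (simp add: vec_eq_iff matrix_vector_mult_def sum_UNIV_Plus hblock_def vtop_def vbot_def)

lemma vblock_mult_vec: "vblock M N *v x = vjoin (M *v x) (N *v x)"
  by (simp add: vec_eq_iff matrix_vector_mult_def vblock_def vjoin_def split: sum.split)

lemma block22_mult_vec:
  "block22 M11 M12 M21 M22 *v s = vjoin (M11 *v vtop s + M12 *v vbot s) (M21 *v vtop s + M22 *v vbot s)"
  unfolding block22_def by (simp add: vblock_mult_vec hblock_mult_vec)

lemma inner_vjoin: "inner s r = inner (vtop s) (vtop r) + inner (vbot s) (vbot r)"
  by (simp add: inner_vec_def sum_UNIV_Plus vtop_def vbot_def)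

lemma inner_complex_mult: "inner (m * a) b = inner a (cnj m * (b::complex))"
  by (simp add: inner_complex_def algebra_simps)

text \<open>On complex vectors \<open>inner\<close> is the real part of the hermitian product. All
  quadratic forms below are therefore real bilinear, yet the complex adjoint is still the adjoint
  for \<open>inner\<close>.\<close>

lemma inner_adj_right: "inner x (adj_mat M *v y) = inner (M *v x) y"
  for x :: "complex^'n" and M :: "complex^'n^'m"
proof -
  have "inner (M *v x) y = (\<Sum>i\<in>UNIV. \<Sum>j\<in>UNIV. inner (x $ j) (cnj (M $ i $ j) * y $ i))"
    by (simp add: inner_vec_def matrix_vector_mult_def inner_sum_left inner_complex_mult)
  also have "\<dots> = (\<Sum>j\<in>UNIV. \<Sum>i\<in>UNIV. inner (x $ j) (cnj (M $ i $ j) * y $ i))" by (rule sum.swap)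
  also have "\<dots> = inner x (adj_mat M *v y)"
    by (simp add: inner_vec_def matrix_vector_mult_def inner_sum_right adj_mat_def transpose_def)
  finally show ?thesis ..
qed

lemma inner_adj_left: "inner (adj_mat M *v y) x = inner y (M *v x)"
  for x :: "complex^'n" and M :: "complex^'n^'m"
  using inner_adj_right[of x M y] by (simp add: inner_commute)

lemma inner_scale_right: "inner x (z *s y) = inner (cnj z *s x) y"
  for x :: "complex^'n"
  by (simp add: inner_vec_def inner_complex_mult)

lemma inner_matrix_eqI:
  fixes M N :: "complex^'n^'m"
  assumes "\<And>x y. inner (M *v x) y = inner (N *v x) y"
  shows "M = N"
  using assms by (metis matrix_eq vector_eq_rdot)

lemma adj_mat_eqI:
  fixes P :: "complex^'n^'n"
  assumes "\<And>x y. inner (P *v x) y = inner x (P *v y)"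
  shows "adj_mat P = P"
  by (rule inner_matrix_eqI) (simp add: inner_adj_left assms)

section \<open>Kernels of semidefinite real forms\<close>

lemma bilinear_eq_zero_if_nonneg:
  fixes a b :: real
  assumes "\<And>t. t * a + t\<^sup>2 * b \<ge> 0"
  shows "a = 0"
proof (rule ccontr)
  assume "a \<noteq> 0"
  \<comment> \<open>The minimizer of t a + t^2 c for c = \<bar>b\<bar> + 1, a positive upper bound
    of \<open>b\<close>.\<close>
  define t where "t = - a / (2 * (\<bar>b\<bar> + 1))"
  have "t * a + t\<^sup>2 * b \<le> t * a + t\<^sup>2 * \<bar>b\<bar>" by (simp add: mult_left_mono)
  also have "\<dots> \<le> t * a + t\<^sup>2 * (\<bar>b\<bar> + 1)" by (simp add: mult_left_mono)
  also have "\<dots> = - (a\<^sup>2 / (4 * (\<bar>b\<bar> + 1)))"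
  proof -
    have nz: "\<bar>b\<bar> + 1 \<noteq> 0" by linarith
    define c where "c = \<bar>b\<bar> + 1"
    have "c \<noteq> 0" using nz c_def by simp
    then show ?thesis unfolding t_def c_def[symmetric] by (simp add: field_simps power2_eq_square)
  qed
  also have "\<dots> < 0" using \<open>a \<noteq> 0\<close> by (simp add: zero_less_power2)
  finally show False using assms[of t] by simp
qed

lemma psd_kernel:
  fixes b :: "'v::real_vector \<Rightarrow> 'v \<Rightarrow> real"
  assumes b: "bilinear b" and psd: "\<And>s. 0 \<le> b s s" and s: "b s s = 0"
  shows "b s r + b r s = 0"
proof (rule bilinear_eq_zero_if_nonneg)
  fix t :: real
  have "b (s + t *\<^sub>R r) (s + t *\<^sub>R r) = t * (b s r + b r s) + t\<^sup>2 * b r r"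
    using s by (simp add: bilinear_ladd[OF b] bilinear_radd[OF b] bilinear_lmul[OF b] bilinear_rmul[OF b]
        power2_eq_square algebra_simps)
  then show "0 \<le> t * (b s r + b r s) + t\<^sup>2 * b r r" using psd by metis
qed

lemma psd_kernel_diff:
  fixes b :: "'v::real_vector \<Rightarrow> 'v \<Rightarrow> real"
  assumes b: "bilinear b" and psd: "\<And>s. 0 \<le> b s s" and s: "b s s = 0" and r: "b r r = 0"
  shows "b (s - r) (s - r) = 0"
  using psd_kernel[OF b psd s, of r] s r by (simp add: bilinear_lsub[OF b] bilinear_rsub[OF b])

text \<open>The derivative of \<open>b\<close> along \<open>M\<close> is a semidefinite form too,
  with the opposite sign, and it vanishes at \<open>s\<close> because \<open>s\<close> is in the
  kernel of \<open>b\<close>. Its own kernel condition at \<open>s\<close>, with the terms in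
  \<open>M r\<close> removed by the kernel of \<open>b\<close>, says that \<open>M s\<close> is in
  the kernel of \<open>b\<close>.\<close>

lemma psd_kernel_invariant:
  fixes b :: "'v::real_vector \<Rightarrow> 'v \<Rightarrow> real"
  assumes b: "bilinear b" and psd: "\<And>s. 0 \<le> b s s" and M: "linear M"
    and dec: "\<And>s. b (M s) s + b s (M s) \<le> 0" and s: "b s s = 0"
  shows "b (M s) (M s) = 0"
proof -
  have ker: "b s r + b r s = 0" for r by (rule psd_kernel[OF b psd s])
  have "b (M s) r + b r (M s) = 0" for r
  proof -
    have "- (b (M s) r + b r (M s)) = 0"
    proof (rule bilinear_eq_zero_if_nonneg)
      fix t :: real
      have "b (M (s + t *\<^sub>R r)) (s + t *\<^sub>R r) + b (s + t *\<^sub>R r) (M (s + t *\<^sub>R r)) =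
        (b s (M s) + b (M s) s) + t * (b (M s) r + b r (M s)) + t * (b s (M r) + b (M r) s)
          + t\<^sup>2 * (b (M r) r + b r (M r))"
        by (simp add: linear_add[OF M] linear_scale[OF M] bilinear_ladd[OF b] bilinear_radd[OF b]
            bilinear_lmul[OF b] bilinear_rmul[OF b] power2_eq_square algebra_simps)
      then have "b (M (s + t *\<^sub>R r)) (s + t *\<^sub>R r) + b (s + t *\<^sub>R r) (M (s + t *\<^sub>R r)) =
        t * (b (M s) r + b r (M s)) + t\<^sup>2 * (b (M r) r + b r (M r))"
        unfolding ker by simp
      then show "0 \<le> t * - (b (M s) r + b r (M s)) + t\<^sup>2 * - (b (M r) r + b r (M r))"
        using dec[of "s + t *\<^sub>R r"] unfolding mult_minus_right by linarith
    qed
    then show ?thesis by simp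
  qed
  from this[of "M s"] show ?thesis by simp
qed

section \<open>Quadratic forms along the flow of a matrix\<close>

lemma flow_form_derivative:
  fixes M :: "(complex, 'n::finite) sqmat" and b :: "complex^'n \<Rightarrow> complex^'n \<Rightarrow> real"
  assumes b: "bilinear b"
  defines "x \<equiv> \<lambda>s t. to_mat (exp (t *\<^sub>R M)) *v s"
  shows "((\<lambda>t. b (x s t) (x r t)) has_real_derivative
    b (to_mat M *v x s t) (x r t) + b (x s t) (to_mat M *v x r t)) (at t)"
proof -
  have bb: "bounded_bilinear b" using b by (simp add: bilinear_conv_bounded_bilinear)
  have d: "((\<lambda>t. x s t) has_vector_derivative to_mat M *v x s t) (at t)" for s
  proof -
    have "((\<lambda>t. to_mat (exp (t *\<^sub>R M)) *v s) has_vector_derivative to_mat (M * exp (t *\<^sub>R M)) *v s) (at t)"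
      by (rule bounded_linear.has_vector_derivative[OF bounded_linear_sqmat_vector_mult
            exp_scaleR_has_vector_derivative_left])
    then show ?thesis unfolding x_def by (simp add: to_mat_mult matrix_vector_mul_assoc)
  qed
  have "((\<lambda>t. b (x s t) (x r t)) has_derivative
    (\<lambda>h. b (x s t) (h *\<^sub>R (to_mat M *v x r t)) + b (h *\<^sub>R (to_mat M *v x s t)) (x r t))) (at t)"
    by (rule bounded_bilinear.FDERIV[OF bb d[unfolded has_vector_derivative_def] d[unfolded has_vector_derivative_def]])
  then show ?thesis
    unfolding has_field_derivative_def
    by (rule has_derivative_eq_rhs)
      (simp add: fun_eq_iff bounded_bilinear.scaleR_left[OF bb] bounded_bilinear.scaleR_right[OF bb] algebra_simps)
qed

lemma tendsto_flow_dyadic: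
  fixes M :: "(complex, 'n::finite) sqmat"
  assumes "(\<lambda>k. exp M ^ (2^k) * R) \<longlonglongrightarrow> 0"
  shows "(\<lambda>k. to_mat (exp (real (2^k) *\<^sub>R M)) *v (to_mat R *v s)) \<longlonglongrightarrow> 0"
proof -
  have "(\<lambda>k. to_mat (exp M ^ (2^k) * R) *v s) \<longlonglongrightarrow> to_mat 0 *v s"
    by (intro bounded_linear.tendsto[OF bounded_linear_sqmat_vector_mult] assms)
  then show ?thesis
    unfolding exp_of_nat_scaleR by (simp add: to_mat_mult to_mat_0 matrix_vector_mul_assoc)
qed

text \<open>Along the flow of \<open>M\<close> the form does not increase, and it tends to its value
  at 0, which is 0.\<close>

theorem lyapunov_nonneg:
  fixes M :: "(complex, 'n::finite) sqmat" and b :: "complex^'n \<Rightarrow> complex^'n \<Rightarrow> real"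
  assumes b: "bilinear b" and stab: "complex_exp_stable (to_mat M)"
    and dec: "\<And>s. b (to_mat M *v s) s + b s (to_mat M *v s) \<le> 0"
  shows "0 \<le> b s s"
proof -
  let ?x = "\<lambda>t. to_mat (exp (t *\<^sub>R M)) *v s"
  have bb: "bounded_bilinear b" using b by (simp add: bilinear_conv_bounded_bilinear)
  have "gelfand_mat (to_mat M) id = to_mat M" by (simp add: vec_eq_iff)
  then have "(\<lambda>k. exp M ^ (2^k)) \<longlonglongrightarrow> 0"
    using stab by (intro stable_exp_powers_null semisimple_complex) (simp add: max_ideal_space_complex)
  then have "(\<lambda>k. exp M ^ (2^k) * 1) \<longlonglongrightarrow> 0" by simp
  from tendsto_flow_dyadic[OF this, of s] have "(\<lambda>k. ?x (real (2^k))) \<longlonglongrightarrow> 0"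
    by (simp add: to_mat_1)
  then have "(\<lambda>k. b (?x (real (2^k))) (?x (real (2^k)))) \<longlonglongrightarrow> b 0 0"
    by (intro bounded_bilinear.tendsto[OF bb])
  moreover have "b (?x (real (2^k))) (?x (real (2^k))) \<le> b s s" for k
  proof -
    have "b (?x (real (2^k))) (?x (real (2^k))) \<le> b (?x 0) (?x 0)"
      by (rule DERIV_nonpos_imp_nonincreasing[where f = "\<lambda>t. b (?x t) (?x t)"])
        (simp, use flow_form_derivative[OF b, where s = s and r = s and M = M] dec in blast)
    then show ?thesis by (simp add: to_mat_1)
  qed
  ultimately have "b 0 0 \<le> b s s" by (intro LIMSEQ_le_const2) auto
  then show ?thesis by (simp add: bounded_bilinear.zero_left[OF bb])
qed

text \<open>The form is constant along the flow of \<open>H\<close>, but on the range of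
  \<open>R\<close> the flow tends to 0. Applied to the symplectic form, this makes spectral
  subspaces isotropic.\<close>

lemma conserved_form_zero:
  fixes H R :: "(complex, 'n::finite) sqmat" and b :: "complex^'n \<Rightarrow> complex^'n \<Rightarrow> real"
  assumes b: "bilinear b" and lim: "(\<lambda>k. exp H ^ (2^k) * R) \<longlonglongrightarrow> 0"
    and cons: "\<And>s r. b (to_mat H *v s) r + b s (to_mat H *v r) = 0"
  shows "b (to_mat R *v s) (to_mat R *v r) = 0"
proof -
  let ?x = "\<lambda>s t. to_mat (exp (t *\<^sub>R H)) *v (to_mat R *v s)"
  have bb: "bounded_bilinear b" using b by (simp add: bilinear_conv_bounded_bilinear)
  have "(\<lambda>k. b (?x s (real (2^k))) (?x r (real (2^k)))) \<longlonglongrightarrow> b 0 0"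
    by (intro bounded_bilinear.tendsto[OF bb] tendsto_flow_dyadic[OF lim])
  moreover have "b (?x s (real (2^k))) (?x r (real (2^k))) = b (?x s 0) (?x r 0)" for k
    by (rule DERIV_isconst_all) (use flow_form_derivative[OF b, where s = "to_mat R *v s" and M = H and r = "to_mat R *v r"] cons in auto)
  ultimately have "(\<lambda>k::nat. b (?x s 0) (?x r 0)) \<longlonglongrightarrow> b 0 0" by simp
  then have "b (?x s 0) (?x r 0) = b 0 0" using LIMSEQ_unique tendsto_const by blast
  then show ?thesis by (simp add: to_mat_1 bounded_bilinear.zero_left[OF bb])
qed

lemma adj_eigenvalue:
  assumes "is_eigenvalue (adj_mat A) z"
  shows "is_eigenvalue A (cnj z)"
proof (rule ccontr)
  assume no: "\<not> is_eigenvalue A (cnj z)"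
  obtain p where p: "p \<noteq> 0" "adj_mat A *v p = z *s p" using assms unfolding is_eigenvalue_def by blast
  have act: "(A - mat (cnj z)) *v x = A *v x - cnj z *s x" for x
    by (simp add: matrix_vector_mult_diff_rdistrib mat_vector_mult vec_eq_iff)
  have "invertible (A - mat (cnj z))"
    by (rule invertible_if_injective) (use no in \<open>auto simp: act is_eigenvalue_def\<close>)
  then obtain B where "(A - mat (cnj z)) ** B = mat 1" unfolding invertible_def by blast
  then have "(A - mat (cnj z)) *v (B *v p) = p" by (simp add: matrix_vector_mul_assoc)
  then have "inner p p = inner (A *v (B *v p)) p - inner (cnj z *s (B *v p)) p"
    unfolding act by (metis inner_diff_left)
  also have "\<dots> = inner (B *v p) (z *s p) - inner (B *v p) (z *s p)"
    using inner_adj_right[of "B *v p" A p] p(2) inner_scale_right[of "B *v p" z p] by simp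
  finally show False using p(1) by simp
qed

lemma adj_eigenvector_stable:
  assumes "complex_exp_stable A" "adj_mat A *v p = z *s p" "Re z \<ge> 0"
  shows "p = 0"
proof (rule ccontr)
  assume "p \<noteq> 0"
  then have "is_eigenvalue A (cnj z)" using assms(2) by (intro adj_eigenvalue) (auto simp: is_eigenvalue_def)
  then show False using assms(1,3) unfolding complex_exp_stable_def by force
qed

section \<open>Stable subspaces of Hamiltonian matrices\<close>

text \<open>If the range of the projection \<open>Q\<close> is the graph of a matrix \<open>P\<close>, then \<open>P\<close> is the lower
  block row of \<open>Q\<close> times a right inverse of its upper block row. For the spectral projection of a
  Hamiltonian matrix the adjoint of \<open>Q\<close> is \<open>1 + J Q J\<close>, so that the Moore-Penrose right inverse
  can be written without an involution and makes sense over any commutative ring.\<close>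

definition sympl :: "'a::comm_ring_1^('n::finite + 'n)^('n + 'n)" where
  "sympl = block22 0 (- mat 1) (mat 1) 0"

definition graph_basis :: "'a::comm_ring_1^('n::finite + 'n)^('n + 'n) \<Rightarrow> 'a^'n^('n + 'n)" where
  "graph_basis Q = (mat 1 + sympl ** Q ** sympl) ** vblock (mat 1) 0"

text \<open>For a Hamiltonian projection this is T times its adjoint, where T is the upper block row
  of \<open>Q\<close>.\<close>

definition graph_gram :: "'a::comm_ring_1^('n::finite + 'n)^('n + 'n) \<Rightarrow> 'a^'n^'n" where
  "graph_gram Q = hblock (mat 1) 0 ** Q ** graph_basis Q"

definition graph_mat :: "'a::comm_ring_1^('n::finite + 'n)^('n + 'n) \<Rightarrow> 'a^'n^'n" where
  "graph_mat Q = hblock 0 (mat 1) ** Q ** graph_basis Q ** matrix_inv (graph_gram Q)"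

lemma matrix_vector_mult_uminus: "(- M) *v x = - (M *v (x :: 'a::ring_1^'n))"
  by (simp add: vec_eq_iff matrix_vector_mult_def sum_negf)

lemma matrix_vector_mult_uminus_right: "M *v (- x) = - (M *v (x :: 'a::ring_1^'n))"
  by (simp add: vec_eq_iff matrix_vector_mult_def sum_negf)

lemma sympl_mult_vec: "sympl *v s = vjoin (- vbot s) (vtop s)"
  by (simp add: sympl_def block22_mult_vec matrix_vector_mult_uminus)

lemma graph_basis_mult_vec: "graph_basis Q *v y = vjoin y 0 + sympl *v (Q *v (vjoin 0 y))"
proof -
  have "graph_basis Q *v y = vjoin y 0 + sympl *v (Q *v (sympl *v vjoin y 0))"
    by (simp add: graph_basis_def matrix_vector_mult_add_rdistrib vblock_mult_vec flip: matrix_vector_mul_assoc)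
  also have "sympl *v vjoin y 0 = vjoin 0 y" by (simp add: sympl_mult_vec)
  finally show ?thesis .
qed

definition sympl_form :: "complex^('n::finite + 'n) \<Rightarrow> complex^('n + 'n) \<Rightarrow> real" where
  "sympl_form s r = inner (vtop s) (vbot r) - inner (vbot s) (vtop r)"

lemma bilinear_sympl_form: "bilinear sympl_form"
  unfolding bilinear_def sympl_form_def
  by (intro conjI allI linearI) (simp_all add: inner_add_left inner_add_right algebra_simps)

lemma sympl_form_eq_inner: "sympl_form s r = inner (sympl *v s) r"
  by (simp add: sympl_form_def sympl_mult_vec inner_vjoin)

locale hamiltonian_projection =
  fixes H Q :: "(complex, 'n::finite + 'n) sqmat"
  assumes proj: "stable_projection H Q"
    and hamiltonian: "\<And>s r. sympl_form (to_mat H *v s) r + sympl_form s (to_mat H *v r) = 0"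
    and complementary: "\<And>p. to_mat Q *v vjoin 0 p = vjoin 0 p \<Longrightarrow> p = 0"
begin

lemmas idem = stable_projectionD(1)[OF proj] and comm = stable_projectionD(2)[OF proj]
  and lim = stable_projectionD(3)[OF proj] and lim' = stable_projectionD(4)[OF proj]

abbreviation "q \<equiv> to_mat Q"

lemma qq: "q *v (q *v s) = q *v s"
  by (metis idem matrix_vector_mul_assoc to_mat_mult)

lemma isotropic: "sympl_form (q *v s) (q *v r) = 0"
  by (rule conserved_form_zero[OF bilinear_sympl_form lim hamiltonian])

lemma isotropic': "sympl_form (s - q *v s) (r - q *v r) = 0"
proof -
  have "sympl_form (to_mat (1 - Q) *v s) (to_mat (1 - Q) *v r) = 0"
  proof (rule conserved_form_zero[OF bilinear_sympl_form lim'])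
    fix s r :: "complex^('n + 'n)"
    have "sympl_form (- x) y = - sympl_form x y" "sympl_form x (- y) = - sympl_form x y" for x y :: "complex^('n + 'n)"
      by (simp_all add: sympl_form_def)
    then show "sympl_form (to_mat (- H) *v s) r + sympl_form s (to_mat (- H) *v r) = 0"
      using hamiltonian[of s r] by (simp add: to_mat_uminus matrix_vector_mult_uminus)
  qed
  then show ?thesis by (simp add: to_mat_diff to_mat_1 matrix_vector_mult_diff_rdistrib)
qed

lemma sympl_form_diff: "sympl_form (s - s') r = sympl_form s r - sympl_form s' r"
  "sympl_form s (r - r') = sympl_form s r - sympl_form s r'"
  by (simp_all add: sympl_form_def inner_diff_left inner_diff_right)

text \<open>Range and kernel of the projection are both isotropic, so moving \<open>q\<close> across
  the symplectic form turns it into 1 - q. Since that form is \<open>inner\<close> composed with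
  \<open>sympl\<close>, this computes the adjoint.\<close>

lemma adj_projection: "adj_mat q *v s = s + sympl *v (q *v (sympl *v s))"
proof -
  have JJ: "sympl *v (sympl *v y) = - y" for y :: "complex^('n + 'n)"
    by (simp add: sympl_mult_vec block_vec_eq_iff)
  have *: "inner (adj_mat q *v (sympl *v r)) t = inner (sympl *v r - sympl *v (q *v r)) t" for r t
  proof -
    have "sympl_form (q *v r) t = sympl_form r (t - q *v t)"
      using isotropic[of r t] isotropic'[of r t] by (simp add: sympl_form_diff)
    then show ?thesis by (simp add: sympl_form_eq_inner inner_diff_left inner_diff_right inner_adj_left)
  qed
  then have "adj_mat q *v (sympl *v r) = sympl *v r - sympl *v (q *v r)" for r
    by (metis vector_eq_rdot)
  from this[of "- (sympl *v s)"] show ?thesis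
    by (simp add: matrix_vector_mult_uminus_right JJ)
qed

lemma top_zero_imp_zero: "vtop (q *v s) = 0 \<Longrightarrow> q *v s = 0"
  using complementary[of "vbot (q *v s)"] qq[of s] by (metis vjoin_0 vjoin_vtop_vbot)

lemma graph_basis_eq: "graph_basis q *v y = adj_mat q *v vjoin y 0"
  by (simp add: graph_basis_mult_vec adj_projection sympl_mult_vec)

lemma graph_gram_mult_vec: "graph_gram q *v y = vtop (q *v (graph_basis q *v y))"
  by (simp add: graph_gram_def hblock_mult_vec flip: matrix_vector_mul_assoc)

text \<open>A kernel vector \<open>y\<close> of the Gram matrix is killed by the adjoint of the
  upper block row. The formula for the adjoint of \<open>q\<close> rewrites this as:
  \<open>q\<close> fixes (0, y), which complementarity excludes unless y = 0.\<close>

lemma graph_gram_invertible: "invertible (graph_gram q)"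
proof (rule invertible_if_injective)
  fix y assume "graph_gram q *v y = 0"
  then have "vtop (q *v (graph_basis q *v y)) = 0" by (simp add: graph_gram_mult_vec)
  then have "inner (vjoin y 0) (q *v (graph_basis q *v y)) = 0" by (simp add: inner_vjoin)
  then have "inner (adj_mat q *v vjoin y 0) (graph_basis q *v y) = 0" by (simp add: inner_adj_left)
  then have "graph_basis q *v y = 0" by (simp add: graph_basis_eq)
  then have "sympl *v (vjoin y 0 + sympl *v (q *v (vjoin 0 y))) = 0" by (simp add: graph_basis_mult_vec)
  then have "q *v vjoin 0 y = vjoin 0 y"
    by (simp add: sympl_mult_vec block_vec_eq_iff)
  then show "y = 0" by (rule complementary)
qed

lemma graph_surj: "vtop (q *v (graph_basis q *v (matrix_inv (graph_gram q) *v x))) = x"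
  unfolding graph_gram_mult_vec[symmetric]
  by (simp add: matrix_vector_mul_assoc matrix_inv_right[OF graph_gram_invertible])

lemma graph_mat_mult_vec: "graph_mat q *v x = vbot (q *v (graph_basis q *v (matrix_inv (graph_gram q) *v x)))"
  by (simp add: graph_mat_def hblock_mult_vec flip: matrix_vector_mul_assoc)

lemma range_graph: "vbot (q *v s) = graph_mat q *v vtop (q *v s)"
proof -
  let ?r = "graph_basis q *v (matrix_inv (graph_gram q) *v vtop (q *v s))"
  have "vtop (q *v (s - ?r)) = 0" by (simp add: matrix_vector_mult_diff_distrib graph_surj)
  then have "q *v (s - ?r) = 0" by (rule top_zero_imp_zero)
  then have "q *v s = q *v ?r" by (simp add: matrix_vector_mult_diff_distrib)
  then show ?thesis unfolding graph_mat_mult_vec by simp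
qed

lemma graph_in_range: "q *v vjoin x (graph_mat q *v x) = vjoin x (graph_mat q *v x)"
proof -
  let ?s = "q *v (graph_basis q *v (matrix_inv (graph_gram q) *v x))"
  have "vjoin x (graph_mat q *v x) = ?s"
    by (simp add: block_vec_eq_iff graph_surj graph_mat_mult_vec)
  then show ?thesis by (simp add: qq)
qed

lemma adj_graph_mat: "adj_mat (graph_mat q) = graph_mat q"
proof (rule adj_mat_eqI)
  fix x y
  have "sympl_form (q *v vjoin x (graph_mat q *v x)) (q *v vjoin y (graph_mat q *v y)) = 0" by (rule isotropic)
  then show "inner (graph_mat q *v x) y = inner x (graph_mat q *v y)"
    unfolding graph_in_range by (simp add: sympl_form_def)
qed

lemma graph_invariant:
  assumes "to_mat H *v vjoin x (graph_mat q *v x) = vjoin x' p'"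
  shows "p' = graph_mat q *v x'"
proof -
  let ?s = "vjoin x (graph_mat q *v x)"
  have "q *v vjoin x' p' = to_mat H *v (q *v ?s)"
    unfolding assms[symmetric] by (metis comm matrix_vector_mul_assoc to_mat_mult)
  then have "q *v vjoin x' p' = vjoin x' p'" by (simp add: graph_in_range assms)
  then show ?thesis using range_graph[of "vjoin x' p'"] by simp
qed

end

lemma complex_spectral_projection:
  fixes H :: "(complex, 'n::finite) sqmat"
  assumes "\<And>z. Re z = 0 \<Longrightarrow> \<not> is_eigenvalue (to_mat H) z"
  obtains Q where "stable_projection H Q"
proof -
  have "gelfand_mat (to_mat H) id = to_mat H" by (simp add: vec_eq_iff)
  then have "\<not> is_eigenvalue (gelfand_mat (to_mat H) \<phi>) z" if "\<phi> \<in> max_ideal_space" "Re z = 0" for \<phi> z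
    using that assms by (simp add: max_ideal_space_complex)
  then show ?thesis using that by (rule spectral_projection)
qed

section \<open>The Hamiltonian matrix of the game\<close>

lemma inner_scale_skew:
  fixes x :: "complex^'n"
  assumes "Re z = 0"
  shows "inner (z *s x) y = - inner x (z *s y)"
proof -
  have "cnj z = - z" using assms by (simp add: complex_eq_iff)
  then have "inner x (z *s y) = inner ((- z) *s x) y" by (simp add: inner_scale_right)
  then show ?thesis by simp
qed

lemma inner_scale_both:
  fixes x :: "complex^'n"
  shows "inner (z *s x) (z *s y) = (cmod z)\<^sup>2 * inner x y"
proof -
  have "cnj z * z = complex_of_real ((cmod z)\<^sup>2)" by (simp add: complex_norm_square[symmetric] mult.commute)
  then show ?thesis unfolding inner_scale_right vector_smult_assoc by (simp only: of_real_scale_vec inner_scaleR_left)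
qed

lemma resolvent_equation_solvable:
  fixes A :: "complex^'n^'n"
  assumes "complex_exp_stable A" "Re z \<ge> 0"
  obtains x where "z *s x = A *v x + f"
proof -
  have act: "(mat z - A) *v x = z *s x - A *v x" for x
    by (simp add: matrix_vector_mult_diff_rdistrib mat_vector_mult vec_eq_iff)
  have "invertible (mat z - A)"
  proof (rule invertible_if_injective, rule ccontr)
    fix x assume "(mat z - A) *v x = 0" "x \<noteq> 0"
    then have "is_eigenvalue A z" unfolding act is_eigenvalue_def by auto
    then show False using assms unfolding complex_exp_stable_def by force
  qed
  then have "(mat z - A) *v (matrix_inv (mat z - A) *v f) = f"
    by (simp add: matrix_vector_mul_assoc matrix_inv_right)
  then have "z *s (matrix_inv (mat z - A) *v f) = A *v (matrix_inv (mat z - A) *v f) + f"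
    unfolding act by (simp add: algebra_simps)
  then show ?thesis using that by blast
qed

text \<open>For \<open>s = (x, p)\<close>, \<open>u s\<close> and \<open>Wm s\<close> are the stationary control and disturbance and \<open>y s\<close> is
  the corresponding output. With \<open>B = 0\<close> and \<open>D1 = 0\<close> this covers the bounded real lemma.\<close>

locale game_system =
  fixes A :: "complex^'n::finite^'n" and B :: "complex^'m::finite^'n" and C :: "complex^'n^'p::finite"
    and D1 :: "complex^'m^'p" and D2 :: "complex^'l::finite^'p" and E :: "complex^'l^'n"
    and \<gamma> g :: real and H :: "(complex, 'n + 'n) sqmat"
    and u :: "complex^('n + 'n) \<Rightarrow> complex^'m" and Wm :: "complex^('n + 'n)^'l"
    and y :: "complex^('n + 'n) \<Rightarrow> complex^'p"
  assumes A_stable: "complex_exp_stable A"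
    and g_nonneg: "0 \<le> g" and g_less: "g < \<gamma>"
    and gain: "\<And>z x v. Re z = 0 \<Longrightarrow> z *s x = A *v x + E *v v \<Longrightarrow> norm (C *v x + D2 *v v) \<le> g * norm v"
    and pencil: "\<And>z x v. Re z = 0 \<Longrightarrow> z *s x = A *v x + B *v v \<Longrightarrow> C *v x + D1 *v v = 0 \<Longrightarrow> x = 0"
    and out: "\<And>s. y s = C *v vtop s + D1 *v u s + D2 *v (Wm *v s)"
    and eqB: "\<And>s. adj_mat B *v vbot s + adj_mat D1 *v y s = 0"
    and eqE: "\<And>s. adj_mat E *v vbot s + adj_mat D2 *v y s = \<gamma>\<^sup>2 *\<^sub>R (Wm *v s)"
    and dyn_top: "\<And>s. vtop (to_mat H *v s) = A *v vtop s + B *v u s + E *v (Wm *v s)"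
    and dyn_bot: "\<And>s. vbot (to_mat H *v s) = - (adj_mat A *v vbot s) - adj_mat C *v y s"
begin

lemma innerB: "inner (B *v a) (vbot s) = - inner (D1 *v a) (y s)"
proof -
  have "inner a (adj_mat B *v vbot s + adj_mat D1 *v y s) = 0" unfolding eqB by simp
  then show ?thesis by (simp add: inner_add_right inner_adj_right)
qed

lemma innerE: "inner (E *v a) (vbot s) = \<gamma>\<^sup>2 * inner a (Wm *v s) - inner (D2 *v a) (y s)"
proof -
  have "inner a (adj_mat E *v vbot s + adj_mat D2 *v y s) = \<gamma>\<^sup>2 * inner a (Wm *v s)" unfolding eqE by simp
  then show ?thesis by (simp add: inner_add_right inner_adj_right)
qed

lemma inner_out: "inner (y s) a = inner (C *v vtop s) a + inner (D1 *v u s) a + inner (D2 *v (Wm *v s)) a"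
  unfolding out by (simp add: inner_add_left)

text \<open>The stationarity conditions replace the terms in \<open>B\<close> and \<open>E\<close>
  by products of outputs and of disturbances. These are symmetric in \<open>s\<close> and
  \<open>r\<close> and cancel in the antisymmetric form.\<close>

lemma hamiltonian: "sympl_form (to_mat H *v s) r + sympl_form s (to_mat H *v r) = 0"
  using innerB[of "u s" r] innerB[of "u r" s] innerE[of "Wm *v s" r] innerE[of "Wm *v r" s]
    inner_out[of s "y r"] inner_out[of r "y s"]
  by (simp add: sympl_form_def dyn_top dyn_bot inner_add_left inner_add_right inner_diff_left inner_diff_right
      inner_adj_left inner_adj_right inner_commute)

lemma power_balance:
  "inner (vtop (to_mat H *v s)) (vbot s) + inner (vtop s) (vbot (to_mat H *v s)) = \<gamma>\<^sup>2 * (norm (Wm *v s))\<^sup>2 - (norm (y s))\<^sup>2"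
  using innerB[of "u s" s] innerE[of "Wm *v s" s] inner_out[of s "y s"]
  by (simp add: dyn_top dyn_bot inner_add_left inner_diff_right inner_adj_right power2_norm_eq_inner)

text \<open>On an imaginary eigenvector the left side of the power balance vanishes, so the output
  has norm \<gamma> times that of the disturbance \<open>w\<close>. The output differs from the
  response to \<open>w\<close> alone by something orthogonal to it, so its norm is at most
  \<open>g\<close> times that of \<open>w\<close>. Hence both vanish; stability of \<open>A\<close>
  then kills the costate, and the pencil condition the state.\<close>

lemma no_imaginary_eigenvalue:
  assumes z: "Re z = 0"
  shows "\<not> is_eigenvalue (to_mat H) z"
proof
  assume "is_eigenvalue (to_mat H) z"
  then obtain s where s: "s \<noteq> 0" "to_mat H *v s = z *s s" unfolding is_eigenvalue_def by blast
  define x where "x = vtop s"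
  define p where "p = vbot s"
  let ?w = "Wm *v s"
  have x: "z *s x = A *v x + B *v u s + E *v ?w"
    unfolding x_def dyn_top[symmetric] s(2) by simp
  have p: "z *s p = - (adj_mat A *v p) - adj_mat C *v y s"
    unfolding p_def dyn_bot[symmetric] s(2) by simp
  have "inner (z *s x) p + inner x (z *s p) = \<gamma>\<^sup>2 * (norm ?w)\<^sup>2 - (norm (y s))\<^sup>2"
    using power_balance[of s] unfolding s(2) x_def p_def by simp
  then have 1: "(norm (y s))\<^sup>2 = (\<gamma> * norm ?w)\<^sup>2"
    using inner_scale_skew[OF z, of x p] by (simp add: power_mult_distrib)
  have gp: "\<gamma> > 0" using g_nonneg g_less by simp
  have y_eq: "norm (y s) = \<gamma> * norm ?w"
    using power2_eq_imp_eq[OF 1] gp by simp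
  obtain \<xi> where \<xi>: "z *s \<xi> = A *v \<xi> + E *v ?w"
    using resolvent_equation_solvable[OF A_stable] z by (metis order_refl)
  define \<eta> where "\<eta> = x - \<xi>"
  have \<eta>: "z *s \<eta> = A *v \<eta> + B *v u s"
    unfolding \<eta>_def vec.scale_right_diff_distrib x \<xi> by (simp add: matrix_vector_mult_diff_distrib)
  let ?y' = "C *v \<xi> + D2 *v ?w"
  have "inner (z *s \<eta>) p + inner \<eta> (z *s p) = 0" by (simp add: inner_scale_skew[OF z])
  then have "inner (C *v \<eta> + D1 *v u s) (y s) = 0"
    unfolding \<eta> p using innerB[of "u s" s]
    by (simp add: inner_add_left inner_diff_right inner_adj_right p_def)
  moreover have "y s = ?y' + (C *v \<eta> + D1 *v u s)"
    unfolding out \<eta>_def x_def by (simp add: matrix_vector_mult_diff_distrib)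
  ultimately have "(norm (y s))\<^sup>2 = inner ?y' (y s)"
    by (metis add.right_neutral inner_add_left power2_norm_eq_inner)
  also have "\<dots> \<le> norm ?y' * norm (y s)" by (rule norm_cauchy_schwarz)
  also have "\<dots> \<le> (g * norm ?w) * norm (y s)"
    using gain[OF z \<xi>] by (intro mult_right_mono) auto
  finally have "norm (y s) * norm (y s) \<le> (g * norm ?w) * norm (y s)"
    by (simp add: power2_eq_square)
  then have "norm (y s) \<le> g * norm ?w \<or> norm (y s) = 0"
    unfolding mult_le_cancel_right by auto
  then have w0: "?w = 0"
  proof
    assume "norm (y s) \<le> g * norm ?w"
    then have "(\<gamma> - g) * norm ?w \<le> 0" unfolding y_eq by (simp add: algebra_simps)
    then show ?thesis using g_less by (simp add: mult_le_0_iff)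
  qed (use y_eq gp in simp)
  then have y0: "y s = 0" using y_eq by simp
  have "adj_mat A *v p = (- z) *s p" using p y0 by (simp add: vec.scale_minus_left)
  then have p0: "p = 0" by (rule adj_eigenvector_stable[OF A_stable]) (simp add: z)
  have "x = 0"
    by (rule pencil[OF z, of x "u s"]) (use x w0 y0 out[of s] x_def in simp_all)
  then show False using p0 s(1) unfolding x_def p_def by (simp add: block_vec_eq_iff)
qed

end

section \<open>The bounded real lemma\<close>

text \<open>A dissipation inequality for the storage function \<open>inner (X *v x) x\<close>. The
  right-hand side keeps the distance of \<open>v\<close> from the worst-case disturbance
  \<open>K *v x\<close>; this slack is what later forces a disturbance to vanish.\<close>

definition dissipative ::
  "complex^'n^'n \<Rightarrow> complex^'n^'p \<Rightarrow> complex^'l^'p \<Rightarrow> complex^'l^'n \<Rightarrow> real \<Rightarrow> real \<Rightarrow> complex^'n^'n \<Rightarrow> complex^'n^'l \<Rightarrow> bool" where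
  "dissipative A C D2 E \<gamma> g X K \<longleftrightarrow> (\<forall>x v.
    2 * inner (X *v x) (A *v x + E *v v) + (norm (C *v x + D2 *v v))\<^sup>2 - \<gamma>\<^sup>2 * (norm v)\<^sup>2
      \<le> - (\<gamma>\<^sup>2 - g\<^sup>2) * (norm (v - K *v x))\<^sup>2)"

text \<open>\<open>X\<close> is the stabilizing Riccati solution, whose graph is the stable subspace
  of the Hamiltonian matrix. Here complementarity is direct: on stable vectors (0, p) the matrix
  acts as minus the adjoint of \<open>A\<close>, whose eigenvalues all have positive real
  part.\<close>

theorem bounded_real_dissipation:
  fixes A :: "complex^'n^'n" and C :: "complex^'n^'p" and D2 :: "complex^'l^'p" and E :: "complex^'l^'n"
  assumes stab: "complex_exp_stable A" and g: "0 \<le> g" "g < \<gamma>"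
    and gain: "\<And>z x v. Re z = 0 \<Longrightarrow> z *s x = A *v x + E *v v \<Longrightarrow> norm (C *v x + D2 *v v) \<le> g * norm v"
    and D2: "\<And>v. norm (D2 *v v) \<le> g * norm v"
  obtains X K where "adj_mat X = X" "dissipative A C D2 E \<gamma> g X K"
proof -
  define S where "S = mat (complex_of_real (\<gamma>\<^sup>2)) - adj_mat D2 ** D2"
  have S_act: "S *v v = \<gamma>\<^sup>2 *\<^sub>R v - adj_mat D2 *v (D2 *v v)" for v
    unfolding S_def matrix_vector_mult_diff_rdistrib
    by (simp add: mat_vector_mult matrix_vector_mul_assoc vec_eq_iff scaleR_conv_of_real[where 'a = complex])
  have D2sq: "(norm (D2 *v v))\<^sup>2 \<le> g\<^sup>2 * (norm v)\<^sup>2" for v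
    using power_mono[OF D2, of v 2] by (simp add: power_mult_distrib)
  have gg: "g\<^sup>2 < \<gamma>\<^sup>2" using g by (intro power_strict_mono) auto
  have inner_S: "inner v (S *v v) = \<gamma>\<^sup>2 * (norm v)\<^sup>2 - (norm (D2 *v v))\<^sup>2" for v
    unfolding S_act by (simp add: inner_diff_right inner_adj_right power2_norm_eq_inner)
  have S_pos: "v = 0" if "inner v (S *v v) \<le> 0" for v
  proof (rule ccontr)
    assume "v \<noteq> 0"
    then have "g\<^sup>2 * (norm v)\<^sup>2 < \<gamma>\<^sup>2 * (norm v)\<^sup>2" using gg by simp
    then show False using that D2sq[of v] unfolding inner_S by linarith
  qed
  have S_inv: "invertible S"
    by (rule invertible_if_injective) (use S_pos in simp)
  define Wm where "Wm = matrix_inv S ** hblock (adj_mat D2 ** C) (adj_mat E)"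
  have S_Wm: "S *v (Wm *v s) = adj_mat D2 *v (C *v vtop s) + adj_mat E *v vbot s" for s
    unfolding Wm_def by (simp add: matrix_vector_mul_assoc matrix_mul_assoc matrix_inv_right[OF S_inv])
      (simp add: hblock_mult_vec matrix_vector_mul_assoc)
  define H :: "(complex, 'n + 'n) sqmat" where
    "H = of_mat (block22 A 0 (- (adj_mat C ** C)) (- adj_mat A) + vblock E (- (adj_mat C ** D2)) ** Wm)"
  define y where "y s = C *v vtop s + D2 *v (Wm *v s)" for s
  have H_act: "to_mat H *v s = vjoin (A *v vtop s + E *v (Wm *v s)) (- (adj_mat A *v vbot s) - adj_mat C *v y s)" for s
    unfolding H_def y_def
    by (simp add: matrix_vector_mult_add_rdistrib block22_mult_vec vblock_mult_vec block_vec_eq_iff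
        matrix_vector_mult_uminus matrix_vector_right_distrib flip: matrix_vector_mul_assoc)
  \<comment> \<open>The control is a dummy, with zero input and output matrices; the pencil
    condition then only says that \<open>A\<close> has no imaginary eigenvalue.\<close>
  interpret game_system A "0 :: complex^'l^'n" C "0 :: complex^'l^'p" D2 E \<gamma> g H "\<lambda>_. 0" Wm y
  proof
    show "complex_exp_stable A" "0 \<le> g" "g < \<gamma>" by (fact stab g)+
    show "norm (C *v x + D2 *v v) \<le> g * norm v" if "Re z = 0" "z *s x = A *v x + E *v v" for z x v
      using gain that .
    show "x = 0" if "Re z = 0" "z *s x = A *v x + (0 :: complex^'l^'n) *v v" for z x v
    proof (rule ccontr)
      assume "x \<noteq> 0"
      then have "is_eigenvalue A z" using that(2) unfolding is_eigenvalue_def by auto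
      then show False using stab that(1) unfolding complex_exp_stable_def by force
    qed
    show "y s = C *v vtop s + (0 :: complex^'l^'p) *v 0 + D2 *v (Wm *v s)" for s by (simp add: y_def)
    have "adj_mat (0 :: complex^'l^'n) = 0" "adj_mat (0 :: complex^'l^'p) = 0"
      by (simp_all add: adj_mat_def vec_eq_iff transpose_def)
    then show "adj_mat (0 :: complex^'l^'n) *v vbot s + adj_mat (0 :: complex^'l^'p) *v y s = 0" for s by simp
    show "adj_mat E *v vbot s + adj_mat D2 *v y s = \<gamma>\<^sup>2 *\<^sub>R (Wm *v s)" for s
      using S_Wm[of s] unfolding S_act y_def by (simp add: matrix_vector_right_distrib algebra_simps)
    show "vtop (to_mat H *v s) = A *v vtop s + (0 :: complex^'l^'n) *v 0 + E *v (Wm *v s)" for s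
      by (simp add: H_act)
    show "vbot (to_mat H *v s) = - (adj_mat A *v vbot s) - adj_mat C *v y s" for s
      by (simp add: H_act)
  qed
  obtain Q where proj: "stable_projection H Q"
    by (rule complex_spectral_projection[OF no_imaginary_eigenvalue])
  note Q = stable_projectionD[OF proj]
  have QH: "to_mat Q *v (to_mat H *v s) = to_mat H *v (to_mat Q *v s)" for s
    by (metis Q(2) matrix_vector_mul_assoc to_mat_mult)
  \<comment> \<open>Isotropy of the stable subspace gives
    \<open>inner p (E *v (Wm *v vjoin 0 p)) = 0\<close>, which is the value of the positive definite
    \<open>S\<close> at the disturbance.\<close>
  have bot_inv: "Wm *v vjoin 0 p = 0" if p: "to_mat Q *v vjoin 0 p = vjoin 0 p" for p
  proof -
    let ?s = "vjoin 0 p"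
    have "sympl_form (to_mat Q *v ?s) (to_mat Q *v (to_mat H *v ?s)) = 0"
      by (rule conserved_form_zero[OF bilinear_sympl_form Q(3) hamiltonian])
    then have "sympl_form ?s (to_mat H *v ?s) = 0" unfolding QH p .
    then have "inner p (E *v (Wm *v ?s)) = 0" by (simp add: sympl_form_def dyn_top)
    then have "inner (Wm *v ?s) (adj_mat E *v p) = 0" by (metis inner_adj_right inner_commute)
    moreover have "S *v (Wm *v ?s) = adj_mat E *v p" using S_Wm[of ?s] by simp
    ultimately show ?thesis using S_pos by simp
  qed
  interpret hamiltonian_projection H Q
  proof
    fix p assume p: "to_mat Q *v vjoin 0 p = vjoin 0 p"
    let ?S = "{p. to_mat Q *v vjoin 0 p = vjoin 0 p}"
    have H_bot: "to_mat H *v vjoin 0 p = vjoin 0 (- (adj_mat A *v p))" if "p \<in> ?S" for p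
      using bot_inv[of p] that by (simp add: H_act y_def)
    show "p = 0"
    proof (rule ccontr)
      assume "p \<noteq> 0"
      obtain w l where w: "w \<in> ?S" "w \<noteq> 0" "adj_mat A *v w = l *s w"
      proof (rule eigenvector_in_invariant_set[where S = ?S and v = p and M = "adj_mat A"])
        fix x l assume x: "x \<in> ?S"
        have "vjoin 0 (adj_mat A *v x - l *s x) = - (to_mat H *v vjoin 0 x) - l *s vjoin 0 x"
          using H_bot[OF x] by (simp add: block_vec_eq_iff)
        moreover have "to_mat Q *v (- (to_mat H *v vjoin 0 x) - l *s vjoin 0 x) = - (to_mat H *v vjoin 0 x) - l *s vjoin 0 x"
          using x by (simp add: matrix_vector_mult_diff_distrib matrix_vector_mult_uminus_right QH vector_scalar_commute)
        ultimately show "adj_mat A *v x - l *s x \<in> ?S" by simp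
      qed (use p \<open>p \<noteq> 0\<close> in auto)
      have "to_mat H *v vjoin 0 w = (- l) *s vjoin 0 w"
        using H_bot[OF w(1)] w(3) by (simp add: block_vec_eq_iff vec.scale_minus_left)
      moreover have "vjoin 0 w \<noteq> 0" using w(2) by (simp add: block_vec_eq_iff)
      ultimately have "Re (- l) < 0"
        using projection_eigenvalue_stable[OF proj] w(1) by blast
      then show False using adj_eigenvector_stable[OF stab w(3)] w(2) by simp
    qed
  qed (fact proj hamiltonian)+
  define X where "X = graph_mat (to_mat Q)"
  define K where "K = Wm ** vblock (mat 1) X"
  have K: "K *v x = Wm *v vjoin x (X *v x)" for x
    unfolding K_def by (simp add: vblock_mult_vec flip: matrix_vector_mul_assoc)
  have X_sym: "adj_mat X = X" unfolding X_def by (rule adj_graph_mat)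
  have "2 * inner (X *v x) (A *v x + E *v v) + (norm (C *v x + D2 *v v))\<^sup>2 - \<gamma>\<^sup>2 * (norm v)\<^sup>2
      \<le> - (\<gamma>\<^sup>2 - g\<^sup>2) * (norm (v - K *v x))\<^sup>2" for x v
  proof -
    let ?s = "vjoin x (X *v x)"
    define d where "d = v - K *v x"
    have inv: "vbot (to_mat H *v ?s) = X *v vtop (to_mat H *v ?s)"
      unfolding X_def by (rule graph_invariant) simp
    have "inner x (X *v vtop (to_mat H *v ?s)) = inner (X *v x) (vtop (to_mat H *v ?s))"
      using inner_adj_right[of x X] X_sym by simp
    then have 0: "2 * inner (X *v x) (A *v x + E *v (K *v x)) = \<gamma>\<^sup>2 * (norm (K *v x))\<^sup>2 - (norm (y ?s))\<^sup>2"
      using power_balance[of ?s] unfolding inv by (simp add: dyn_top K inner_commute)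
    have y: "y ?s = C *v x + D2 *v (K *v x)" by (simp add: y_def K)
    have v: "v = K *v x + d" unfolding d_def by simp
    have Ed: "inner (X *v x) (E *v d) = \<gamma>\<^sup>2 * inner d (K *v x) - inner (D2 *v d) (y ?s)"
      using innerE[of d ?s] by (simp add: K inner_commute)
    have "A *v x + E *v v = (A *v x + E *v (K *v x)) + E *v d"
      "C *v x + D2 *v v = y ?s + D2 *v d"
      unfolding y v by (simp_all add: matrix_vector_right_distrib)
    then have "2 * inner (X *v x) (A *v x + E *v v) + (norm (C *v x + D2 *v v))\<^sup>2 - \<gamma>\<^sup>2 * (norm v)\<^sup>2 =
      (2 * inner (X *v x) (A *v x + E *v (K *v x)) + 2 * inner (X *v x) (E *v d)) + (norm (y ?s + D2 *v d))\<^sup>2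
        - \<gamma>\<^sup>2 * (norm (K *v x + d))\<^sup>2"
      by (simp add: inner_add_right v[symmetric])
    \<comment> \<open>Completing the square around \<open>K *v x\<close>: the terms linear in
      \<open>d\<close> cancel by stationarity, and only the quadratic remainder is left.\<close>
    also have "\<dots> = (norm (D2 *v d))\<^sup>2 - \<gamma>\<^sup>2 * (norm d)\<^sup>2"
      unfolding 0 Ed by (simp add: power2_norm_eq_inner inner_add_left inner_add_right inner_commute algebra_simps)
    also have "\<dots> \<le> - (\<gamma>\<^sup>2 - g\<^sup>2) * (norm d)\<^sup>2" using D2sq[of d] by (simp add: algebra_simps)
    finally show ?thesis unfolding d_def .
  qed
  then show ?thesis using that X_sym unfolding dissipative_def by blast
qed

section \<open>Complementarity and positivity for the game\<close>

text \<open>The auxiliary state \<open>\<xi>\<close> is driven by the disturbance alone, so \<open>y s - (C \<xi> + D2 w)\<close> is the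
  response to the control alone and is orthogonal to \<open>y s\<close>. This makes \<open>form\<close> below decrease along
  the stable flow of \<open>joint\<close>, whence it is nonnegative.\<close>

locale game_projection = game_system A B C D1 D2 E \<gamma> g H u Wm y
  for A :: "complex^'n::finite^'n" and B :: "complex^'m::finite^'n" and C :: "complex^'n^'p::finite"
    and D1 :: "complex^'m^'p" and D2 :: "complex^'l::finite^'p" and E :: "complex^'l^'n"
    and \<gamma> g :: real and H :: "(complex, 'n + 'n) sqmat"
    and u :: "complex^('n + 'n) \<Rightarrow> complex^'m" and Wm :: "complex^('n + 'n)^'l"
    and y :: "complex^('n + 'n) \<Rightarrow> complex^'p" +
  fixes Q :: "(complex, 'n + 'n) sqmat"
  assumes D2_gain: "\<And>v. norm (D2 *v v) \<le> g * norm v"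
    and proj: "stable_projection H Q"
begin

abbreviation "q \<equiv> to_mat Q"

lemma qq: "q *v (q *v s) = q *v s"
  by (metis stable_projectionD(1)[OF proj] matrix_vector_mul_assoc to_mat_mult)

lemma qH: "q *v (to_mat H *v s) = to_mat H *v (q *v s)"
  by (metis stable_projectionD(2)[OF proj] matrix_vector_mul_assoc to_mat_mult)

text \<open>The state is a pair (s, \<xi>). The first component follows \<open>H\<close> on the
  range of \<open>q\<close> and decays at rate 1 on the kernel, which makes the flow stable on the
  whole space; the disturbance produced by \<open>q s\<close> drives \<xi>.\<close>

definition joint :: "(complex, ('n + 'n) + 'n) sqmat" where
  "joint = of_mat (block22 (to_mat H ** q - mat 1 + q) 0 (E ** Wm ** q) A)"

lemma joint_mult_vec: "to_mat joint *v s = vjoin (to_mat H *v (q *v vtop s) - vtop s + q *v vtop s)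
    (E *v (Wm *v (q *v vtop s)) + A *v vbot s)"
  by (simp add: joint_def block22_mult_vec matrix_vector_mult_add_rdistrib matrix_vector_mult_diff_rdistrib
      flip: matrix_vector_mul_assoc)

lemma joint_state: "q *v vtop (to_mat joint *v s) = to_mat H *v (q *v vtop s)"
  by (simp add: joint_mult_vec matrix_vector_right_distrib matrix_vector_mult_diff_distrib qH qq)

lemma joint_stable: "complex_exp_stable (to_mat joint)"
  unfolding complex_exp_stable_def
proof (intro allI impI)
  fix l assume "is_eigenvalue (to_mat joint) l"
  then obtain s where s: "s \<noteq> 0" "to_mat joint *v s = l *s s" unfolding is_eigenvalue_def by blast
  let ?v = "vtop s"
  have top: "to_mat H *v (q *v ?v) - ?v + q *v ?v = l *s ?v"
    using arg_cong[OF s(2), of vtop] unfolding joint_mult_vec by simp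
  have bot: "E *v (Wm *v (q *v ?v)) + A *v vbot s = l *s vbot s"
    using arg_cong[OF s(2), of vbot] unfolding joint_mult_vec by simp
  have Hqv: "to_mat H *v (q *v ?v) = l *s (q *v ?v)"
    using joint_state[of s] unfolding s(2) by (simp add: vector_scalar_commute)
  show "Re l < 0"
  proof (cases "q *v ?v = 0")
    case False
    then show ?thesis using projection_eigenvalue_stable[OF proj, of "q *v ?v" l] Hqv qq by blast
  next
    case True
    then have "l *s ?v = - ?v" using top by simp
    then have "(l + 1) *s ?v = 0" by (simp only: vector_sadd_rdistrib) simp
    then have "l + 1 = 0 \<or> ?v = 0" unfolding vector_mul_eq_0 .
    then consider "l = - 1" | "?v = 0" by (auto simp: eq_neg_iff_add_eq_0)
    then show ?thesis
    proof cases
      case 2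
      then have "vbot s \<noteq> 0" using s(1) by (simp add: block_vec_eq_iff)
      moreover have "A *v vbot s = l *s vbot s" using bot True by simp
      ultimately show ?thesis using A_stable unfolding complex_exp_stable_def is_eigenvalue_def by blast
    qed simp
  qed
qed

text \<open>With (x, p) = q s, the diagonal value is inner \<xi> (X \<xi>) + 2 inner (x - \<xi>) p -
  inner x p. At \<xi> = 0 it reduces to inner x p, the quantity to be shown nonnegative.\<close>

definition form :: "complex^'n^'n \<Rightarrow> complex^(('n + 'n) + 'n) \<Rightarrow> complex^(('n + 'n) + 'n) \<Rightarrow> real" where
  "form X s r = inner (vbot s) (X *v vbot r)
    + inner (vtop (q *v vtop s) - vbot s) (vbot (q *v vtop r))
    + inner (vbot (q *v vtop s)) (vtop (q *v vtop r) - vbot r)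
    - inner (vtop (q *v vtop s)) (vbot (q *v vtop r))"

lemma bilinear_form: "bilinear (form X)"
  unfolding bilinear_def form_def
  by (intro conjI allI linearI)
    (simp_all add: matrix_vector_right_distrib matrix_vector_mult_scaleR_right inner_add_left inner_add_right
      inner_diff_left inner_diff_right algebra_simps)

text \<open>Let \<open>w\<close> be the disturbance and y' the output it produces with \<xi>. The
  storage term contributes at most \<gamma>^2 |w|^2 - |y'|^2 minus the slack, the middle terms -2
  inner (y - y') y, and the last term |y|^2 - \<gamma>^2 |w|^2. The sum is -|y - y'|^2 minus the
  slack.\<close>

lemma form_derivative:
  assumes X: "adj_mat X = X" and dissip: "dissipative A C D2 E \<gamma> g X K"
  shows "form X (to_mat joint *v s) s + form X s (to_mat joint *v s) \<le>
    - (norm (y (q *v vtop s) - (C *v vbot s + D2 *v (Wm *v (q *v vtop s)))))\<^sup>2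
    - (\<gamma>\<^sup>2 - g\<^sup>2) * (norm (Wm *v (q *v vtop s) - K *v vbot s))\<^sup>2"
proof -
  define r where "r = q *v vtop s"
  define \<xi> where "\<xi> = vbot s"
  define w where "w = Wm *v r"
  define y' where "y' = C *v \<xi> + D2 *v w"
  define \<eta> where "\<eta> = vtop r - \<xi>"
  have \<xi>': "vbot (to_mat joint *v s) = A *v \<xi> + E *v w"
    unfolding joint_mult_vec \<xi>_def w_def r_def by simp
  have X_inner: "inner a (X *v b) = inner (X *v a) b" for a b
    using inner_adj_right[of a X b] X by simp
  have "form X (to_mat joint *v s) s + form X s (to_mat joint *v s) =
    2 * inner (X *v \<xi>) (A *v \<xi> + E *v w)
    + 2 * (inner (vtop (to_mat H *v r) - (A *v \<xi> + E *v w)) (vbot r) + inner \<eta> (vbot (to_mat H *v r)))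
    - (inner (vtop (to_mat H *v r)) (vbot r) + inner (vtop r) (vbot (to_mat H *v r)))"
    unfolding form_def joint_state \<xi>' r_def[symmetric] \<xi>_def[symmetric] \<eta>_def[symmetric]
    using X_inner[of \<xi> "A *v \<xi>"] X_inner[of \<xi> "E *v w"]
    by (simp add: inner_commute algebra_simps)
  also have "vtop (to_mat H *v r) - (A *v \<xi> + E *v w) = A *v \<eta> + B *v u r"
    unfolding dyn_top w_def \<eta>_def by (simp add: matrix_vector_mult_diff_distrib)
  also have "inner (A *v \<eta> + B *v u r) (vbot r) + inner \<eta> (vbot (to_mat H *v r)) = - inner (y r - y') (y r)"
  proof -
    have "y r - y' = C *v \<eta> + D1 *v u r"
      unfolding out y'_def \<eta>_def w_def by (simp add: matrix_vector_mult_diff_distrib)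
    then show ?thesis
      by (simp add: dyn_bot inner_add_left inner_diff_right inner_adj_right innerB)
  qed
  also have "inner (vtop (to_mat H *v r)) (vbot r) + inner (vtop r) (vbot (to_mat H *v r)) = \<gamma>\<^sup>2 * (norm w)\<^sup>2 - (norm (y r))\<^sup>2"
    unfolding w_def by (rule power_balance)
  also have "2 * inner (X *v \<xi>) (A *v \<xi> + E *v w) + 2 * - inner (y r - y') (y r) - (\<gamma>\<^sup>2 * (norm w)\<^sup>2 - (norm (y r))\<^sup>2) \<le>
    - (norm (y r - y'))\<^sup>2 - (\<gamma>\<^sup>2 - g\<^sup>2) * (norm (w - K *v \<xi>))\<^sup>2"
    using dissip[unfolded dissipative_def, rule_format, of \<xi> w] unfolding y'_def[symmetric]
    by (simp add: power2_norm_eq_inner inner_diff_left inner_diff_right inner_commute algebra_simps)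
  finally show ?thesis unfolding y'_def w_def \<xi>_def r_def .
qed

lemma psd_form:
  obtains X K where "\<And>s. 0 \<le> form X s s"
    "\<And>s. form X (to_mat joint *v s) s + form X s (to_mat joint *v s) \<le> 0"
    "\<And>s. form X (to_mat joint *v s) s + form X s (to_mat joint *v s) \<le>
      - (norm (y (q *v vtop s) - (C *v vbot s + D2 *v (Wm *v (q *v vtop s)))))\<^sup>2
      - (\<gamma>\<^sup>2 - g\<^sup>2) * (norm (Wm *v (q *v vtop s) - K *v vbot s))\<^sup>2"
proof -
  show thesis
  proof (rule bounded_real_dissipation[where A = A and C = C and ?D2.0 = D2 and E = E and g = g and \<gamma> = \<gamma>])
    show "norm (C *v x + D2 *v v) \<le> g * norm v" if "Re z = 0" "z *s x = A *v x + E *v v" for z x v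
      by (rule gain[OF that])
    fix X :: "complex^'n^'n" and K :: "complex^'n^'l"
    assume X: "adj_mat X = X" and dissip: "dissipative A C D2 E \<gamma> g X K"
    note dec = form_derivative[OF X dissip]
    have "0 \<le> \<gamma>\<^sup>2 - g\<^sup>2" using g_nonneg g_less by (simp add: power_mono)
    then have "- a\<^sup>2 - (\<gamma>\<^sup>2 - g\<^sup>2) * b\<^sup>2 \<le> 0" for a b :: real
      using mult_nonneg_nonneg[of "\<gamma>\<^sup>2 - g\<^sup>2" "b\<^sup>2"] zero_le_power2[of a] zero_le_power2[of b] by linarith
    then have dec0: "form X (to_mat joint *v s) s + form X s (to_mat joint *v s) \<le> 0" for s
      using dec[of s] order.trans by blast
    show thesis
      by (rule that[OF lyapunov_nonneg[OF bilinear_form joint_stable dec0] dec0 dec])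
  qed (fact A_stable g_nonneg g_less D2_gain)+
qed

text \<open>At (0, p) with \<xi> = 0 the nonnegative form vanishes, so this vector lies in its
  kernel. There the form has zero derivative, which forces disturbance and output to vanish and
  leaves the costate governed by the adjoint of \<open>A\<close> alone, which cannot decay.\<close>

lemma complementary:
  assumes p: "q *v vjoin 0 p = vjoin 0 p"
  shows "p = 0"
proof -
  obtain X K where psd: "\<And>s. 0 \<le> form X s s"
    and dec0: "\<And>s. form X (to_mat joint *v s) s + form X s (to_mat joint *v s) \<le> 0" and dec: "\<And>s. form X (to_mat joint *v s) s + form X s (to_mat joint *v s) \<le>
      - (norm (y (q *v vtop s) - (C *v vbot s + D2 *v (Wm *v (q *v vtop s)))))\<^sup>2
      - (\<gamma>\<^sup>2 - g\<^sup>2) * (norm (Wm *v (q *v vtop s) - K *v vbot s))\<^sup>2"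
    using psd_form by blast
  have gg: "g\<^sup>2 < \<gamma>\<^sup>2" using g_nonneg g_less by (intro power_strict_mono) auto
  define N where "N = {s. form X s s = 0 \<and> vbot s = 0 \<and> q *v vtop s = vtop s}"
  have N_zero: "y (vtop s) = 0" "Wm *v vtop s = 0" if s: "s \<in> N" for s
  proof -
    have qv: "q *v vtop s = vtop s" and \<xi>: "vbot s = 0" and f: "form X s s = 0" using s unfolding N_def by auto
    let ?a = "(norm (y (vtop s) - D2 *v (Wm *v vtop s)))\<^sup>2" and ?c = "(norm (Wm *v vtop s))\<^sup>2"
    have "0 \<le> - ?a - (\<gamma>\<^sup>2 - g\<^sup>2) * ?c"
      using dec[of s] psd_kernel[OF bilinear_form psd f, of "to_mat joint *v s"] unfolding qv \<xi> by simp
    moreover have "?a \<ge> 0" "(\<gamma>\<^sup>2 - g\<^sup>2) * ?c \<ge> 0" using gg by simp_all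
    ultimately have "?a = 0" "(\<gamma>\<^sup>2 - g\<^sup>2) * ?c = 0" by linarith+
    then show "Wm *v vtop s = 0" "y (vtop s) = 0" using gg by auto
  qed
  have N_joint: "to_mat joint *v s = vjoin (to_mat H *v vtop s) 0" if "s \<in> N" for s
    using that N_zero[OF that] unfolding N_def by (simp add: joint_mult_vec)
  have N_inv: "to_mat joint *v s - l *s s \<in> N" if s: "s \<in> N" for s l
  proof -
    have qv: "q *v vtop s = vtop s" and \<xi>: "vbot s = 0" and f: "form X s s = 0" using s unfolding N_def by auto
    have "linear ((*v) (to_mat joint))"
      by (rule bounded_linear.linear[OF bounded_linear_matrix_vector_mult])
    from psd_kernel_invariant[OF bilinear_form psd this dec0 f]
    have 1: "form X (to_mat joint *v s) (to_mat joint *v s) = 0" .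
    have form_s: "form X r r = inner (vtop (q *v vtop r)) (vbot (q *v vtop r))" if "vbot r = 0" for r
      using that by (simp add: form_def inner_commute)
    have "form X (l *s s) (l *s s) = (cmod l)\<^sup>2 * form X s s"
      using \<xi> by (simp add: form_s vector_scalar_commute inner_scale_both)
    then have 2: "form X (l *s s) (l *s s) = 0" using f by simp
    show ?thesis unfolding N_def
      using psd_kernel_diff[OF bilinear_form psd 1 2] \<xi> N_joint[OF s] qv
      by (simp add: matrix_vector_mult_diff_distrib vector_scalar_commute qH)
  qed
  \<comment> \<open>One eigenvector in \<open>N\<close> would not settle the given vector, so the
    whole chain of factors is followed. If the costate of \<open>joint s - l s\<close> is 0, the
    costate of \<open>s\<close> satisfies the eigenvector equation of the adjoint of
    \<open>A\<close> for - l, whose real part is positive, and is therefore 0.\<close>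
  have costate: "vbot (vtop s) = 0"
    if "reduce_by (to_mat joint) ls s = 0" "s \<in> N" "\<forall>l\<in>set ls. is_eigenvalue (to_mat joint) l" for ls s
    using that
  proof (induction ls arbitrary: s)
    case (Cons l ls)
    have l: "Re l < 0" using Cons.prems(3) joint_stable unfolding complex_exp_stable_def by simp
    have "vbot (vtop (to_mat joint *v s - l *s s)) = 0"
    proof (rule Cons.IH)
      show "to_mat joint *v s - l *s s \<in> N" by (rule N_inv[OF Cons.prems(2)])
    qed (use Cons.prems in simp_all)
    then have "adj_mat A *v vbot (vtop s) = (- l) *s vbot (vtop s)"
      using N_joint[OF Cons.prems(2)] N_zero[OF Cons.prems(2)]
      by (simp add: dyn_bot vec.scale_minus_left) (metis add.inverse_inverse)
    then show ?case by (rule adj_eigenvector_stable[OF A_stable]) (use l in simp)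
  qed simp
  let ?s = "vjoin (vjoin 0 p) 0 :: complex^(('n + 'n) + 'n)"
  have "?s \<in> N" using p by (simp add: N_def form_def)
  moreover obtain ls where "\<forall>l\<in>set ls. is_eigenvalue (to_mat joint) l" "reduce_by (to_mat joint) ls ?s = 0"
    using eigenvalue_list_annihilates by blast
  ultimately have "vbot (vtop ?s) = 0" using costate by blast
  then show ?thesis by simp
qed

lemma hamiltonian_projection: "hamiltonian_projection H Q"
proof
  show "stable_projection H Q" by (rule proj)
  show "sympl_form (to_mat H *v s) r + sympl_form s (to_mat H *v r) = 0" for s r by (rule hamiltonian)
  show "p = 0" if "q *v vjoin 0 p = vjoin 0 p" for p using that by (rule complementary)
qed

text \<open>The value of the nonnegative form at a graph vector (x, P x) with \<xi> = 0.\<close>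

lemma graph_mat_nonneg: "0 \<le> inner x (graph_mat q *v x)"
proof (rule psd_form)
  fix X :: "complex^'n^'n"
  assume psd: "\<And>s. 0 \<le> form X s s"
  show ?thesis using psd[of "vjoin (vjoin x (graph_mat q *v x)) 0"]
    by (simp add: form_def hamiltonian_projection.graph_in_range[OF hamiltonian_projection] inner_commute)
qed

lemma pos_semidef_graph_mat: "pos_semidef (graph_mat q)"
proof -
  have "inner a b = Re (cnj a * b)" for a b :: complex by (simp add: inner_complex_def)
  then show ?thesis unfolding pos_semidef_def
    using graph_mat_nonneg hamiltonian_projection.adj_graph_mat[OF hamiltonian_projection] by (simp add: inner_vec_def Re_sum)
qed

end

section \<open>Invariant zeros and the system pencil\<close>

lemma full_rank_iff_left_inverse:
  fixes M :: "'k::field^'n^'m"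
  shows "rank M = CARD('n) \<longleftrightarrow> (\<exists>L. L ** M = mat 1)"
proof -
  have "rank M = CARD('n) \<longleftrightarrow> vec.span (rows M) = UNIV"
    unfolding row_rank_def_gen
    using vec.dim_eq_full[of "rows M"] unfolding vec.dimension_def card_cart_basis .
  then show ?thesis by (simp add: matrix_left_invertible_span_rows_gen)
qed

lemma rank_le_columns:
  fixes M :: "'k::field^'n^'m"
  shows "rank M \<le> CARD('n)"
  unfolding row_rank_def_gen by (rule dim_subset_UNIV_cart_gen)

lemma exists_non_eigenvalue: "\<exists>z. \<not> is_eigenvalue (A :: complex^'n^'n) z"
proof -
  define c where "c = onorm ((*v) A) + 1"
  have c: "c > 0" unfolding c_def using onorm_matrix_nonneg[of A] by linarith
  have "\<not> is_eigenvalue A (of_real c)"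
  proof
    assume "is_eigenvalue A (of_real c)"
    then obtain v where v: "v \<noteq> 0" "A *v v = of_real c *s v" unfolding is_eigenvalue_def by blast
    have "norm (A *v v) = c * norm v" using c unfolding v(2) by (simp add: norm_scale_vec)
    moreover have "norm (A *v v) \<le> onorm ((*v) A) * norm v" by (rule norm_matrix_vector_mult_le_onorm)
    ultimately have "c * norm v \<le> (c - 1) * norm v" unfolding c_def by simp
    then show False using v(1) by (simp add: algebra_simps)
  qed
  then show ?thesis by blast
qed

lemma invertible_resolvent_iff: "invertible (mat z - A) \<longleftrightarrow> \<not> is_eigenvalue (A :: complex^'n^'n) z"
proof -
  have act: "(mat z - A) *v x = z *s x - A *v x" for x
    by (simp add: matrix_vector_mult_diff_rdistrib mat_vector_mult vec_eq_iff)
  have "invertible (mat z - A) \<longleftrightarrow> (\<forall>x. (mat z - A) *v x = 0 \<longrightarrow> x = 0)"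
    using matrix_left_invertible_ker invertible_left_inverse by blast
  then show ?thesis unfolding act is_eigenvalue_def by auto
qed

text \<open>The characteristic polynomial, as the determinant of a polynomial matrix, is nonzero
  because it does not vanish at a non-eigenvalue. Evaluation and the embedding into fractions are
  ring homomorphisms, so both commute with the determinant.\<close>

lemma invertible_ratfun_resolvent:
  fixes A :: "complex^'n^'n"
  shows "invertible (mat ratfun_var - map_matrix ratfun_const A)"
proof -
  define P :: "complex poly^'n^'n" where "P = mat [:0, 1:] - map_matrix (\<lambda>c. [:c:]) A"
  obtain z where z: "\<not> is_eigenvalue A z" using exists_non_eigenvalue by blast
  have "map_matrix (\<lambda>p. poly p z) P = mat z - A"
    unfolding P_def by (simp add: vec_eq_iff mat_def)
  then have "poly (det P) z = det (mat z - A)"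
    using det_map_matrix[of "\<lambda>p. poly p z" P] by simp
  then have "det P \<noteq> 0" using z by (auto simp: invertible_resolvent_iff[symmetric] invertible_det_nz)
  then have nz: "Fract (det P) 1 \<noteq> 0" by (simp add: Zero_fract_def eq_fract)
  have "map_matrix (\<lambda>p. Fract p 1) P = mat ratfun_var - map_matrix ratfun_const A"
    unfolding P_def ratfun_var_def ratfun_const_def by (simp add: vec_eq_iff mat_def Zero_fract_def)
  then have "det (mat ratfun_var - map_matrix ratfun_const A) = Fract (det P) 1"
    using det_map_matrix[of "\<lambda>p. Fract p 1" P] by (simp add: One_fract_def)
  then show ?thesis using nz by (simp add: invertible_det_nz)
qed

lemma system_pencil_mult_vec:
  "system_pencil A B C D s *v r = vjoin ((mat s - A) *v vtop r - B *v vbot r) (C *v vtop r + D *v vbot r)"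
  unfolding system_pencil_def by (simp add: block22_mult_vec matrix_vector_mult_uminus)

text \<open>Over the rational functions, eliminating the state by the resolvent leaves the transfer
  matrix, so left invertibility gives the pencil full column rank. As \<open>z\<close> is not an
  invariant zero, the rank does not drop there.\<close>

lemma pencil_injective:
  fixes A :: "complex^'n^'n" and B :: "complex^'m^'n" and C :: "complex^'n^'p" and D :: "complex^'m^'p"
  assumes left: "left_invertible_system A B C D" and zero: "\<not> invariant_zero A B C D z"
    and x: "z *s x = A *v x + B *v v" "C *v x + D *v v = 0"
  shows "x = 0"
proof -
  let ?A = "map_matrix ratfun_const A" and ?B = "map_matrix ratfun_const B"
    and ?C = "map_matrix ratfun_const C" and ?D = "map_matrix ratfun_const D"
  let ?N = "mat ratfun_var - ?A" and ?S = "system_pencil ?A ?B ?C ?D ratfun_var"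
  obtain X where X: "X ** transfer_mat ?A ?B ?C ?D ratfun_var = mat 1"
    using left unfolding left_invertible_system_def by blast
  have N: "invertible ?N" by (rule invertible_ratfun_resolvent)
  have "r = 0" if "?S *v r = 0" for r
  proof -
    have 1: "?N *v vtop r = ?B *v vbot r" and 2: "?C *v vtop r + ?D *v vbot r = 0"
      using that unfolding system_pencil_mult_vec by (simp_all add: block_vec_eq_iff)
    have 3: "vtop r = matrix_inv ?N *v (?B *v vbot r)"
      unfolding 1[symmetric] by (simp add: matrix_vector_mul_assoc matrix_inv_left[OF N])
    have "transfer_mat ?A ?B ?C ?D ratfun_var *v vbot r = ?C *v vtop r + ?D *v vbot r"
      unfolding transfer_mat_def 3
      by (simp add: matrix_vector_mult_add_rdistrib flip: matrix_vector_mul_assoc)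
    then have "X *v (transfer_mat ?A ?B ?C ?D ratfun_var *v vbot r) = 0" unfolding 2 by simp
    then have "vbot r = 0" by (simp add: matrix_vector_mul_assoc X)
    then show ?thesis using 3 by (simp add: block_vec_eq_iff)
  qed
  then have "rank ?S = CARD('n + 'm)"
    unfolding full_rank_iff_left_inverse matrix_left_invertible_ker by blast
  then have "rank (system_pencil A B C D z) \<ge> CARD('n + 'm)"
    using zero unfolding invariant_zero_def by simp
  then have "rank (system_pencil A B C D z) = CARD('n + 'm)"
    using rank_le_columns[of "system_pencil A B C D z"] by simp
  then have inj: "\<And>r. system_pencil A B C D z *v r = 0 \<Longrightarrow> r = 0"
    unfolding full_rank_iff_left_inverse matrix_left_invertible_ker by blast
  have "mat z *v x = z *s x" by (simp add: mat_vector_mult vec_eq_iff)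
  then have "system_pencil A B C D z *v vjoin x v = 0"
    using x by (simp add: system_pencil_mult_vec matrix_vector_mult_diff_rdistrib)
  then have "vjoin x v = 0" by (rule inj)
  then show ?thesis by (simp add: block_vec_eq_iff)
qed

section \<open>Gain bounds on the imaginary axis and at infinity\<close>

lemma le_if_le_add_small:
  fixes a b :: real
  assumes "e0 > 0" "\<And>e. 0 < e \<Longrightarrow> e < e0 \<Longrightarrow> a \<le> b + e * M"
  shows "a \<le> b"
proof (rule tendsto_lowerbound)
  show "((\<lambda>e. b + e * M) \<longlongrightarrow> b) (at_right 0)" by (auto intro!: tendsto_eq_intros)
  show "\<forall>\<^sub>F e in at_right 0. a \<le> b + e * M"
    unfolding eventually_at_right_field using assms by blast
qed simp

text \<open>The norm is a supremum over the open right half plane. The bound reaches the imaginary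
  axis by shifting \<open>z\<close> to the right by a small \<open>e\<close>, and reaches
  \<open>D\<close> by letting \<open>s\<close> tend to infinity along the positive reals.\<close>

lemma hinf_gain:
  fixes A :: "complex^'n^'n" and E :: "complex^'l^'n" and C :: "complex^'n^'p" and D :: "complex^'l^'p"
  assumes stab: "complex_exp_stable A" and hinf: "hinf_norm (transfer_mat A E C D) < ereal \<gamma>"
  obtains g where "0 \<le> g" "g < \<gamma>"
    "\<And>z x v. Re z = 0 \<Longrightarrow> z *s x = A *v x + E *v v \<Longrightarrow> norm (C *v x + D *v v) \<le> g * norm v"
    "\<And>v. norm (D *v v) \<le> g * norm v"
proof -
  let ?G = "transfer_mat A E C D"
  have upper: "ereal (onorm ((*v) (?G s))) \<le> hinf_norm ?G" if "Re s > 0" for s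
    unfolding hinf_norm_def by (rule SUP_upper) (use that in simp)
  have "0 \<le> ereal (onorm ((*v) (?G 1)))" by (simp add: onorm_matrix_nonneg)
  also have "\<dots> \<le> hinf_norm ?G" by (rule upper) simp
  finally have "0 \<le> hinf_norm ?G" .
  then obtain g where g: "hinf_norm ?G = ereal g" using hinf by (cases "hinf_norm ?G") auto
  have g0: "0 \<le> g" "g < \<gamma>" using \<open>0 \<le> hinf_norm ?G\<close> hinf unfolding g by simp_all
  have gain: "norm (C *v x + D *v v) \<le> g * norm v" if "Re s > 0" "s *s x = A *v x + E *v v" for s x v
  proof -
    have inv: "invertible (mat s - A)"
      using stab that(1) unfolding invertible_resolvent_iff complex_exp_stable_def by force
    have "mat s *v x = s *s x" by (simp add: mat_vector_mult vec_eq_iff)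
    then have "(mat s - A) *v x = E *v v" using that(2) by (simp add: matrix_vector_mult_diff_rdistrib)
    then have "x = matrix_inv (mat s - A) *v (E *v v)"
      by (metis inv matrix_inv_left matrix_vector_mul_assoc matrix_vector_mul_lid)
    then have "C *v x + D *v v = ?G s *v v"
      unfolding transfer_mat_def by (simp add: matrix_vector_mult_add_rdistrib flip: matrix_vector_mul_assoc)
    then have "norm (C *v x + D *v v) \<le> onorm ((*v) (?G s)) * norm v"
      using norm_matrix_vector_mult_le_onorm[of "?G s" v] by simp
    also have "\<dots> \<le> g * norm v" using upper[OF that(1)] unfolding g by (intro mult_right_mono) auto
    finally show ?thesis .
  qed
  define c where "c = onorm ((*v) C)"
  have c: "norm (C *v x) \<le> c * norm x" "0 \<le> c" for x
    unfolding c_def by (rule norm_matrix_vector_mult_le_onorm, rule onorm_matrix_nonneg)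
  have axis: "norm (C *v x + D *v v) \<le> g * norm v" if z: "Re z = 0" "z *s x = A *v x + E *v v" for z x v
  proof -
    define R where "R = matrix_inv (mat z - A)"
    have inv: "invertible (mat z - A)"
      using stab z(1) unfolding invertible_resolvent_iff complex_exp_stable_def by force
    define k where "k = onorm ((*v) R)"
    have k: "norm (R *v x) \<le> k * norm x" "0 \<le> k" for x
      unfolding k_def by (rule norm_matrix_vector_mult_le_onorm, rule onorm_matrix_nonneg)
    show ?thesis
    proof (rule le_if_le_add_small)
      \<comment> \<open>For \<open>e\<close> below this bound e * k \<le> 1/2, so the norm of
        \<open>d\<close> on the right of its own estimate can be absorbed.\<close>
      show "1 / (2 * (k + 1)) > 0" using k(2) by simp
      fix e :: real assume e: "0 < e" "e < 1 / (2 * (k + 1))"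
      obtain x' where x': "(z + of_real e) *s x' = A *v x' + E *v v"
        using resolvent_equation_solvable[OF stab, of "z + of_real e"] z(1) e(1) by auto
      define d where "d = x' - x"
      have "z *s d - A *v d = - (of_real e *s x')"
        unfolding d_def using x' z(2)
        by (simp add: vec.scale_right_diff_distrib matrix_vector_mult_diff_distrib vector_sadd_rdistrib algebra_simps)
      then have "(mat z - A) *v d = - (of_real e *s x')"
        by (simp add: matrix_vector_mult_diff_rdistrib mat_vector_mult vec_eq_iff)
      then have "d = R *v (- (of_real e *s x'))"
        unfolding R_def by (metis inv matrix_inv_left matrix_vector_mul_assoc matrix_vector_mul_lid)
      then have "norm d \<le> k * norm (- (of_real e *s x'))" using k(1) by metis
      also have "\<dots> = e * k * norm x'" using e(1) by (simp add: norm_scale_vec)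
      also have "\<dots> \<le> e * k * (norm x + norm d)"
        unfolding d_def using e(1) k(2) norm_triangle_sub[of x' x] by (intro mult_left_mono) auto
      finally have 1: "norm d \<le> e * k * norm x + (e * k) * norm d" by (simp add: algebra_simps)
      have "e * (2 * (k + 1)) < 1" using e(2) k(2) by (simp add: pos_less_divide_eq)
      then have "e * k \<le> 1/2" using e(1) by (simp add: algebra_simps)
      then have "(e * k) * norm d \<le> 1/2 * norm d" by (intro mult_right_mono) auto
      then have d: "norm d \<le> 2 * (e * k * norm x)" using 1 by linarith
      have "C *v x + D *v v = (C *v x' + D *v v) - C *v d"
        unfolding d_def by (simp add: matrix_vector_mult_diff_distrib)
      then have "norm (C *v x + D *v v) \<le> norm (C *v x' + D *v v) + norm (C *v d)"
        by (metis norm_triangle_ineq4)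
      also have "\<dots> \<le> g * norm v + c * (2 * (e * k * norm x))"
        using gain[of "z + of_real e" x' v] x' z(1) e(1) order.trans[OF c(1)[of d] mult_left_mono[OF d c(2)]]
        by (intro add_mono) auto
      finally show "norm (C *v x + D *v v) \<le> g * norm v + e * (2 * c * k * norm x)" by (simp add: mult_ac)
    qed
  qed
  have "norm (D *v v) \<le> g * norm v" for v
  proof (rule le_if_le_add_small)
    define a where "a = onorm ((*v) A)"
    have a: "norm (A *v x) \<le> a * norm x" "0 \<le> a" for x
      unfolding a_def by (rule norm_matrix_vector_mult_le_onorm, rule onorm_matrix_nonneg)
    fix e :: real assume e: "0 < e" "e < 1"
    \<comment> \<open>With this \<open>t\<close> the term \<open>a * norm x\<close> cancels and
      leaves norm x \<le> e * norm (E v).\<close>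
    define t where "t = a + 1 / e"
    have t: "t > 0" unfolding t_def using a(2) e by (simp add: add_nonneg_pos)
    obtain x where x: "of_real t *s x = A *v x + E *v v"
      using resolvent_equation_solvable[OF stab, of "of_real t"] t by auto
    have "t * norm x = norm (A *v x + E *v v)" using t unfolding x[symmetric] by (simp add: norm_scale_vec)
    also have "\<dots> \<le> a * norm x + norm (E *v v)" by (rule norm_triangle_le) (use a(1)[of x] in simp)
    finally have "norm x / e \<le> norm (E *v v)" unfolding t_def by (simp add: algebra_simps)
    then have nx: "norm x \<le> e * norm (E *v v)" using e by (simp add: pos_divide_le_eq mult.commute)
    have "D *v v = (C *v x + D *v v) - C *v x" by simp
    then have "norm (D *v v) \<le> norm (C *v x + D *v v) + norm (C *v x)" by (metis norm_triangle_ineq4)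
    also have "\<dots> \<le> g * norm v + c * (e * norm (E *v v))"
      using gain[of "of_real t" x v] x t order.trans[OF c(1)[of x] mult_left_mono[OF nx c(2)]]
      by (intro add_mono) auto
    finally show "norm (D *v v) \<le> g * norm v + e * (c * norm (E *v v))" by (simp add: mult_ac)
  qed simp
  then show ?thesis using that[OF g0] axis by blast
qed

section \<open>The pointwise problem\<close>

text \<open>The starred data are separate arguments because the same matrices are formed over the
  algebra, with its involution, and at each character, with adjoints; \<open>c\<close> is the square
  of \<gamma>.\<close>

definition game_weight ::
  "'a::comm_ring_1^'m^'p \<Rightarrow> 'a^'l^'p \<Rightarrow> 'a^'p^'m \<Rightarrow> 'a^'p^'l \<Rightarrow> 'a \<Rightarrow> 'a^('m + 'l)^('m + 'l)" where
  "game_weight D1 D2 D1s D2s c = block22 (D1s ** D1) (D1s ** D2) (D2s ** D1) (D2s ** D2 - mat c)"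

text \<open>With \<open>Wi\<close> the inverse of the weight, this solves the stationarity
  conditions: it gives control and disturbance as a linear function of state and costate.\<close>

definition game_policy ::
  "'a::comm_ring_1^'n^'p \<Rightarrow> 'a^'n^'m \<Rightarrow> 'a^'p^'m \<Rightarrow> 'a^'p^'l \<Rightarrow> 'a^'n^'l \<Rightarrow> 'a^('m + 'l)^('m + 'l) \<Rightarrow> 'a^('n + 'n)^('m + 'l)" where
  "game_policy C Bs D1s D2s Es Wi = - (Wi ** hblock (vblock (D1s ** C) (D2s ** C)) (vblock Bs Es))"

definition game_hamiltonian ::
  "'a::comm_ring_1^'n^'n \<Rightarrow> 'a^'m^'n \<Rightarrow> 'a^'n^'p \<Rightarrow> 'a^'m^'p \<Rightarrow> 'a^'l^'p \<Rightarrow> 'a^'l^'n \<Rightarrow> 'a^'n^'n \<Rightarrow> 'a^'p^'n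
    \<Rightarrow> 'a^('n + 'n)^('m + 'l) \<Rightarrow> 'a^('n + 'n)^('n + 'n)" where
  "game_hamiltonian A B C D1 D2 E As Cs Z =
    block22 A 0 (- (Cs ** C)) (- As) + vblock (hblock B E) (- (Cs ** hblock D1 D2)) ** Z"

locale pointwise_problem =
  fixes A :: "complex^'n::finite^'n" and B :: "complex^'m::finite^'n" and C :: "complex^'n^'p::finite"
    and D1 :: "complex^'m^'p" and D2 :: "complex^'l::finite^'p" and E :: "complex^'l^'n" and \<gamma> :: real
    and F1 :: "complex^'n^'m" and F2 :: "complex^'l^'m"
  assumes stable: "complex_exp_stable (A + B ** F1)"
    and hinf: "hinf_norm (transfer_mat (A + B ** F1) (E + B ** F2) (C + D1 ** F1) (D2 + D1 ** F2)) < ereal \<gamma>"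
    and left: "left_invertible_system A B C D1"
    and no_zeros: "\<And>z. Re z = 0 \<Longrightarrow> \<not> invariant_zero A B C D1 z"
    and ker: "{v. D1 *v v = 0} = {0}"
begin

definition "W = game_weight D1 D2 (adj_mat D1) (adj_mat D2) (of_real (\<gamma>\<^sup>2))"
definition "Z = game_policy C (adj_mat B) (adj_mat D1) (adj_mat D2) (adj_mat E) (matrix_inv W)"
definition "H = game_hamiltonian A B C D1 D2 E (adj_mat A) (adj_mat C) Z"

lemma W_mult_vec: "W *v s = vjoin (adj_mat D1 *v (D1 *v vtop s + D2 *v vbot s))
    (adj_mat D2 *v (D1 *v vtop s + D2 *v vbot s) - \<gamma>\<^sup>2 *\<^sub>R vbot s)"
  unfolding W_def game_weight_def
  by (simp add: block22_mult_vec matrix_vector_mult_diff_rdistrib mat_vector_mult block_vec_eq_iff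
      matrix_vector_right_distrib flip: matrix_vector_mul_assoc)
    (simp add: vec_eq_iff scaleR_conv_of_real[where 'a = complex])

text \<open>A kernel vector with components a and v makes z = D1 a + D2 v orthogonal to the range of
  \<open>D1\<close>, with |z| = \<gamma> |v|. Replacing \<open>D2\<close> by D2 + D1 F2 does not
  change the product with z, so the gain bound gives \<gamma>^2 |v|^2 \<le> g \<gamma> |v|^2. Hence
  v = 0, then z = 0, and injectivity of \<open>D1\<close> finishes.\<close>

lemma W_invertible: "invertible W"
proof (rule invertible_if_injective)
  fix s assume s: "W *v s = 0"
  obtain g where g: "0 \<le> g" "g < \<gamma>" and gain: "\<And>v. norm ((D2 + D1 ** F2) *v v) \<le> g * norm v"
    by (rule hinf_gain[OF stable hinf]) blast
  define v where "v = vbot s"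
  define z where "z = D1 *v vtop s + D2 *v v"
  have z1: "adj_mat D1 *v z = 0" and z2: "adj_mat D2 *v z = \<gamma>\<^sup>2 *\<^sub>R v"
    using s unfolding W_mult_vec z_def v_def by (simp_all add: block_vec_eq_iff)
  have D1z: "inner (D1 *v a) z = 0" for a using inner_adj_right[of a D1 z] z1 by simp
  have D2z: "inner (D2 *v v) z = \<gamma>\<^sup>2 * (norm v)\<^sup>2"
    using inner_adj_right[of v D2 z] z2 by (simp add: power2_norm_eq_inner)
  have "(norm z)\<^sup>2 = inner z z" by (rule power2_norm_eq_inner)
  also have "\<dots> = \<gamma>\<^sup>2 * (norm v)\<^sup>2"
    using D1z D2z by (subst z_def) (simp add: inner_add_left)
  finally have zz: "(norm z)\<^sup>2 = (\<gamma> * norm v)\<^sup>2" by (simp add: power_mult_distrib)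
  have zv: "norm z = \<gamma> * norm v" using power2_eq_imp_eq[OF zz] g by simp
  have "\<gamma>\<^sup>2 * (norm v)\<^sup>2 = inner ((D2 + D1 ** F2) *v v) z"
    using D1z[of "F2 *v v"] D2z
    by (simp add: matrix_vector_mult_add_rdistrib inner_add_left flip: matrix_vector_mul_assoc)
  also have "\<dots> \<le> norm ((D2 + D1 ** F2) *v v) * norm z" by (rule norm_cauchy_schwarz)
  also have "\<dots> \<le> (g * norm v) * (\<gamma> * norm v)" unfolding zv using gain g by (intro mult_right_mono) auto
  finally have "(\<gamma> * (\<gamma> - g)) * (norm v)\<^sup>2 \<le> 0" by (simp add: power2_eq_square algebra_simps)
  moreover have "\<gamma> * (\<gamma> - g) > 0" using g by simp
  ultimately have "(norm v)\<^sup>2 \<le> 0" by (metis mult_pos_pos not_less)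
  then have v0: "v = 0" by simp
  then have "D1 *v vtop s = 0" using zv unfolding z_def by simp
  then have "vtop s = 0" using ker by blast
  then show "s = 0" using v0 unfolding v_def by (simp add: block_vec_eq_iff)
qed

lemma W_Z: "W *v (Z *v s) = - vjoin (adj_mat D1 *v (C *v vtop s) + adj_mat B *v vbot s)
    (adj_mat D2 *v (C *v vtop s) + adj_mat E *v vbot s)"
  unfolding Z_def game_policy_def
  by (simp add: matrix_vector_mult_uminus matrix_vector_mult_uminus_right matrix_vector_mul_assoc
      matrix_mul_assoc matrix_inv_right[OF W_invertible])
    (simp add: hblock_mult_vec vblock_mult_vec block_vec_eq_iff matrix_vector_mul_assoc)

lemma H_mult_vec: "H *v s = vjoin (A *v vtop s + B *v vtop (Z *v s) + E *v vbot (Z *v s))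
    (- (adj_mat A *v vbot s) - adj_mat C *v (C *v vtop s + D1 *v vtop (Z *v s) + D2 *v vbot (Z *v s)))"
  unfolding H_def game_hamiltonian_def
  by (simp add: matrix_vector_mult_add_rdistrib block22_mult_vec vblock_mult_vec hblock_mult_vec
      block_vec_eq_iff matrix_vector_mult_uminus matrix_vector_right_distrib flip: matrix_vector_mul_assoc)

text \<open>The preliminary feedback \<open>u = F1 x + F2 w + v\<close> turns the problem into one with a stable \<open>A\<close>
  and leaves the Hamiltonian matrix unchanged.\<close>

abbreviation "y s \<equiv> C *v vtop s + D1 *v vtop (Z *v s) + D2 *v vbot (Z *v s)"
abbreviation "u s \<equiv> vtop (Z *v s) - F1 *v vtop s - F2 *v vbot (Z *v s)"
abbreviation "Wm \<equiv> hblock 0 (mat 1) ** Z"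
abbreviation "feedback_game g \<equiv> game_system (A + B ** F1) B (C + D1 ** F1) D1 (D2 + D1 ** F2) (E + B ** F2)
  \<gamma> g (of_mat H) u Wm y"

lemma game_system:
  obtains g where "feedback_game g"
    "\<And>v. norm ((D2 + D1 ** F2) *v v) \<le> g * norm v"
proof (rule hinf_gain[OF stable hinf])
  fix g assume g: "0 \<le> g" "g < \<gamma>"
    and gain: "\<And>z x v. Re z = 0 \<Longrightarrow> z *s x = (A + B ** F1) *v x + (E + B ** F2) *v v \<Longrightarrow>
      norm ((C + D1 ** F1) *v x + (D2 + D1 ** F2) *v v) \<le> g * norm v"
    and D2: "\<And>v. norm ((D2 + D1 ** F2) *v v) \<le> g * norm v"
  have adj_feedback: "adj_mat (M + N ** F) *v a = adj_mat M *v a + adj_mat F *v (adj_mat N *v a)"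
    for M :: "complex^'i^'j" and N :: "complex^'k^'j" and F :: "complex^'i^'k" and a
  proof -
    have "inner b (adj_mat (M + N ** F) *v a) = inner b (adj_mat M *v a + adj_mat F *v (adj_mat N *v a))" for b
      by (simp add: inner_adj_right inner_add_right matrix_vector_mult_add_rdistrib inner_add_left
          flip: matrix_vector_mul_assoc)
    then show ?thesis by (metis vector_eq_ldot)
  qed
  have Wm: "Wm *v s = vbot (Z *v s)" for s
    by (simp add: hblock_mult_vec flip: matrix_vector_mul_assoc)
  have eqs: "adj_mat B *v vbot s + adj_mat D1 *v y s = 0"
    "adj_mat E *v vbot s + adj_mat D2 *v y s = \<gamma>\<^sup>2 *\<^sub>R vbot (Z *v s)" for s
  proof -
    have "adj_mat D1 *v (D1 *v vtop (Z *v s) + D2 *v vbot (Z *v s)) = - (adj_mat D1 *v (C *v vtop s) + adj_mat B *v vbot s)"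
      "adj_mat D2 *v (D1 *v vtop (Z *v s) + D2 *v vbot (Z *v s)) - \<gamma>\<^sup>2 *\<^sub>R vbot (Z *v s) =
        - (adj_mat D2 *v (C *v vtop s) + adj_mat E *v vbot s)"
      using W_Z[of s] unfolding W_mult_vec by (simp_all add: block_vec_eq_iff)
    then show "adj_mat B *v vbot s + adj_mat D1 *v y s = 0"
      "adj_mat E *v vbot s + adj_mat D2 *v y s = \<gamma>\<^sup>2 *\<^sub>R vbot (Z *v s)"
      by (simp_all add: matrix_vector_right_distrib algebra_simps eq_neg_iff_add_eq_0)
  qed
  have "feedback_game g"
  proof
    show "complex_exp_stable (A + B ** F1)" "0 \<le> g" "g < \<gamma>" by (fact stable g)+
    show "norm ((C + D1 ** F1) *v x + (D2 + D1 ** F2) *v v) \<le> g * norm v"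
      if "Re z = 0" "z *s x = (A + B ** F1) *v x + (E + B ** F2) *v v" for z x v
      by (rule gain[OF that])
    show "x = 0" if "Re z = 0" "z *s x = (A + B ** F1) *v x + B *v v" "(C + D1 ** F1) *v x + D1 *v v = 0" for z x v
    proof (rule pencil_injective[OF left no_zeros[OF that(1)], of x "F1 *v x + v"])
      show "z *s x = A *v x + B *v (F1 *v x + v)" "C *v x + D1 *v (F1 *v x + v) = 0"
        using that(2,3) by (simp_all add: matrix_vector_mult_add_rdistrib matrix_vector_right_distrib
            add.assoc flip: matrix_vector_mul_assoc)
    qed
    fix s
    show "y s = (C + D1 ** F1) *v vtop s + D1 *v u s
        + (D2 + D1 ** F2) *v (Wm *v s)"
      unfolding Wm by (simp add: matrix_vector_mult_add_rdistrib matrix_vector_mult_diff_distrib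
          flip: matrix_vector_mul_assoc)
    show "adj_mat B *v vbot s + adj_mat D1 *v y s = 0" by (rule eqs)
    \<comment> \<open>The correction due to the feedback is the adjoint of \<open>F2\<close> applied
      to the stationarity condition for the control, hence 0; likewise for \<open>F1\<close>
      below.\<close>
    have "adj_mat (E + B ** F2) *v vbot s + adj_mat (D2 + D1 ** F2) *v y s =
      (adj_mat E *v vbot s + adj_mat D2 *v y s) + adj_mat F2 *v (adj_mat B *v vbot s + adj_mat D1 *v y s)"
      unfolding adj_feedback matrix_vector_right_distrib[of "adj_mat F2"] by simp
    then show "adj_mat (E + B ** F2) *v vbot s + adj_mat (D2 + D1 ** F2) *v y s =
      \<gamma>\<^sup>2 *\<^sub>R (Wm *v s)"
      unfolding eqs Wm by simp
    show "vtop (to_mat (of_mat H) *v s) = (A + B ** F1) *v vtop s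
        + B *v u s + (E + B ** F2) *v (Wm *v s)"
      unfolding Wm by (simp add: H_mult_vec matrix_vector_mult_add_rdistrib matrix_vector_mult_diff_distrib
          flip: matrix_vector_mul_assoc)
    have "adj_mat (A + B ** F1) *v vbot s + adj_mat (C + D1 ** F1) *v y s =
      (adj_mat A *v vbot s + adj_mat C *v y s) + adj_mat F1 *v (adj_mat B *v vbot s + adj_mat D1 *v y s)"
      unfolding adj_feedback matrix_vector_right_distrib[of "adj_mat F1"] by simp
    then have "adj_mat (A + B ** F1) *v vbot s + adj_mat (C + D1 ** F1) *v y s = adj_mat A *v vbot s + adj_mat C *v y s"
      unfolding eqs by simp
    moreover have "vbot (to_mat (of_mat H) *v s) = - (adj_mat A *v vbot s + adj_mat C *v y s)"
      by (simp add: H_mult_vec)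
    ultimately have "vbot (to_mat (of_mat H) *v s) =
      - (adj_mat (A + B ** F1) *v vbot s + adj_mat (C + D1 ** F1) *v y s)" by (simp only:)
    then show "vbot (to_mat (of_mat H) *v s) = - (adj_mat (A + B ** F1) *v vbot s) - adj_mat (C + D1 ** F1) *v y s"
      by (simp only: minus_add_distrib diff_conv_add_uminus)
  qed
  then show thesis using D2 by (rule that)
qed

lemma no_imaginary_eigenvalue: "Re z = 0 \<Longrightarrow> \<not> is_eigenvalue H z"
  by (rule game_system) (drule game_system.no_imaginary_eigenvalue, auto)

context
  fixes Q :: "(complex, 'n + 'n) sqmat"
  assumes Q: "stable_projection (of_mat H) Q"
begin

lemma projection:
  shows "hamiltonian_projection (of_mat H) Q" "pos_semidef (graph_mat (to_mat Q))"
proof -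
  obtain g where g: "feedback_game g"
    "\<And>v. norm ((D2 + D1 ** F2) *v v) \<le> g * norm v"
    by (rule game_system) blast
  interpret game_projection "A + B ** F1" B "C + D1 ** F1" D1 "D2 + D1 ** F2" "E + B ** F2" \<gamma> g
      "of_mat H" u Wm y Q
    by (intro game_projection.intro game_projection_axioms.intro) (fact g Q)+
  show "hamiltonian_projection (of_mat H) Q" by (rule hamiltonian_projection)
  show "pos_semidef (graph_mat (to_mat Q))" by (rule pos_semidef_graph_mat)
qed

abbreviation "P \<equiv> graph_mat (to_mat Q)"
abbreviation "V \<equiv> vblock (adj_mat B ** P + adj_mat D1 ** C) (adj_mat E ** P + adj_mat D2 ** C)"
abbreviation "Acl \<equiv> A - hblock B E ** matrix_inv W ** V"

lemma Z_graph: "Z *v vjoin x (P *v x) = - (matrix_inv W *v (V *v x))"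
  unfolding Z_def game_policy_def
  by (simp add: matrix_vector_mult_uminus hblock_mult_vec vblock_mult_vec matrix_vector_mult_add_rdistrib
      flip: matrix_vector_mul_assoc)
    (rule arg_cong[where f = "\<lambda>x. matrix_inv W *v x"], simp add: block_vec_eq_iff add.commute)

lemma closed_loop: "vtop (H *v vjoin x (P *v x)) = Acl *v x"
proof -
  have "hblock B E *v s = B *v vtop s + E *v vbot s" for s by (rule hblock_mult_vec)
  then have "Acl *v x = A *v x + (B *v vtop (Z *v vjoin x (P *v x)) + E *v vbot (Z *v vjoin x (P *v x)))"
    unfolding Z_graph by (simp add: matrix_vector_mult_diff_rdistrib matrix_vector_mult_uminus_right
        flip: matrix_vector_mul_assoc)
  then show ?thesis by (simp add: H_mult_vec)
qed

lemma graph_invariant: "H *v vjoin x (P *v x) = vjoin (Acl *v x) (P *v (Acl *v x))"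
  using hamiltonian_projection.graph_invariant[OF projection(1), of x "vtop (H *v vjoin x (P *v x))" "vbot (H *v vjoin x (P *v x))"]
  by (simp add: block_vec_eq_iff closed_loop)

text \<open>The lower component of the invariance of the graph under \<open>H\<close>, with control
  and disturbance eliminated through \<open>Z_graph\<close>.\<close>

lemma riccati_equation:
  "adj_mat A ** P + P ** A + adj_mat C ** C
    - hblock (P ** B + adj_mat C ** D1) (P ** E + adj_mat C ** D2) ** matrix_inv W ** V = 0"
proof -
  have "(adj_mat A ** P + P ** A + adj_mat C ** C
    - hblock (P ** B + adj_mat C ** D1) (P ** E + adj_mat C ** D2) ** matrix_inv W ** V) *v x = 0 *v x" for x
  proof -
    define \<zeta> where "\<zeta> = Z *v vjoin x (P *v x)"
    have \<zeta>: "matrix_inv W *v (V *v x) = - \<zeta>" unfolding \<zeta>_def Z_graph by simp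
    have "vbot (H *v vjoin x (P *v x)) = P *v vtop (H *v vjoin x (P *v x))"
      unfolding graph_invariant by simp
    then have "- (adj_mat A *v (P *v x)) - adj_mat C *v (C *v x + D1 *v vtop \<zeta> + D2 *v vbot \<zeta>) =
      P *v (A *v x + B *v vtop \<zeta> + E *v vbot \<zeta>)"
      unfolding H_mult_vec \<zeta>_def by simp
    then have eq: "adj_mat A *v (P *v x) + P *v (A *v x) + adj_mat C *v (C *v x)
      + ((P *v (B *v vtop \<zeta>) + adj_mat C *v (D1 *v vtop \<zeta>)) + (P *v (E *v vbot \<zeta>) + adj_mat C *v (D2 *v vbot \<zeta>))) = 0"
      by (simp add: matrix_vector_right_distrib algebra_simps eq_neg_iff_add_eq_0 neg_eq_iff_add_eq_0)
    have "(adj_mat A ** P + P ** A + adj_mat C ** C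
        - hblock (P ** B + adj_mat C ** D1) (P ** E + adj_mat C ** D2) ** matrix_inv W ** V) *v x =
      adj_mat A *v (P *v x) + P *v (A *v x) + adj_mat C *v (C *v x)
        - hblock (P ** B + adj_mat C ** D1) (P ** E + adj_mat C ** D2) *v (matrix_inv W *v (V *v x))"
      by (simp add: matrix_vector_mult_diff_rdistrib matrix_vector_mult_add_rdistrib flip: matrix_vector_mul_assoc)
    also have "hblock (P ** B + adj_mat C ** D1) (P ** E + adj_mat C ** D2) *v (matrix_inv W *v (V *v x)) =
      - ((P *v (B *v vtop \<zeta>) + adj_mat C *v (D1 *v vtop \<zeta>)) + (P *v (E *v vbot \<zeta>) + adj_mat C *v (D2 *v vbot \<zeta>)))"
      unfolding \<zeta> matrix_vector_mult_uminus_right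
      by (simp only: hblock_mult_vec matrix_vector_mult_add_rdistrib matrix_vector_mul_assoc[symmetric])
    finally show ?thesis unfolding diff_minus_eq_add eq by simp
  qed
  then show ?thesis by (metis matrix_eq)
qed

text \<open>An eigenvector \<open>x\<close> of the closed loop lifts to the eigenvector (x, P x) of
  \<open>H\<close> in the range of the stable projection, with the same eigenvalue.\<close>

lemma closed_loop_stable: "complex_exp_stable Acl"
  unfolding complex_exp_stable_def
proof (intro allI impI)
  fix l assume "is_eigenvalue Acl l"
  then obtain x where x: "x \<noteq> 0" "Acl *v x = l *s x" unfolding is_eigenvalue_def by blast
  show "Re l < 0"
  proof (rule projection_eigenvalue_stable[OF Q])
    show "to_mat Q *v vjoin x (P *v x) = vjoin x (P *v x)"
      by (rule hamiltonian_projection.graph_in_range[OF projection(1)])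
    show "vjoin x (P *v x) \<noteq> 0" using x(1) by (simp add: block_vec_eq_iff)
    show "to_mat (of_mat H) *v vjoin x (P *v x) = l *s vjoin x (P *v x)"
      by (simp add: graph_invariant x(2) block_vec_eq_iff vector_scalar_commute)
  qed
qed

end

end

section \<open>Assembly over the algebra\<close>

lemma gelfand_mat_hblock: "gelfand_mat (hblock M N) \<phi> = hblock (gelfand_mat M \<phi>) (gelfand_mat N \<phi>)"
  by (simp add: vec_eq_iff hblock_def split: sum.split)

lemma gelfand_mat_vblock: "gelfand_mat (vblock M N) \<phi> = vblock (gelfand_mat M \<phi>) (gelfand_mat N \<phi>)"
  by (simp add: vec_eq_iff vblock_def split: sum.split)

lemma gelfand_mat_block22: "gelfand_mat (block22 M11 M12 M21 M22) \<phi> =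
    block22 (gelfand_mat M11 \<phi>) (gelfand_mat M12 \<phi>) (gelfand_mat M21 \<phi>) (gelfand_mat M22 \<phi>)"
  unfolding block22_def gelfand_mat_vblock gelfand_mat_hblock ..

lemmas gelfand_mat_simps = gelfand_mat_hblock gelfand_mat_vblock gelfand_mat_block22 gelfand_mat_mult
  gelfand_mat_add gelfand_mat_diff gelfand_mat_uminus gelfand_mat_0 gelfand_mat_mat

lemma gelfand_mat_graph_basis:
  "\<phi> \<in> max_ideal_space \<Longrightarrow> gelfand_mat (graph_basis Q) \<phi> = graph_basis (gelfand_mat Q \<phi>)"
  unfolding graph_basis_def sympl_def by (simp add: gelfand_mat_simps character_1)

lemma gelfand_mat_graph_gram:
  "\<phi> \<in> max_ideal_space \<Longrightarrow> gelfand_mat (graph_gram Q) \<phi> = graph_gram (gelfand_mat Q \<phi>)"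
  unfolding graph_gram_def by (simp add: gelfand_mat_simps character_1 gelfand_mat_graph_basis)

lemma gelfand_mat_graph_mat:
  fixes Q :: "'a::comm_complex_banach_algebra_1^('n::finite + 'n)^('n + 'n)"
  assumes "\<phi> \<in> max_ideal_space" "invertible (graph_gram Q)"
  shows "gelfand_mat (graph_mat Q) \<phi> = graph_mat (gelfand_mat Q \<phi>)"
  using assms unfolding graph_mat_def
  by (simp add: gelfand_mat_simps character_1 gelfand_mat_graph_basis gelfand_mat_inverse gelfand_mat_graph_gram)

lemma sq_gelfand_stable_projection:
  assumes p: "\<phi> \<in> max_ideal_space" and Q: "stable_projection H Q"
  shows "stable_projection (sq_gelfand \<phi> H) (sq_gelfand \<phi> Q)"
  using sq_gelfand_tendsto_0[OF p stable_projectionD(3)[OF Q]] sq_gelfand_tendsto_0[OF p stable_projectionD(4)[OF Q]]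
    stable_projectionD(1,2)[OF Q] p
  by (simp add: stable_projection_def sq_gelfand_uminus sq_gelfand_diff sq_gelfand_1 flip: sq_gelfand_mult)

theorem theorem1p3:
  fixes star :: "'a::comm_complex_banach_algebra_1 \<Rightarrow> 'a"
    and \<gamma> :: real
    and A :: "'a^'n^'n" and B :: "'a^'m^'n" and C :: "'a^'n^'p"
    and D1 :: "'a^'m^'p" and D2 :: "'a^'l^'p" and E :: "'a^'l^'n"
  assumes semisimple: "semisimple TYPE('a)"
    and involution: "is_involution star"
    and gamma: "\<gamma> > 0"
    and symmetric: "\<And>\<phi>. \<phi> \<in> max_ideal_space \<Longrightarrow>
        gelfand_mat (star_mat star A) \<phi> = adj_mat (gelfand_mat A \<phi>) \<and>
        gelfand_mat (star_mat star B) \<phi> = adj_mat (gelfand_mat B \<phi>) \<and>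
        gelfand_mat (star_mat star C) \<phi> = adj_mat (gelfand_mat C \<phi>) \<and>
        gelfand_mat (star_mat star D1) \<phi> = adj_mat (gelfand_mat D1 \<phi>) \<and>
        gelfand_mat (star_mat star D2) \<phi> = adj_mat (gelfand_mat D2 \<phi>) \<and>
        gelfand_mat (star_mat star E) \<phi> = adj_mat (gelfand_mat E \<phi>)"
    and left_inv: "\<And>\<phi>. \<phi> \<in> max_ideal_space \<Longrightarrow>
        left_invertible_system (gelfand_mat A \<phi>) (gelfand_mat B \<phi>)
          (gelfand_mat C \<phi>) (gelfand_mat D1 \<phi>)"
    and hinf: "\<And>\<phi>. \<phi> \<in> max_ideal_space \<Longrightarrow>
        \<exists>(F1 :: complex^'n^'m) (F2 :: complex^'l^'m).
          complex_exp_stable (gelfand_mat A \<phi> + gelfand_mat B \<phi> ** F1) \<and>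
          hinf_norm (transfer_mat
            (gelfand_mat A \<phi> + gelfand_mat B \<phi> ** F1)
            (gelfand_mat E \<phi> + gelfand_mat B \<phi> ** F2)
            (gelfand_mat C \<phi> + gelfand_mat D1 \<phi> ** F1)
            (gelfand_mat D2 \<phi> + gelfand_mat D1 \<phi> ** F2)) < ereal \<gamma>"
    and no_zeros: "\<And>\<phi> s0. \<phi> \<in> max_ideal_space \<Longrightarrow> Re s0 = 0 \<Longrightarrow>
        \<not> invariant_zero (gelfand_mat A \<phi>) (gelfand_mat B \<phi>)
            (gelfand_mat C \<phi>) (gelfand_mat D1 \<phi>) s0"
    and ker_D1: "\<And>\<phi>. \<phi> \<in> max_ideal_space \<Longrightarrow>
        {v. gelfand_mat D1 \<phi> *v v = 0} = {0}"
  shows "\<exists>P :: 'a^'n^'n.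
    (let W = block22
               (star_mat star D1 ** D1) (star_mat star D1 ** D2)
               (star_mat star D2 ** D1) (star_mat star D2 ** D2 - mat (of_real (\<gamma>\<^sup>2)));
         V = vblock (star_mat star B ** P + star_mat star D1 ** C)
               (star_mat star E ** P + star_mat star D2 ** C);
         Acl = A - hblock B E ** matrix_inv W ** V
     in invertible W \<and>
        0 = star_mat star A ** P + P ** A + star_mat star C ** C
            - hblock (P ** B + star_mat star C ** D1) (P ** E + star_mat star C ** D2)
              ** matrix_inv W ** V \<and>
        exp_stable Acl \<and>
        (\<forall>\<phi>\<in>max_ideal_space. pos_semidef (gelfand_mat P \<phi>)))"
proof -
  define As Bs Cs D1s D2s Es where "As = star_mat star A" "Bs = star_mat star B" "Cs = star_mat star C"
    "D1s = star_mat star D1" "D2s = star_mat star D2" "Es = star_mat star E"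
  note star_defs = this
  have star: "gelfand_mat As \<phi> = adj_mat (gelfand_mat A \<phi>)" "gelfand_mat Bs \<phi> = adj_mat (gelfand_mat B \<phi>)"
    "gelfand_mat Cs \<phi> = adj_mat (gelfand_mat C \<phi>)" "gelfand_mat D1s \<phi> = adj_mat (gelfand_mat D1 \<phi>)"
    "gelfand_mat D2s \<phi> = adj_mat (gelfand_mat D2 \<phi>)" "gelfand_mat Es \<phi> = adj_mat (gelfand_mat E \<phi>)"
    if "\<phi> \<in> max_ideal_space" for \<phi>
    using symmetric[OF that] unfolding star_defs by auto
  have "\<exists>F1 F2. pointwise_problem (gelfand_mat A \<phi>) (gelfand_mat B \<phi>) (gelfand_mat C \<phi>) (gelfand_mat D1 \<phi>)
      (gelfand_mat D2 \<phi>) (gelfand_mat E \<phi>) \<gamma> F1 F2" if p: "\<phi> \<in> max_ideal_space" for \<phi>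
    using hinf[OF p] left_inv[OF p] no_zeros[OF p] ker_D1[OF p] unfolding pointwise_problem_def by blast
  then obtain F1 F2 where pw: "\<And>\<phi>. \<phi> \<in> max_ideal_space \<Longrightarrow>
      pointwise_problem (gelfand_mat A \<phi>) (gelfand_mat B \<phi>) (gelfand_mat C \<phi>) (gelfand_mat D1 \<phi>)
        (gelfand_mat D2 \<phi>) (gelfand_mat E \<phi>) \<gamma> (F1 \<phi>) (F2 \<phi>)" by metis
  define c :: 'a where "c = of_real (\<gamma>\<^sup>2)"
  have c: "\<phi> c = of_real (\<gamma>\<^sup>2)" if "\<phi> \<in> max_ideal_space" for \<phi>
    unfolding c_def using that by (rule character_of_real)
  define W where "W = game_weight D1 D2 D1s D2s c"
  have W: "gelfand_mat W \<phi> = pointwise_problem.W (gelfand_mat D1 \<phi>) (gelfand_mat D2 \<phi>) \<gamma>"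
    if p: "\<phi> \<in> max_ideal_space" for \<phi>
    unfolding pointwise_problem.W_def[OF pw[OF p]] W_def game_weight_def
    by (simp add: gelfand_mat_simps p star c del: of_real_power)
  have W_inv: "invertible W"
    by (rule invertible_if_gelfand_mat_invertible) (simp add: W pointwise_problem.W_invertible[OF pw])
  define Z where "Z = game_policy C Bs D1s D2s Es (matrix_inv W)"
  have Z: "gelfand_mat Z \<phi> = pointwise_problem.Z (gelfand_mat B \<phi>) (gelfand_mat C \<phi>) (gelfand_mat D1 \<phi>)
      (gelfand_mat D2 \<phi>) (gelfand_mat E \<phi>) \<gamma>" if p: "\<phi> \<in> max_ideal_space" for \<phi>
    unfolding pointwise_problem.Z_def[OF pw[OF p]] Z_def game_policy_def
    by (simp add: gelfand_mat_simps p star gelfand_mat_inverse W_inv W)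
  define H where "H = game_hamiltonian A B C D1 D2 E As Cs Z"
  have H: "gelfand_mat H \<phi> = pointwise_problem.H (gelfand_mat A \<phi>) (gelfand_mat B \<phi>) (gelfand_mat C \<phi>) (gelfand_mat D1 \<phi>)
      (gelfand_mat D2 \<phi>) (gelfand_mat E \<phi>) \<gamma>" if p: "\<phi> \<in> max_ideal_space" for \<phi>
    unfolding pointwise_problem.H_def[OF pw[OF p]] H_def game_hamiltonian_def
    by (simp add: gelfand_mat_simps p star Z)
  have "\<not> is_eigenvalue (gelfand_mat (to_mat (of_mat H)) \<phi>) z" if p: "\<phi> \<in> max_ideal_space" "Re z = 0" for \<phi> z
    using pointwise_problem.no_imaginary_eigenvalue[OF pw[OF p(1)] p(2)] by (simp add: H p(1))
  \<comment> \<open>A single projection over the algebra; at each character its transform is a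
    stable projection of the pointwise Hamiltonian matrix, so all pointwise results apply to
    it.\<close>
  then obtain Q where Q: "stable_projection (of_mat H) Q"
    by (rule spectral_projection)
  have Q_hat: "stable_projection (of_mat (gelfand_mat H \<phi>)) (sq_gelfand \<phi> Q)" if p: "\<phi> \<in> max_ideal_space" for \<phi>
    using sq_gelfand_stable_projection[OF p Q] by (simp add: sq_gelfand_def[of \<phi> "of_mat H"])
  \<comment> \<open>Without this, \<open>matrix_inv\<close> would be an unspecified value, and the
    transform of \<open>P\<close> could not be identified with the pointwise solution.\<close>
  have gram: "invertible (graph_gram (to_mat Q))"
  proof (rule invertible_if_gelfand_mat_invertible)
    fix \<phi> :: "'a \<Rightarrow> complex" assume p: "\<phi> \<in> max_ideal_space"
    show "invertible (gelfand_mat (graph_gram (to_mat Q)) \<phi>)"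
      using hamiltonian_projection.graph_gram_invertible[OF pointwise_problem.projection(1)[OF pw[OF p] Q_hat[OF p, unfolded H[OF p]]]]
      by (simp add: gelfand_mat_graph_gram p)
  qed
  define P where "P = graph_mat (to_mat Q)"
  have P: "gelfand_mat P \<phi> = graph_mat (to_mat (sq_gelfand \<phi> Q))" if p: "\<phi> \<in> max_ideal_space" for \<phi>
    unfolding P_def by (simp add: gelfand_mat_graph_mat p gram)
  define V where "V = vblock (Bs ** P + D1s ** C) (Es ** P + D2s ** C)"
  define Acl where "Acl = A - hblock B E ** matrix_inv W ** V"
  have "0 = As ** P + P ** A + Cs ** C - hblock (P ** B + Cs ** D1) (P ** E + Cs ** D2) ** matrix_inv W ** V"
  proof (rule gelfand_mat_eqI[OF semisimple])
    fix \<phi> :: "'a \<Rightarrow> complex" assume p: "\<phi> \<in> max_ideal_space"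
    show "gelfand_mat 0 \<phi> = gelfand_mat (As ** P + P ** A + Cs ** C
        - hblock (P ** B + Cs ** D1) (P ** E + Cs ** D2) ** matrix_inv W ** V) \<phi>"
      using pointwise_problem.riccati_equation[OF pw[OF p] Q_hat[OF p, unfolded H[OF p]]]
      unfolding V_def by (simp add: gelfand_mat_simps p star P gelfand_mat_inverse W_inv W)
  qed
  moreover have "exp_stable Acl"
  proof (rule exp_stable_if_pointwise_stable[OF semisimple])
    fix \<phi> :: "'a \<Rightarrow> complex" assume p: "\<phi> \<in> max_ideal_space"
    show "complex_exp_stable (gelfand_mat Acl \<phi>)"
      using pointwise_problem.closed_loop_stable[OF pw[OF p] Q_hat[OF p, unfolded H[OF p]]]
      unfolding Acl_def V_def by (simp add: gelfand_mat_simps p star P gelfand_mat_inverse W_inv W)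
  qed
  moreover have "pos_semidef (gelfand_mat P \<phi>)" if p: "\<phi> \<in> max_ideal_space" for \<phi>
    unfolding P[OF p] by (rule pointwise_problem.projection(2)[OF pw[OF p] Q_hat[OF p, unfolded H[OF p]]])
  ultimately show ?thesis
    using W_inv unfolding Acl_def V_def W_def game_weight_def c_def star_defs Let_def by blast
qed

end
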